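(* Let $\mathcal{A}$ be an accessible additive category with arbitrary coproducts and let $\mathcal{B}$ be a class of objects of $\mathcal{A}$ closed under taking coproducts. Then the following assertions are equivalent: (1) $\mathbf{K}(\mathcal{B})$ is well generated. (2) $\mathcal{B}\subseteq\operatorname{Add}(\mathcal{S})$ for some set $\mathcal{S}\subseteq\mathcal{B}$.
   Context: For a regular cardinal $\kappa$, a $\kappa$-direct limit is a direct limit over a $\kappa$-directed set (each subset of cardinality $<\kappa$ has an upper bound). An object $M$ of a category $\mathcal{D}$ is $\kappa$-presentable if $\operatorname{Hom}_{\mathcal{D}}(M,-)$ preserves all existing $\kappa$-direct limits. $\mathcal{D}$ is $\kappa$-accessible if it has all $\kappa$-direct limits and there is a set of $\kappa$-presentable objects such that every object is a $\kappa$-direct limit of these; accessible means $\kappa$-accessible for some regular $\kappa$. $\operatorname{Add}(\mathcal{S})$ is the class of all direct summands of arbitrary set-indexed coproducts of objects from $\mathcal{S}$. $\mathbf{K}(\mathcal{B})$ is the homotopy category of (unbounded) complexes with all components in $\mathcal{B}$. An additive category $\mathcal{D}$ with arbitrary coproducts is $\kappa$-well generated by a set $\mathcal{D}_0$ of objects ($\kappa$ a regular cardinal) if: (1) every non-zero $M\in\mathcal{D}$ receives a non-zero morphism from some $X\in\mathcal{D}_0$; (2) each $X\in\mathcal{D}_0$ is $\kappa$-small relative to split monomorphisms, i.e. for all ordinals $\lambda$ of cofinality $\ge\kappa$ and all $\lambda$-sequences $(Y_\alpha)_{\alpha<\lambda}$ having a colimit in $\mathcal{D}$ and with all $Y_\alpha\to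 Y_{\alpha+1}$ split monomorphisms, the map $\operatorname{colim}\operatorname{Hom}(X,Y_\alpha)\to\operatorname{Hom}(X,\operatorname{colim}Y_\alpha)$ is an isomorphism (a $\lambda$-sequence is a direct system indexed by $\lambda$ such that for each limit ordinal $\gamma<\lambda$ the colimit $\operatorname{colim}_{\alpha<\gamma}Y_\alpha$ exists and maps isomorphically to $Y_\gamma$); (3) for each morphism $f:X\to\coprod_{i\in I}M_i$ with $X\in\mathcal{D}_0$ there are morphisms $f_i:X_i\to M_i$ with $X_i\in\mathcal{D}_0$ such that $f$ factors as $X\to\coprod_i X_i\xrightarrow{\coprod f_i}\coprod_i M_i$. $\mathcal{D}$ is well generated if it is $\kappa$-well generated by some set of objects for some regular cardinal $\kappa$. *)

theory Defs
  imports "HOL-Algebra.Group"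
begin

unbundle cardinal_syntax

text \<open>
  Sets versus classes.  A strongly inaccessible cardinal \<open>U\<close> plays the role of the class of all
  sets: a ``set'' is a collection with fewer than \<open>U\<close> elements, a ``class'' is an arbitrary
  collection.  A predicate cannot quantify over index types, so index sets, posets, cardinals and
  ordinals are all taken on the type carrying \<open>U\<close>.  This loses nothing: each collection with
  fewer than \<open>U\<close> elements is in bijection with a subset of that type.
\<close>

definition regular_cardinal :: "'u rel \<Rightarrow> bool" where
  "regular_cardinal \<kappa> \<longleftrightarrow> Cinfinite \<kappa> \<and> regularCard \<kappa>"

definition inaccessible :: "'u rel \<Rightarrow> bool" where
  "inaccessible U \<longleftrightarrow> regular_cardinal U \<and> natLeq <o U \<and>
     (\<forall>X :: 'u set. |X| <o U \<longrightarrow> |Pow X| <o U)"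

definition small :: "'u rel \<Rightarrow> 'a set \<Rightarrow> bool" where
  "small U X \<longleftrightarrow> |X| <o U"


section \<open>Categories and additive categories\<close>

record ('o, 'm) cat =
  Ob :: "'o set"
  Arr :: "'m set"
  Dom :: "'m \<Rightarrow> 'o"
  Cod :: "'m \<Rightarrow> 'o"
  Id :: "'o \<Rightarrow> 'm"
  Comp :: "'m \<Rightarrow> 'm \<Rightarrow> 'm" (infixr \<open>\<cdot>\<index>\<close> 70)

definition Hom :: "('o, 'm, 'z) cat_scheme \<Rightarrow> 'o \<Rightarrow> 'o \<Rightarrow> 'm set" where
  "Hom C X Y = {f \<in> Arr C. Dom C f = X \<and> Cod C f = Y}"

locale category =
  fixes C :: "('o, 'm, 'z) cat_scheme" (structure)
  assumes dom_cod: "f \<in> Arr C \<Longrightarrow> Dom C f \<in> Ob C \<and> Cod C f \<in> Ob C"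
    and id_hom: "X \<in> Ob C \<Longrightarrow> Id C X \<in> Hom C X X"
    and comp_hom: "\<lbrakk>g \<in> Hom C Y Z; f \<in> Hom C X Y\<rbrakk> \<Longrightarrow> g \<cdot> f \<in> Hom C X Z"
    and id_left: "f \<in> Hom C X Y \<Longrightarrow> Id C Y \<cdot> f = f"
    and id_right: "f \<in> Hom C X Y \<Longrightarrow> f \<cdot> Id C X = f"
    and comp_assoc:
      "\<lbrakk>h \<in> Hom C Y Z; g \<in> Hom C X Y; f \<in> Hom C W X\<rbrakk> \<Longrightarrow> (h \<cdot> g) \<cdot> f = h \<cdot> (g \<cdot> f)"

definition locally_small :: "'u rel \<Rightarrow> ('o, 'm, 'z) cat_scheme \<Rightarrow> bool" where
  "locally_small U C \<longleftrightarrow> (\<forall>X\<in>Ob C. \<forall>Y\<in>Ob C. small U (Hom C X Y))"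

definition isomorphism :: "('o, 'm, 'z) cat_scheme \<Rightarrow> 'o \<Rightarrow> 'o \<Rightarrow> 'm \<Rightarrow> bool" where
  "isomorphism C X Y f \<longleftrightarrow> f \<in> Hom C X Y \<and>
     (\<exists>g\<in>Hom C Y X. g \<cdot>\<^bsub>C\<^esub> f = Id C X \<and> f \<cdot>\<^bsub>C\<^esub> g = Id C Y)"

definition split_mono :: "('o, 'm, 'z) cat_scheme \<Rightarrow> 'o \<Rightarrow> 'o \<Rightarrow> 'm \<Rightarrow> bool" where
  "split_mono C X Y f \<longleftrightarrow> f \<in> Hom C X Y \<and> (\<exists>g\<in>Hom C Y X. g \<cdot>\<^bsub>C\<^esub> f = Id C X)"

definition zero_object :: "('o, 'm, 'z) cat_scheme \<Rightarrow> 'o \<Rightarrow> bool" where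
  "zero_object C Z \<longleftrightarrow> Z \<in> Ob C \<and>
     (\<forall>X\<in>Ob C. (\<exists>!f. f \<in> Hom C Z X) \<and> (\<exists>!f. f \<in> Hom C X Z))"

definition coproduct ::
  "('o, 'm, 'z) cat_scheme \<Rightarrow> 'i set \<Rightarrow> ('i \<Rightarrow> 'o) \<Rightarrow> 'o \<Rightarrow> ('i \<Rightarrow> 'm) \<Rightarrow> bool" where
  "coproduct C I M P \<iota> \<longleftrightarrow> P \<in> Ob C \<and> (\<forall>i\<in>I. M i \<in> Ob C \<and> \<iota> i \<in> Hom C (M i) P) \<and>
     (\<forall>T\<in>Ob C. \<forall>f. (\<forall>i\<in>I. f i \<in> Hom C (M i) T) \<longrightarrow>
        (\<exists>!h. h \<in> Hom C P T \<and> (\<forall>i\<in>I. h \<cdot>\<^bsub>C\<^esub> \<iota> i = f i)))"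

definition has_coproducts :: "'u rel \<Rightarrow> ('o, 'm, 'z) cat_scheme \<Rightarrow> bool" where
  "has_coproducts U C \<longleftrightarrow>
     (\<forall>(I :: 'u set) M. small U I \<and> (\<forall>i\<in>I. M i \<in> Ob C) \<longrightarrow> (\<exists>P \<iota>. coproduct C I M P \<iota>))"

definition closed_under_coproducts :: "'u rel \<Rightarrow> ('o, 'm, 'z) cat_scheme \<Rightarrow> 'o set \<Rightarrow> bool" where
  "closed_under_coproducts U C B \<longleftrightarrow>
     (\<forall>(I :: 'u set) M P \<iota>.
        small U I \<and> (\<forall>i\<in>I. M i \<in> B) \<and> coproduct C I M P \<iota> \<longrightarrow> P \<in> B)"

record ('o, 'm) preadd = "('o, 'm) cat" +
  hom_zero :: "'o \<Rightarrow> 'o \<Rightarrow> 'm"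
  hom_add :: "'m \<Rightarrow> 'm \<Rightarrow> 'm" (infixl \<open>\<^bold>+\<index>\<close> 65)

locale preadditive_category = category C
  for C :: "('o, 'm, 'z) preadd_scheme" (structure) +
  assumes hom_group: "\<lbrakk>X \<in> Ob C; Y \<in> Ob C\<rbrakk> \<Longrightarrow>
      comm_group \<lparr>carrier = Hom C X Y, mult = hom_add C, one = hom_zero C X Y\<rparr>"
    and comp_add_left: "\<lbrakk>f \<in> Hom C X Y; f' \<in> Hom C X Y; g \<in> Hom C Y Z\<rbrakk> \<Longrightarrow>
      g \<cdot> (f \<^bold>+ f') = (g \<cdot> f) \<^bold>+ (g \<cdot> f')"
    and comp_add_right: "\<lbrakk>f \<in> Hom C X Y; g \<in> Hom C Y Z; g' \<in> Hom C Y Z\<rbrakk> \<Longrightarrow>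
      (g \<^bold>+ g') \<cdot> f = (g \<cdot> f) \<^bold>+ (g' \<cdot> f)"

definition biproduct :: "('o, 'm, 'z) preadd_scheme \<Rightarrow> 'o \<Rightarrow> 'o \<Rightarrow> 'o \<Rightarrow> bool" where
  "biproduct C X Y P \<longleftrightarrow> X \<in> Ob C \<and> Y \<in> Ob C \<and> P \<in> Ob C \<and>
     (\<exists>i\<in>Hom C X P. \<exists>j\<in>Hom C Y P. \<exists>p\<in>Hom C P X. \<exists>q\<in>Hom C P Y.
        p \<cdot>\<^bsub>C\<^esub> i = Id C X \<and> q \<cdot>\<^bsub>C\<^esub> j = Id C Y \<and> (i \<cdot>\<^bsub>C\<^esub> p) \<^bold>+\<^bsub>C\<^esub> (j \<cdot>\<^bsub>C\<^esub> q) = Id C P)"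

locale additive_category = preadditive_category C
  for C :: "('o, 'm, 'z) preadd_scheme" (structure) +
  assumes zero_object: "\<exists>Z. zero_object C Z"
    and biproducts: "\<lbrakk>X \<in> Ob C; Y \<in> Ob C\<rbrakk> \<Longrightarrow> \<exists>P. biproduct C X Y P"

definition direct_summand :: "('o, 'm, 'z) preadd_scheme \<Rightarrow> 'o \<Rightarrow> 'o \<Rightarrow> bool" where
  "direct_summand C X P \<longleftrightarrow> (\<exists>Y. biproduct C X Y P)"

definition Add :: "'u rel \<Rightarrow> ('o, 'm, 'z) preadd_scheme \<Rightarrow> 'o set \<Rightarrow> 'o set" where
  "Add U C S = {X. \<exists>(I :: 'u set) M P \<iota>. small U I \<and> (\<forall>i\<in>I. M i \<in> S) \<and>
     coproduct C I M P \<iota> \<and> direct_summand C X P}"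


section \<open>Direct limits\<close>

text \<open>
  A poset is given by its reflexive order relation \<open>r\<close>, its elements being \<open>Field r\<close>.
\<close>

definition direct_system ::
  "('o, 'm, 'z) cat_scheme \<Rightarrow> 'i rel \<Rightarrow> ('i \<Rightarrow> 'o) \<Rightarrow> ('i \<Rightarrow> 'i \<Rightarrow> 'm) \<Rightarrow> bool" where
  "direct_system C r D t \<longleftrightarrow> Partial_order r \<and>
     (\<forall>i\<in>Field r. D i \<in> Ob C \<and> t i i = Id C (D i)) \<and>
     (\<forall>(i, j)\<in>r. t i j \<in> Hom C (D i) (D j)) \<and>
     (\<forall>i j k. (i, j) \<in> r \<and> (j, k) \<in> r \<longrightarrow> t j k \<cdot>\<^bsub>C\<^esub> t i j = t i k)"

definition cocone ::
  "('o, 'm, 'z) cat_scheme \<Rightarrow> 'i rel \<Rightarrow> ('i \<Rightarrow> 'o) \<Rightarrow> ('i \<Rightarrow> 'i \<Rightarrow> 'm) \<Rightarrow> 'o \<Rightarrow> ('i \<Rightarrow> 'm) \<Rightarrow> bool" where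
  "cocone C r D t L \<iota> \<longleftrightarrow> L \<in> Ob C \<and> (\<forall>i\<in>Field r. \<iota> i \<in> Hom C (D i) L) \<and>
     (\<forall>(i, j)\<in>r. \<iota> j \<cdot>\<^bsub>C\<^esub> t i j = \<iota> i)"

definition colimit ::
  "('o, 'm, 'z) cat_scheme \<Rightarrow> 'i rel \<Rightarrow> ('i \<Rightarrow> 'o) \<Rightarrow> ('i \<Rightarrow> 'i \<Rightarrow> 'm) \<Rightarrow> 'o \<Rightarrow> ('i \<Rightarrow> 'm) \<Rightarrow> bool" where
  "colimit C r D t L \<iota> \<longleftrightarrow> cocone C r D t L \<iota> \<and>
     (\<forall>T f. cocone C r D t T f \<longrightarrow>
        (\<exists>!h. h \<in> Hom C L T \<and> (\<forall>i\<in>Field r. h \<cdot>\<^bsub>C\<^esub> \<iota> i = f i)))"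

text \<open>
  The direct limit of a directed system of sets \<open>S i\<close> with transition maps \<open>t i j\<close>, constructed
  as a quotient of the disjoint union, and the map out of it induced by compatible maps \<open>g i\<close>.
\<close>

definition dirlim_rel ::
  "'i rel \<Rightarrow> ('i \<Rightarrow> 'x set) \<Rightarrow> ('i \<Rightarrow> 'i \<Rightarrow> 'x \<Rightarrow> 'x) \<Rightarrow> ('i \<times> 'x) rel" where
  "dirlim_rel r S t = {((i, x), (j, y)). x \<in> S i \<and> y \<in> S j \<and>
     (\<exists>k. (i, k) \<in> r \<and> (j, k) \<in> r \<and> t i k x = t j k y)}"

definition dirlim ::
  "'i rel \<Rightarrow> ('i \<Rightarrow> 'x set) \<Rightarrow> ('i \<Rightarrow> 'i \<Rightarrow> 'x \<Rightarrow> 'x) \<Rightarrow> ('i \<times> 'x) set set" where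
  "dirlim r S t = Sigma (Field r) S // dirlim_rel r S t"

definition dirlim_map :: "('i \<Rightarrow> 'x \<Rightarrow> 'y) \<Rightarrow> ('i \<times> 'x) set \<Rightarrow> 'y" where
  "dirlim_map g K = the_elem ((\<lambda>(i, x). g i x) ` K)"

text \<open>
  For a colimit \<open>(L, \<iota>)\<close> of a directed system: the canonical map
  \<open>colim Hom(X, D i) \<rightarrow> Hom(X, L)\<close> is bijective.
\<close>

definition Hom_preserves ::
  "('o, 'm, 'z) cat_scheme \<Rightarrow> 'o \<Rightarrow> 'i rel \<Rightarrow> ('i \<Rightarrow> 'o) \<Rightarrow> ('i \<Rightarrow> 'i \<Rightarrow> 'm) \<Rightarrow> 'o \<Rightarrow> ('i \<Rightarrow> 'm) \<Rightarrow> bool" where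
  "Hom_preserves C X r D t L \<iota> \<longleftrightarrow>
     bij_betw (dirlim_map (\<lambda>i f. \<iota> i \<cdot>\<^bsub>C\<^esub> f))
       (dirlim r (\<lambda>i. Hom C X (D i)) (\<lambda>i j f. t i j \<cdot>\<^bsub>C\<^esub> f)) (Hom C X L)"


section \<open>Accessible categories\<close>

definition directed_poset :: "'k rel \<Rightarrow> 'i rel \<Rightarrow> bool" where
  "directed_poset \<kappa> r \<longleftrightarrow> Partial_order r \<and>
     (\<forall>S \<subseteq> Field r. |S| <o \<kappa> \<longrightarrow> (\<exists>u\<in>Field r. \<forall>s\<in>S. (s, u) \<in> r))"

definition presentable :: "'u rel \<Rightarrow> 'u rel \<Rightarrow> ('o, 'm, 'z) cat_scheme \<Rightarrow> 'o \<Rightarrow> bool" where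
  "presentable U \<kappa> C X \<longleftrightarrow> X \<in> Ob C \<and>
     (\<forall>(r :: 'u rel) D t L \<iota>. small U (Field r) \<and> directed_poset \<kappa> r \<and>
        direct_system C r D t \<and> colimit C r D t L \<iota> \<longrightarrow> Hom_preserves C X r D t L \<iota>)"

definition accessible_at :: "'u rel \<Rightarrow> 'u rel \<Rightarrow> ('o, 'm, 'z) cat_scheme \<Rightarrow> bool" where
  "accessible_at U \<kappa> C \<longleftrightarrow>
     (\<forall>(r :: 'u rel) D t. small U (Field r) \<and> directed_poset \<kappa> r \<and> direct_system C r D t \<longrightarrow>
        (\<exists>L \<iota>. colimit C r D t L \<iota>)) \<and>
     (\<exists>G. small U G \<and> (\<forall>X\<in>G. presentable U \<kappa> C X) \<and>
        (\<forall>X\<in>Ob C. \<exists>(r :: 'u rel) D t \<iota>. small U (Field r) \<and> directed_poset \<kappa> r \<and>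
           direct_system C r D t \<and> (\<forall>i\<in>Field r. D i \<in> G) \<and> colimit C r D t X \<iota>))"

definition accessible :: "'u rel \<Rightarrow> ('o, 'm, 'z) cat_scheme \<Rightarrow> bool" where
  "accessible U C \<longleftrightarrow>
     (\<exists>\<kappa> :: 'u rel. regular_cardinal \<kappa> \<and> \<kappa> <o U \<and> accessible_at U \<kappa> C)"


section \<open>Well generated additive categories\<close>

text \<open>
  Ordinals are well-orders.  The library's \<^const>\<open>BNF_Cardinal_Order_Relation.cofinal\<close> is the
  strict notion, for which a successor ordinal has no cofinal subset; the cofinality bound uses
  the non-strict one, so that successor ordinals have cofinality 1.
\<close>

definition cofinality_ge :: "'k rel \<Rightarrow> 'i rel \<Rightarrow> bool" where
  "cofinality_ge \<kappa> r \<longleftrightarrow>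
     (\<forall>A \<subseteq> Field r. (\<forall>a\<in>Field r. \<exists>b\<in>A. (a, b) \<in> r) \<longrightarrow> \<kappa> \<le>o |A| )"

definition imm_succ :: "'i rel \<Rightarrow> 'i \<Rightarrow> 'i \<Rightarrow> bool" where
  "imm_succ r a b \<longleftrightarrow> a \<in> underS r b \<and> (\<forall>c \<in> underS r b. (c, a) \<in> r)"

definition limit_element :: "'i rel \<Rightarrow> 'i \<Rightarrow> bool" where
  "limit_element r g \<longleftrightarrow> g \<in> Field r \<and> underS r g \<noteq> {} \<and> \<not> (\<exists>a. imm_succ r a g)"

definition ordinal_sequence ::
  "('o, 'm, 'z) cat_scheme \<Rightarrow> 'i rel \<Rightarrow> ('i \<Rightarrow> 'o) \<Rightarrow> ('i \<Rightarrow> 'i \<Rightarrow> 'm) \<Rightarrow> bool" where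
  "ordinal_sequence C r Y t \<longleftrightarrow> Well_order r \<and> direct_system C r Y t \<and>
     (\<forall>g. limit_element r g \<longrightarrow>
        (\<exists>L \<iota> h. colimit C (Restr r (underS r g)) Y t L \<iota> \<and> isomorphism C L (Y g) h \<and>
           (\<forall>a\<in>underS r g. h \<cdot>\<^bsub>C\<^esub> \<iota> a = t a g)))"

definition small_rel_split_monos ::
  "'u rel \<Rightarrow> 'u rel \<Rightarrow> ('o, 'm, 'z) cat_scheme \<Rightarrow> 'o \<Rightarrow> bool" where
  "small_rel_split_monos U \<kappa> C X \<longleftrightarrow>
     (\<forall>(r :: 'u rel) Y t L \<iota>. small U (Field r) \<and> cofinality_ge \<kappa> r \<and>
        ordinal_sequence C r Y t \<and> (\<forall>a b. imm_succ r a b \<longrightarrow> split_mono C (Y a) (Y b) (t a b)) \<and>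
        colimit C r Y t L \<iota> \<longrightarrow> Hom_preserves C X r Y t L \<iota>)"

definition well_generated_by ::
  "'u rel \<Rightarrow> 'u rel \<Rightarrow> ('o, 'm, 'z) preadd_scheme \<Rightarrow> 'o set \<Rightarrow> bool" where
  "well_generated_by U \<kappa> C G \<longleftrightarrow> additive_category C \<and> has_coproducts U C \<and>
     G \<subseteq> Ob C \<and> small U G \<and>
     (\<forall>M\<in>Ob C. \<not> zero_object C M \<longrightarrow> (\<exists>X\<in>G. \<exists>f\<in>Hom C X M. f \<noteq> hom_zero C X M)) \<and>
     (\<forall>X\<in>G. small_rel_split_monos U \<kappa> C X) \<and>
     (\<forall>X\<in>G. \<forall>(I :: 'u set) M P \<iota>. \<forall>f\<in>Hom C X P. small U I \<and> coproduct C I M P \<iota> \<longrightarrow>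
        (\<exists>N f' Q \<iota>' g h. (\<forall>i\<in>I. N i \<in> G \<and> f' i \<in> Hom C (N i) (M i)) \<and>
           coproduct C I N Q \<iota>' \<and> g \<in> Hom C X Q \<and>
           h \<in> Hom C Q P \<and> (\<forall>i\<in>I. h \<cdot>\<^bsub>C\<^esub> \<iota>' i = \<iota> i \<cdot>\<^bsub>C\<^esub> f' i) \<and> f = h \<cdot>\<^bsub>C\<^esub> g))"

definition well_generated :: "'u rel \<Rightarrow> ('o, 'm, 'z) preadd_scheme \<Rightarrow> bool" where
  "well_generated U C \<longleftrightarrow>
     (\<exists>(\<kappa> :: 'u rel) G. regular_cardinal \<kappa> \<and> \<kappa> <o U \<and> well_generated_by U \<kappa> C G)"


section \<open>The homotopy category of complexes\<close>

record ('o, 'm) cochain =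
  cpt :: "int \<Rightarrow> 'o"
  diff :: "int \<Rightarrow> 'm"

definition complexes :: "('o, 'm, 'z) preadd_scheme \<Rightarrow> 'o set \<Rightarrow> ('o, 'm) cochain set" where
  "complexes C B = {X. \<forall>n. cpt X n \<in> B \<and> diff X n \<in> Hom C (cpt X n) (cpt X (n + 1)) \<and>
     diff X (n + 1) \<cdot>\<^bsub>C\<^esub> diff X n = hom_zero C (cpt X n) (cpt X (n + 2))}"

definition chain_maps ::
  "('o, 'm, 'z) preadd_scheme \<Rightarrow> ('o, 'm) cochain \<Rightarrow> ('o, 'm) cochain \<Rightarrow> (int \<Rightarrow> 'm) set" where
  "chain_maps C X Y = {f. \<forall>n. f n \<in> Hom C (cpt X n) (cpt Y n) \<and>
     f (n + 1) \<cdot>\<^bsub>C\<^esub> diff X n = diff Y n \<cdot>\<^bsub>C\<^esub> f n}"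

definition homotopic ::
  "('o, 'm, 'z) preadd_scheme \<Rightarrow> ('o, 'm) cochain \<Rightarrow> ('o, 'm) cochain \<Rightarrow> (int \<Rightarrow> 'm) rel" where
  "homotopic C X Y = {(f, g). f \<in> chain_maps C X Y \<and> g \<in> chain_maps C X Y \<and>
     (\<exists>s. \<forall>n. s n \<in> Hom C (cpt X n) (cpt Y (n - 1)) \<and>
        f n = g n \<^bold>+\<^bsub>C\<^esub> ((diff Y (n - 1) \<cdot>\<^bsub>C\<^esub> s n) \<^bold>+\<^bsub>C\<^esub> (s (n + 1) \<cdot>\<^bsub>C\<^esub> diff X n)))}"

text \<open>
  An arrow is a triple of source, target and homotopy class; the operations on classes are the
  well-defined ones induced from representatives.
\<close>

type_synonym ('o, 'm) harrow = "('o, 'm) cochain \<times> ('o, 'm) cochain \<times> (int \<Rightarrow> 'm) set"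

definition homotopy_category ::
  "('o, 'm, 'z) preadd_scheme \<Rightarrow> 'o set \<Rightarrow> (('o, 'm) cochain, ('o, 'm) harrow) preadd" where
  "homotopy_category C B =
     \<lparr>Ob = complexes C B,
      Arr = {(X, Y, F). X \<in> complexes C B \<and> Y \<in> complexes C B \<and>
               F \<in> chain_maps C X Y // homotopic C X Y},
      Dom = (\<lambda>(X, Y, F). X),
      Cod = (\<lambda>(X, Y, F). Y),
      Id = (\<lambda>X. (X, X, homotopic C X X `` {\<lambda>n. Id C (cpt X n)})),
      Comp = (\<lambda>(Y', Z, G) (X, Y, F).
                (X, Z, \<Union>g\<in>G. \<Union>f\<in>F. homotopic C X Z `` {\<lambda>n. g n \<cdot>\<^bsub>C\<^esub> f n})),
      hom_zero = (\<lambda>X Y. (X, Y, homotopic C X Y `` {\<lambda>n. hom_zero C (cpt X n) (cpt Y n)})),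
      hom_add = (\<lambda>(X, Y, F) (X', Y', G).
                (X, Y, \<Union>f\<in>F. \<Union>g\<in>G. homotopic C X Y `` {\<lambda>n. f n \<^bold>+\<^bsub>C\<^esub> g n}))\<rparr>"

end

(*
  K(B) has coproducts, computed componentwise.

  (2) implies (1).  Accessibility of A yields a small infinite cardinal T such that every map from an object
  of S to a coproduct has at most T summands in its support.  The generators are the complexes whose
  components are coproducts of at most T objects of S.  Every complex M over B is a retract of a complex Q
  whose components are coproducts of objects of S.  If all maps from generators to M are null homotopic,
  then so is Q -> M: by Zorn's lemma there is a maximal null homotopy defined on a subcomplex spanned by
  part of the basis of Q, and the obstruction to extending it by one more basis element lives on a
  generator.  Maps from generators to coproducts factor as required because supports can be closed
  under the differential.  The colimit of a sequence of split monomorphisms is a retract of the coproduct of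
  its terms, so smallness relative to split monomorphisms follows from smallness relative to coproducts.

  (1) implies (2).  Let S consist of the components of the generators and a zero object.  Starting from X in
  degree 0, repeatedly adjoin cones that kill all maps from the generators and their negative shifts.
  By condition (3) the shift map s of the coproduct V of the resulting sequence kills all maps from
  generators to V and V[1], hence the cone of 1 - s receives no non-zero map from a generator and is
  contractible.  The contraction exhibits X as a retract of the component of V in degree -1, a coproduct
  of objects of S, and idempotents split in A.
*)
theory Submission
  imports Defs
begin

section \<open>Small sets\<close>

text \<open>A well generated category is only assumed additive, so no triangulated structure is set
  up: cones, shifts and contractions are written with explicit homotopies. \<open>B\<close> is
  closed under coproducts and not under colimits, so the cone of \<open>1 - s\<close> takes the
  place of the colimit of the sequence. The generators need not be closed under shifts, and maps
  into a cone are controlled by maps into \<open>V\<close> and into \<open>V[1]\<close>; hence the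
  negative shifts. The degree -1 is forced by the cone: its part in degree n is
  \<open>Q (n + 1)\<close> plus \<open>W n\<close>, so \<open>X\<close>, placed in degree 0, never
  enters degree -1 of a stage. The cone of \<open>1 - s\<close> does contain \<open>V 0\<close> in
  degree -1, and a map \<open>V 0\<close> to \<open>X\<close> that vanishes on \<open>1 - s\<close>
  removes it.

  In the other direction the extension step meets a subquotient of \<open>Q\<close>: the new basis
  elements modulo those already treated, with a differential that cannot be prescribed. Therefore
  all complexes over a set of objects serve as generators. Closing one basis element under the
  supports of the differential takes countably many steps with at most \<open>|T|\<close> new
  elements for each old one, which an infinite \<open>T\<close> absorbs.\<close>

lemma inaccessibleD:
  assumes "inaccessible U"
  shows "Card_order U" "infinite (Field U)" "regularCard U" "Cinfinite U"
    "natLeq <o U"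
  using assms by (auto simp: inaccessible_def regular_cardinal_def cinfinite_def)

lemma ordLeq_card_of_Field:
  assumes "inaccessible U" "small U X"
  shows "|X| \<le>o |Field U|"
proof -
  have "U =o |Field U|"
    using inaccessibleD(1)[OF assms(1)] card_of_Field_ordIso ordIso_symmetric by blast
  then show ?thesis
    using assms(2) unfolding small_def by (meson ordLess_imp_ordLeq ordLeq_ordIso_trans)
qed

text \<open>Index sets and posets in the definitions live on the type that carries \<open>U\<close>.
  This embedding is how a small set of any other type (pairs, subsets, naturals) is moved
  there.\<close>

lemma small_embed:
  assumes "inaccessible (U :: 'u rel)" "small U (X :: 'a set)"
  obtains f :: "'a \<Rightarrow> 'u" where "inj_on f X"
  using ordLeq_card_of_Field[OF assms] card_of_ordLeq[of X "Field U"] by blast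

lemma small_ordLeq: "small U Y \<Longrightarrow> |X| \<le>o |Y| \<Longrightarrow> small U X"
  unfolding small_def using ordLeq_ordLess_trans by blast

lemma small_subset: "small U Y \<Longrightarrow> X \<subseteq> Y \<Longrightarrow> small U X"
  by (meson card_of_mono1 small_ordLeq)

lemma small_image: "small U X \<Longrightarrow> small U (f ` X)"
  by (meson card_of_image small_ordLeq)

lemma small_inj_image_iff: "inj_on f X \<Longrightarrow> small U (f ` X) \<longleftrightarrow> small U X"
  using small_image[of U X f] small_image[of U "f ` X" "inv_into X f"] by auto

lemma small_UNION:
  assumes "inaccessible U" "small U I" "\<And>i. i \<in> I \<Longrightarrow> small U (X i)"
  shows "small U (\<Union>i\<in>I. X i)"
  using card_of_UNION_ordLess_infinite_Field_regularCard[of U I X] inaccessibleD[OF assms(1)] assms(2,3)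
  unfolding small_def by auto

lemma small_finite:
  assumes "inaccessible U" "finite X"
  shows "small U X"
proof -
  have "|X| <o natLeq" using assms(2) by (simp add: finite_iff_ordLess_natLeq)
  then show ?thesis
    using inaccessibleD(5)[OF assms(1)] ordLess_transitive unfolding small_def by blast
qed

lemma card_of_int_ordLeq_nat: "|UNIV :: int set| \<le>o |UNIV :: nat set|"
proof -
  have "inj (\<lambda>z :: int. if z \<ge> 0 then 2 * nat z else 2 * nat (- z) + 1)"
  proof (rule injI)
    fix x y :: int
    assume "(if x \<ge> 0 then 2 * nat x else 2 * nat (- x) + 1) = (if y \<ge> 0 then 2 * nat y else 2 * nat (- y) + 1)"
    moreover have "2 * m \<noteq> 2 * n + 1" "2 * m + 1 \<noteq> 2 * n" for m n :: nat by presburger+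
    ultimately show "x = y" by (simp split: if_splits)
  qed
  then show ?thesis using card_of_ordLeq[of "UNIV :: int set" "UNIV :: nat set"] by blast
qed

lemma small_countable:
  assumes "inaccessible U"
  shows "small U (UNIV :: nat set)" "small U (UNIV :: int set)"
proof -
  show "small U (UNIV :: nat set)"
    using inaccessibleD(5)[OF assms] card_of_nat ordIso_ordLess_trans unfolding small_def by blast
  then show "small U (UNIV :: int set)"
    by (rule small_ordLeq[OF _ card_of_int_ordLeq_nat])
qed

lemma small_Sigma:
  assumes "inaccessible U" "small U I" "\<And>i. i \<in> I \<Longrightarrow> small U (X i)"
  shows "small U (Sigma I X)"
proof -
  have "Sigma I X = (\<Union>i\<in>I. Pair i ` X i)"
    by auto
  then show ?thesis
    by (simp add: small_UNION[OF assms(1,2)] small_image[OF assms(3)])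
qed

lemma small_Un:
  assumes "inaccessible U" "small U X" "small U Y"
  shows "small U (X \<union> Y)"
  using assms Un_Cinfinite_bound_strict[of X U Y] inaccessibleD(4)[OF assms(1)]
  unfolding small_def by blast

lemma small_insert: "inaccessible U \<Longrightarrow> small U X \<Longrightarrow> small U (insert x X)"
  using small_Un[of U "{x}" X] small_finite[of U "{x}"] by simp

lemma small_Pow:
  assumes "inaccessible (U :: 'u rel)" "small U X"
  shows "small U (Pow X)"
proof -
  obtain f :: "'a \<Rightarrow> 'u" where f: "inj_on f X"
    using small_embed[OF assms] .
  have "small U (Pow (f ` X))"
    using assms small_image[OF assms(2), of f] unfolding inaccessible_def small_def by blast
  moreover have "inj_on (image f) (Pow X)" "image f ` Pow X = Pow (f ` X)"
    using f by (auto simp: image_Pow_surj inj_on_image_Pow)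
  ultimately show ?thesis
    by (metis small_inj_image_iff)
qed

text \<open>A function is replaced by its graph over \<open>D\<close>, a subset of
  \<open>D \<times> R\<close>. The last hypothesis says that members of \<open>F\<close> are
  determined by their values on \<open>D\<close>.\<close>

lemma small_functions:
  fixes F :: "('a \<Rightarrow> 'b) set"
  assumes "inaccessible U" "small U D" "small U R"
    and "\<And>f x. f \<in> F \<Longrightarrow> x \<in> D \<Longrightarrow> f x \<in> R"
    and "\<And>f g. f \<in> F \<Longrightarrow> g \<in> F \<Longrightarrow> (\<And>x. x \<in> D \<Longrightarrow> f x = g x) \<Longrightarrow> f = g"
  shows "small U F"
proof -
  define gr where "gr f = (\<lambda>x. (x, f x)) ` D" for f :: "'a \<Rightarrow> 'b"
  have "inj_on gr F"
  proof
    fix f g assume fg: "f \<in> F" "g \<in> F" and eq: "gr f = gr g"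
    have "f x = g x" if "x \<in> D" for x
    proof -
      have "(x, f x) \<in> gr g" using that eq unfolding gr_def by blast
      then show ?thesis unfolding gr_def by auto
    qed
    then show "f = g" by (rule assms(5)[OF fg])
  qed
  moreover have "small U (gr ` F)"
  proof (rule small_subset)
    show "small U (Pow (D \<times> R))"
      by (intro small_Pow small_Sigma assms)
    show "gr ` F \<subseteq> Pow (D \<times> R)" using assms(4) by (auto simp: gr_def)
  qed
  ultimately show ?thesis by (simp add: small_inj_image_iff)
qed

text \<open>The successor cardinal of \<open>|T|\<close> is regular and at most the cardinality of
  \<open>Pow T\<close>, hence below \<open>U\<close>. \<open>cardSuc\<close> lives on the type of
  sets, so it is replaced by an equipollent subset of \<open>Field U\<close>.\<close>

lemma ex_regular_cardinal_above:
  assumes "inaccessible (U :: 'u rel)" "small U (T :: 'u set)" "infinite T"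
  shows "\<exists>\<kappa> :: 'u rel. regular_cardinal \<kappa> \<and> \<kappa> <o U \<and> |T| <o \<kappa>"
proof -
  define c where "c = cardSuc |T|"
  have T: "Cinfinite |T|" using assms(3) by (simp add: cinfinite_def Field_card_of card_of_card_order_on)
  have c: "Cinfinite c" "regularCard c"
    unfolding c_def using T by (simp_all add: Cinfinite_cardSuc regularCard_cardSuc)
  have "c \<le>o |Pow T|"
    unfolding c_def by (rule cardSuc_least) (simp_all only: card_of_Pow card_of_Card_order)
  then have cU: "c <o U"
    using small_Pow[OF assms(1,2)] ordLeq_ordLess_trans unfolding small_def by blast
  then have "c \<le>o |Field U|"
    using ordLess_imp_ordLeq ordLeq_ordIso_trans inaccessibleD(1)[OF assms(1)]
      card_of_Field_ordIso ordIso_symmetric by blast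
  then obtain Y where Y: "Y \<subseteq> Field U" "c =o |Y|"
    using internalize_card_of_ordLeq2[of "Field c" "Field U"] c(1) card_of_Field_ordIso
    by (metis card_of_ordIso_subst ordIso_ordLeq_trans ordIso_symmetric ordIso_transitive)
  have "regular_cardinal |Y|"
    unfolding regular_cardinal_def
    using c Y(2) Cinfinite_cong[of c "|Y|"] regularCard_ordIso[of c "|Y|"] by blast
  moreover have "|Y| <o U" using cU Y(2) ordIso_ordLess_trans ordIso_symmetric by blast
  moreover have "|T| <o |Y|"
    using Y(2) cardSuc_greater[OF card_of_Card_order] ordLess_ordIso_trans unfolding c_def by blast
  ultimately show ?thesis by blast
qed

text \<open>The closure is the countable union of the n-step images, each bounded by
  \<open>|T|\<close> by induction.\<close>

lemma card_of_rtrancl_Image_ordLeq: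
  assumes "infinite T" "|X| \<le>o |T|" "\<And>x. |R `` {x}| \<le>o |T|"
  shows "|R\<^sup>* `` X| \<le>o |T|"
proof -
  have "|(R ^^ n) `` X| \<le>o |T|" for n
  proof (induction n)
    case (Suc n)
    have "(R ^^ Suc n) `` X = (\<Union>x\<in>(R ^^ n) `` X. R `` {x})" by auto
    then show ?case
      using card_of_UNION_ordLeq_infinite[OF assms(1) Suc, of "\<lambda>x. R `` {x}"] assms(3) by simp
  qed (use assms in simp)
  moreover have "R\<^sup>* `` X = (\<Union>n\<in>UNIV::nat set. (R ^^ n) `` X)"
    by (fastforce simp: rtrancl_power)
  moreover have "|UNIV :: nat set| \<le>o |T|"
    using assms(1) infinite_iff_card_of_nat by blast
  ultimately show ?thesis
    using card_of_UNION_ordLeq_infinite[OF assms(1), of "UNIV::nat set" "\<lambda>n. (R ^^ n) `` X"] by simp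
qed

section \<open>Calculating in preadditive categories\<close>

lemma Hom_iff: "f \<in> Hom C X Y \<longleftrightarrow> f \<in> Arr C \<and> Dom C f = X \<and> Cod C f = Y"
  by (auto simp: Hom_def)

lemma HomD:
  assumes "f \<in> Hom C X Y"
  shows "f \<in> Arr C" "Dom C f = X" "Cod C f = Y"
  using assms by (auto simp: Hom_def)

context category
begin

lemma arr_ob [simp]: "f \<in> Arr C \<Longrightarrow> Dom C f \<in> Ob C" "f \<in> Arr C \<Longrightarrow> Cod C f \<in> Ob C"
  using dom_cod by auto

lemma Hom_ob: "f \<in> Hom C X Y \<Longrightarrow> X \<in> Ob C" "f \<in> Hom C X Y \<Longrightarrow> Y \<in> Ob C"
  by (auto simp: Hom_def)

text \<open>Typing is expressed by \<open>Arr\<close>, \<open>Dom\<close> and \<open>Cod\<close>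
  instead of \<open>Hom\<close>: no intermediate object occurs as a free variable, so the simplifier
  can discharge the side conditions by itself.\<close>

lemma arr_comp [simp]:
  assumes "g \<in> Arr C" "f \<in> Arr C" "Dom C g = Cod C f"
  shows "g \<cdot> f \<in> Arr C" "Dom C (g \<cdot> f) = Dom C f" "Cod C (g \<cdot> f) = Cod C g"
  using comp_hom[of g "Cod C f" "Cod C g" f "Dom C f"] assms by (auto simp: Hom_def)

lemma arr_assoc [simp]:
  assumes "h \<in> Arr C" "g \<in> Arr C" "f \<in> Arr C" "Dom C h = Cod C g" "Dom C g = Cod C f"
  shows "(h \<cdot> g) \<cdot> f = h \<cdot> g \<cdot> f"
  using comp_assoc[of h "Cod C g" "Cod C h" g "Cod C f" f "Dom C f"] assms by (auto simp: Hom_def)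

lemma arr_Id [simp]:
  assumes "X \<in> Ob C"
  shows "Id C X \<in> Arr C" "Dom C (Id C X) = X" "Cod C (Id C X) = X"
  using id_hom[OF assms] by (auto simp: Hom_def)

lemma arr_Id_left [simp]: "f \<in> Arr C \<Longrightarrow> Cod C f = X \<Longrightarrow> Id C X \<cdot> f = f"
  using id_left[of f "Dom C f" X] by (auto simp: Hom_def)

lemma arr_Id_right [simp]: "f \<in> Arr C \<Longrightarrow> Dom C f = X \<Longrightarrow> f \<cdot> Id C X = f"
  using id_right[of f X "Cod C f"] by (auto simp: Hom_def)

text \<open>Composites are normalised to associate to the right, so a known equation
  \<open>g \<cdot> f = k\<close> does not match inside a longer composite. This is its form with a
  further factor on the right.\<close>

lemma comp_reduce:
  assumes "g \<cdot> f = k" "f \<in> Arr C" "g \<in> Arr C" "h \<in> Arr C" "Dom C g = Cod C f" "Dom C f = Cod C h"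
  shows "g \<cdot> f \<cdot> h = k \<cdot> h"
  using assms arr_assoc[of g f h] by simp

end

context preadditive_category
begin

text \<open>The record holds zero and sum only; the negative is the inverse in the Hom group, whose
  ends are read off from the arrow.\<close>

definition neg :: "'m \<Rightarrow> 'm" where
  "neg f = inv\<^bsub>\<lparr>carrier = Hom C (Dom C f) (Cod C f), mult = hom_add C,
     one = hom_zero C (Dom C f) (Cod C f)\<rparr>\<^esub> f"

abbreviation zr :: "'o \<Rightarrow> 'o \<Rightarrow> 'm" where "zr \<equiv> hom_zero C"

lemma arr_zero [simp]:
  assumes "X \<in> Ob C" "Y \<in> Ob C"
  shows "zr X Y \<in> Arr C" "Dom C (zr X Y) = X" "Cod C (zr X Y) = Y"
proof -
  interpret comm_group "\<lparr>carrier = Hom C X Y, mult = hom_add C, one = zr X Y\<rparr>"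
    using hom_group[OF assms] .
  have "zr X Y \<in> Hom C X Y" using one_closed by simp
  then show "zr X Y \<in> Arr C" "Dom C (zr X Y) = X" "Cod C (zr X Y) = Y"
    by (auto simp: Hom_def)
qed

lemma arr_add [simp]:
  assumes "f \<in> Arr C" "g \<in> Arr C" "Dom C f = Dom C g" "Cod C f = Cod C g"
  shows "f \<^bold>+ g \<in> Arr C" "Dom C (f \<^bold>+ g) = Dom C g" "Cod C (f \<^bold>+ g) = Cod C g"
proof -
  interpret comm_group "\<lparr>carrier = Hom C (Dom C f) (Cod C f), mult = hom_add C,
      one = zr (Dom C f) (Cod C f)\<rparr>"
    by (rule hom_group) (use assms in auto)
  have "f \<^bold>+ g \<in> Hom C (Dom C f) (Cod C f)"
    using m_closed[of f g] assms by (auto simp: Hom_def)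
  then show "f \<^bold>+ g \<in> Arr C" "Dom C (f \<^bold>+ g) = Dom C g" "Cod C (f \<^bold>+ g) = Cod C g"
    using assms by (auto simp: Hom_def)
qed

lemma arr_neg [simp]:
  assumes "f \<in> Arr C"
  shows "neg f \<in> Arr C" "Dom C (neg f) = Dom C f" "Cod C (neg f) = Cod C f"
proof -
  interpret comm_group "\<lparr>carrier = Hom C (Dom C f) (Cod C f), mult = hom_add C,
      one = zr (Dom C f) (Cod C f)\<rparr>"
    by (rule hom_group) (use assms in auto)
  have "neg f \<in> Hom C (Dom C f) (Cod C f)"
    using inv_closed[of f] assms by (auto simp: Hom_def neg_def)
  then show "neg f \<in> Arr C" "Dom C (neg f) = Dom C f" "Cod C (neg f) = Cod C f"
    by (auto simp: Hom_def)
qed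

lemma add_assoc:
  assumes "f \<in> Arr C" "g \<in> Arr C" "h \<in> Arr C" "Dom C f = Dom C g" "Cod C f = Cod C g"
    "Dom C g = Dom C h" "Cod C g = Cod C h"
  shows "(f \<^bold>+ g) \<^bold>+ h = f \<^bold>+ (g \<^bold>+ h)"
proof -
  interpret comm_group "\<lparr>carrier = Hom C (Dom C f) (Cod C f), mult = hom_add C,
      one = zr (Dom C f) (Cod C f)\<rparr>"
    by (rule hom_group) (use assms in auto)
  show ?thesis using m_assoc[of f g h] assms by (auto simp: Hom_def)
qed

lemma add_commute:
  assumes "f \<in> Arr C" "g \<in> Arr C" "Dom C f = Dom C g" "Cod C f = Cod C g"
  shows "f \<^bold>+ g = g \<^bold>+ f"
proof -
  interpret comm_group "\<lparr>carrier = Hom C (Dom C f) (Cod C f), mult = hom_add C,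
      one = zr (Dom C f) (Cod C f)\<rparr>"
    by (rule hom_group) (use assms in auto)
  show ?thesis using m_comm[of f g] assms by (auto simp: Hom_def)
qed

lemma add_left_commute:
  assumes "f \<in> Arr C" "g \<in> Arr C" "h \<in> Arr C" "Dom C f = Dom C g" "Cod C f = Cod C g"
    "Dom C g = Dom C h" "Cod C g = Cod C h"
  shows "f \<^bold>+ (g \<^bold>+ h) = g \<^bold>+ (f \<^bold>+ h)"
  using assms add_assoc[of f g h] add_assoc[of g f h] add_commute[of f g] by simp

lemmas add_ac = add_assoc add_commute add_left_commute

lemma add_zero [simp]:
  assumes "f \<in> Arr C" "Dom C f = X" "Cod C f = Y"
  shows "f \<^bold>+ zr X Y = f" "zr X Y \<^bold>+ f = f"
proof -
  interpret comm_group "\<lparr>carrier = Hom C X Y, mult = hom_add C, one = zr X Y\<rparr>"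
    by (rule hom_group) (use assms in auto)
  show "f \<^bold>+ zr X Y = f" "zr X Y \<^bold>+ f = f"
    using r_one[of f] l_one[of f] assms by (auto simp: Hom_def)
qed

lemma add_neg [simp]:
  assumes "f \<in> Arr C"
  shows "f \<^bold>+ neg f = zr (Dom C f) (Cod C f)" "neg f \<^bold>+ f = zr (Dom C f) (Cod C f)"
proof -
  interpret comm_group "\<lparr>carrier = Hom C (Dom C f) (Cod C f), mult = hom_add C,
      one = zr (Dom C f) (Cod C f)\<rparr>"
    by (rule hom_group) (use assms in auto)
  show "f \<^bold>+ neg f = zr (Dom C f) (Cod C f)" "neg f \<^bold>+ f = zr (Dom C f) (Cod C f)"
    using r_inv[of f] l_inv[of f] assms by (auto simp: Hom_def neg_def)
qed

lemma add_neg_cancel [simp]: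
  assumes "f \<in> Arr C" "g \<in> Arr C" "Dom C f = Dom C g" "Cod C f = Cod C g"
  shows "f \<^bold>+ (neg f \<^bold>+ g) = g" "neg f \<^bold>+ (f \<^bold>+ g) = g"
  using assms add_assoc[of f "neg f" g] add_assoc[of "neg f" f g] by auto

lemma add_left_cancel:
  assumes "f \<in> Arr C" "g \<in> Arr C" "h \<in> Arr C" "Dom C f = Dom C g" "Cod C f = Cod C g"
    "Dom C g = Dom C h" "Cod C g = Cod C h"
  shows "f \<^bold>+ g = f \<^bold>+ h \<longleftrightarrow> g = h"
proof
  assume "f \<^bold>+ g = f \<^bold>+ h"
  then have "neg f \<^bold>+ (f \<^bold>+ g) = neg f \<^bold>+ (f \<^bold>+ h)" by simp
  then show "g = h" using assms by simp
qed simp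

lemma neg_unique:
  assumes "f \<in> Arr C" "g \<in> Arr C" "Dom C f = Dom C g" "Cod C f = Cod C g"
    "f \<^bold>+ g = zr (Dom C g) (Cod C g)"
  shows "g = neg f"
  by (rule add_left_cancel[of f g "neg f", THEN iffD1]) (simp_all add: assms)

lemma neg_neg [simp]: "f \<in> Arr C \<Longrightarrow> neg (neg f) = f"
  by (rule neg_unique[symmetric]) simp_all

lemma neg_zero [simp]: "X \<in> Ob C \<Longrightarrow> Y \<in> Ob C \<Longrightarrow> neg (zr X Y) = zr X Y"
  by (rule neg_unique[symmetric]) simp_all

lemma neg_add:
  assumes "f \<in> Arr C" "g \<in> Arr C" "Dom C f = Dom C g" "Cod C f = Cod C g"
  shows "neg (f \<^bold>+ g) = neg f \<^bold>+ neg g"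
proof (rule neg_unique[symmetric])
  have "(f \<^bold>+ g) \<^bold>+ (neg f \<^bold>+ neg g) = f \<^bold>+ (neg f \<^bold>+ (g \<^bold>+ neg g))"
    using assms by (simp add: add_assoc add_left_commute[of g "neg f"] del: add_neg add_neg_cancel)
  then show "(f \<^bold>+ g) \<^bold>+ (neg f \<^bold>+ neg g) = zr (Dom C (neg f \<^bold>+ neg g)) (Cod C (neg f \<^bold>+ neg g))"
    using assms by simp
qed (use assms in auto)

lemma eq_add_neg_iff:
  assumes "f \<in> Arr C" "g \<in> Arr C" "h \<in> Arr C" "Dom C f = Dom C g" "Cod C f = Cod C g"
    "Dom C g = Dom C h" "Cod C g = Cod C h"
  shows "f = g \<^bold>+ neg h \<longleftrightarrow> f \<^bold>+ h = g"
proof -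
  have "(f \<^bold>+ h) \<^bold>+ neg h = f" "(g \<^bold>+ neg h) \<^bold>+ h = g"
    using assms by (simp_all add: add_assoc)
  then show ?thesis by metis
qed

lemma comp_add [simp]:
  assumes "f \<in> Arr C" "f' \<in> Arr C" "g \<in> Arr C" "Dom C f = Dom C f'" "Cod C f = Cod C f'"
    "Dom C g = Cod C f'"
  shows "g \<cdot> (f \<^bold>+ f') = (g \<cdot> f) \<^bold>+ (g \<cdot> f')"
  using assms comp_add_left[of f "Dom C f" "Cod C f" f' g "Cod C g"] by (auto simp: Hom_def)

lemma add_comp [simp]:
  assumes "f \<in> Arr C" "g \<in> Arr C" "g' \<in> Arr C" "Dom C g = Dom C g'" "Cod C g = Cod C g'"
    "Dom C g' = Cod C f"
  shows "(g \<^bold>+ g') \<cdot> f = (g \<cdot> f) \<^bold>+ (g' \<cdot> f)"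
  using assms comp_add_right[of f "Dom C f" "Cod C f" g "Cod C g" g'] by (auto simp: Hom_def)

lemma add_eq_selfD:
  assumes "f \<in> Arr C" "f \<^bold>+ f = f"
  shows "f = zr (Dom C f) (Cod C f)"
  using add_left_cancel[of f f "zr (Dom C f) (Cod C f)"] assms by simp

lemma comp_zero [simp]:
  assumes "g \<in> Arr C" "X \<in> Ob C" "Dom C g = Y"
  shows "g \<cdot> zr X Y = zr X (Cod C g)"
proof -
  have "Y \<in> Ob C" using assms by auto
  with assms have "(g \<cdot> zr X Y) \<^bold>+ (g \<cdot> zr X Y) = g \<cdot> zr X Y"
    by (subst comp_add[symmetric]) auto
  then show ?thesis using add_eq_selfD[of "g \<cdot> zr X Y"] assms \<open>Y \<in> Ob C\<close> by simp
qed

lemma zero_comp [simp]: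
  assumes "f \<in> Arr C" "Y \<in> Ob C" "Cod C f = X"
  shows "zr X Y \<cdot> f = zr (Dom C f) Y"
proof -
  have "X \<in> Ob C" using assms by auto
  with assms have "(zr X Y \<cdot> f) \<^bold>+ (zr X Y \<cdot> f) = zr X Y \<cdot> f"
    by (subst add_comp[symmetric]) auto
  then show ?thesis using add_eq_selfD[of "zr X Y \<cdot> f"] assms \<open>X \<in> Ob C\<close> by simp
qed

lemma comp_neg [simp]:
  assumes "f \<in> Arr C" "g \<in> Arr C" "Dom C g = Cod C f"
  shows "g \<cdot> neg f = neg (g \<cdot> f)" "neg g \<cdot> f = neg (g \<cdot> f)"
proof -
  have "(g \<cdot> f) \<^bold>+ (g \<cdot> neg f) = zr (Dom C f) (Cod C g)"
    using assms by (subst comp_add[symmetric]) auto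
  then show "g \<cdot> neg f = neg (g \<cdot> f)" by (intro neg_unique) (use assms in auto)
  have "(g \<cdot> f) \<^bold>+ (neg g \<cdot> f) = zr (Dom C f) (Cod C g)"
    using assms by (subst add_comp[symmetric]) auto
  then show "neg g \<cdot> f = neg (g \<cdot> f)" by (intro neg_unique) (use assms in auto)
qed

lemma Hom_simps:
  "\<lbrakk>X \<in> Ob C; Y \<in> Ob C\<rbrakk> \<Longrightarrow> zr X Y \<in> Hom C X Y"
  "\<lbrakk>f \<in> Hom C X Y; g \<in> Hom C X Y\<rbrakk> \<Longrightarrow> f \<^bold>+ g \<in> Hom C X Y"
  "f \<in> Hom C X Y \<Longrightarrow> neg f \<in> Hom C X Y"
  by (auto simp: Hom_def)

lemma zero_objectI:
  assumes "Z \<in> Ob C" "Id C Z = zr Z Z"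
  shows "zero_object C Z"
proof -
  have "f = zr Z X" if "f \<in> Hom C Z X" for f X
  proof -
    have "f = f \<cdot> Id C Z" "f \<in> Arr C" "Dom C f = Z" "Cod C f = X"
      using that by (auto simp: Hom_def)
    with assms show ?thesis by (metis comp_zero)
  qed
  moreover have "f = zr X Z" if "f \<in> Hom C X Z" for f X
  proof -
    have "f = Id C Z \<cdot> f" "f \<in> Arr C" "Dom C f = X" "Cod C f = Z"
      using that by (auto simp: Hom_def)
    with assms show ?thesis by (metis zero_comp)
  qed
  ultimately show ?thesis
    using assms(1) Hom_simps(1) unfolding zero_object_def by blast
qed

lemma zero_objectD:
  assumes "zero_object C Z"
  shows "Z \<in> Ob C" "Id C Z = zr Z Z" "f \<in> Hom C Z X \<Longrightarrow> f = zr Z X" "f \<in> Hom C X Z \<Longrightarrow> f = zr X Z"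
proof -
  show Z: "Z \<in> Ob C" using assms by (auto simp: zero_object_def)
  show *: "f \<in> Hom C Z X \<Longrightarrow> f = zr Z X" for f X
    using assms Hom_simps(1)[OF Z, of X] Hom_ob(2)[of f Z X] unfolding zero_object_def by blast
  show "f \<in> Hom C X Z \<Longrightarrow> f = zr X Z" for f
    using assms Hom_simps(1)[OF _ Z, of X] Hom_ob(1)[of f X Z] unfolding zero_object_def by blast
  show "Id C Z = zr Z Z" using *[of "Id C Z"] id_hom[OF Z] .
qed

end

section \<open>Coproducts\<close>

definition cotuple ::
  "('o, 'm, 'z) cat_scheme \<Rightarrow> 'i set \<Rightarrow> 'o \<Rightarrow> ('i \<Rightarrow> 'm) \<Rightarrow> 'o \<Rightarrow> ('i \<Rightarrow> 'm) \<Rightarrow> 'm" where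
  "cotuple C I P \<iota> T f = (THE h. h \<in> Hom C P T \<and> (\<forall>i\<in>I. h \<cdot>\<^bsub>C\<^esub> \<iota> i = f i))"

lemma coproductD:
  assumes "coproduct C I M P \<iota>"
  shows "P \<in> Ob C" "i \<in> I \<Longrightarrow> M i \<in> Ob C" "i \<in> I \<Longrightarrow> \<iota> i \<in> Hom C (M i) P"
    "i \<in> I \<Longrightarrow> \<iota> i \<in> Arr C" "i \<in> I \<Longrightarrow> Dom C (\<iota> i) = M i" "i \<in> I \<Longrightarrow> Cod C (\<iota> i) = P"
  using assms by (auto simp: coproduct_def Hom_def)

lemma coproduct_ex1:
  assumes "coproduct C I M P \<iota>" "T \<in> Ob C" "\<And>i. i \<in> I \<Longrightarrow> f i \<in> Hom C (M i) T"
  shows "\<exists>!h. h \<in> Hom C P T \<and> (\<forall>i\<in>I. h \<cdot>\<^bsub>C\<^esub> \<iota> i = f i)"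
  using assms unfolding coproduct_def by simp

lemma coproduct_eqI:
  assumes "coproduct C I M P \<iota>" "h \<in> Hom C P T" "h' \<in> Hom C P T" "T \<in> Ob C" "category C"
    "\<And>i. i \<in> I \<Longrightarrow> h \<cdot>\<^bsub>C\<^esub> \<iota> i = h' \<cdot>\<^bsub>C\<^esub> \<iota> i"
  shows "h = h'"
proof -
  have "\<exists>!k. k \<in> Hom C P T \<and> (\<forall>i\<in>I. k \<cdot>\<^bsub>C\<^esub> \<iota> i = h' \<cdot>\<^bsub>C\<^esub> \<iota> i)"
    by (rule coproduct_ex1[OF assms(1,4)])
      (rule category.comp_hom[OF assms(5,3) coproductD(3)[OF assms(1)]])
  moreover have "h \<in> Hom C P T \<and> (\<forall>i\<in>I. h \<cdot>\<^bsub>C\<^esub> \<iota> i = h' \<cdot>\<^bsub>C\<^esub> \<iota> i)"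
    "h' \<in> Hom C P T \<and> (\<forall>i\<in>I. h' \<cdot>\<^bsub>C\<^esub> \<iota> i = h' \<cdot>\<^bsub>C\<^esub> \<iota> i)"
    using assms(2,3,6) by blast+
  ultimately show ?thesis by blast
qed

lemma cotuple:
  assumes "coproduct C I M P \<iota>" "T \<in> Ob C" "\<And>i. i \<in> I \<Longrightarrow> f i \<in> Hom C (M i) T"
  shows "cotuple C I P \<iota> T f \<in> Hom C P T"
    "i \<in> I \<Longrightarrow> cotuple C I P \<iota> T f \<cdot>\<^bsub>C\<^esub> \<iota> i = f i"
proof -
  have "\<exists>!h. h \<in> Hom C P T \<and> (\<forall>i\<in>I. h \<cdot>\<^bsub>C\<^esub> \<iota> i = f i)"
    by (rule coproduct_ex1[OF assms(1,2)]) (rule assms(3))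
  from theI'[OF this] show "cotuple C I P \<iota> T f \<in> Hom C P T"
    "i \<in> I \<Longrightarrow> cotuple C I P \<iota> T f \<cdot>\<^bsub>C\<^esub> \<iota> i = f i"
    unfolding cotuple_def[symmetric] by blast+
qed

context category
begin

lemma coproductI:
  assumes "P \<in> Ob C" "\<And>i. i \<in> I \<Longrightarrow> \<iota> i \<in> Hom C (M i) P"
    and ex: "\<And>T f. \<lbrakk>T \<in> Ob C; \<And>i. i \<in> I \<Longrightarrow> f i \<in> Hom C (M i) T\<rbrakk> \<Longrightarrow>
      \<exists>h. h \<in> Hom C P T \<and> (\<forall>i\<in>I. h \<cdot> \<iota> i = f i)"
    and uniq: "\<And>T h h'. \<lbrakk>T \<in> Ob C; h \<in> Hom C P T; h' \<in> Hom C P T;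
      \<And>i. i \<in> I \<Longrightarrow> h \<cdot> \<iota> i = h' \<cdot> \<iota> i\<rbrakk> \<Longrightarrow> h = h'"
  shows "coproduct C I M P \<iota>"
  unfolding coproduct_def
proof (intro conjI ballI allI impI)
  fix T f assume T: "T \<in> Ob C" and f: "\<forall>i\<in>I. f i \<in> Hom C (M i) T"
  obtain h where "h \<in> Hom C P T" "\<forall>i\<in>I. h \<cdot> \<iota> i = f i"
    using ex[OF T] f by blast
  then show "\<exists>!h. h \<in> Hom C P T \<and> (\<forall>i\<in>I. h \<cdot> \<iota> i = f i)"
    by (intro ex1I[of _ h]) (simp, rule uniq[OF T], simp_all)
qed (use assms(1,2) Hom_ob in blast)+

lemma coproduct_reindex:
  fixes I :: "'i set" and I' :: "'j set"
  assumes "coproduct C I M P \<iota>" "bij_betw \<phi> I' I"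
    "\<And>i. i \<in> I' \<Longrightarrow> M' i = M (\<phi> i)" "\<And>i. i \<in> I' \<Longrightarrow> \<iota>' i = \<iota> (\<phi> i)"
  shows "coproduct C I' M' P \<iota>'"
proof -
  define \<psi> where "\<psi> = inv_into I' \<phi>"
  have \<phi>: "i \<in> I' \<Longrightarrow> \<phi> i \<in> I" and \<psi>: "j \<in> I \<Longrightarrow> \<psi> j \<in> I' \<and> \<phi> (\<psi> j) = j"
    and \<psi>\<phi>: "i \<in> I' \<Longrightarrow> \<psi> (\<phi> i) = i" for i j
    using assms(2) unfolding \<psi>_def bij_betw_def
    by (simp_all add: f_inv_into_f inv_into_into) blast
  show ?thesis
  proof (rule coproductI)
    show "P \<in> Ob C" using coproductD[OF assms(1)] by blast
    show "i \<in> I' \<Longrightarrow> \<iota>' i \<in> Hom C (M' i) P" for i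
      using coproductD(3)[OF assms(1) \<phi>] assms(3,4) by simp
  next
    fix T f assume T: "T \<in> Ob C" and f: "\<And>i. i \<in> I' \<Longrightarrow> f i \<in> Hom C (M' i) T"
    have "f (\<psi> i) \<in> Hom C (M i) T" if "i \<in> I" for i
      using f[of "\<psi> i"] \<psi>[OF that] assms(3) by simp
    from cotuple[OF assms(1) T this]
    show "\<exists>h. h \<in> Hom C P T \<and> (\<forall>i\<in>I'. h \<cdot> \<iota>' i = f i)"
      using \<phi> \<psi>\<phi> assms(4) by (intro exI[of _ "cotuple C I P \<iota> T (\<lambda>i. f (\<psi> i))"]) simp
  next
    fix T h h' assume "T \<in> Ob C" "h \<in> Hom C P T" "h' \<in> Hom C P T"
      and "\<And>i. i \<in> I' \<Longrightarrow> h \<cdot> \<iota>' i = h' \<cdot> \<iota>' i"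
    then show "h = h'"
      using coproduct_eqI[OF assms(1) _ _ _ category_axioms, of h T h'] \<psi> assms(4) by metis
  qed
qed

lemma coproduct_Sigma:
  assumes P: "coproduct C I M P \<iota>" and Q: "\<And>i. i \<in> I \<Longrightarrow> coproduct C (J i) (N i) (M i) (\<kappa> i)"
  shows "coproduct C (Sigma I J) (\<lambda>(i, j). N i j) P (\<lambda>(i, j). \<iota> i \<cdot> \<kappa> i j)"
proof (rule coproductI)
  show "P \<in> Ob C" using coproductD[OF P] by blast
  show "ij \<in> Sigma I J \<Longrightarrow> (case ij of (i, j) \<Rightarrow> \<iota> i \<cdot> \<kappa> i j)
      \<in> Hom C (case ij of (i, j) \<Rightarrow> N i j) P" for ij
    using comp_hom[OF coproductD(3)[OF P] coproductD(3)[OF Q]] by (auto split: prod.split)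
next
  fix T f assume T: "T \<in> Ob C"
    and f: "\<And>ij. ij \<in> Sigma I J \<Longrightarrow> f ij \<in> Hom C (case ij of (i, j) \<Rightarrow> N i j) T"
  define g where "g i = cotuple C (J i) (M i) (\<kappa> i) T (\<lambda>j. f (i, j))" for i
  have g: "g i \<in> Hom C (M i) T" "j \<in> J i \<Longrightarrow> g i \<cdot> \<kappa> i j = f (i, j)" if "i \<in> I" for i j
    using cotuple[OF Q[OF that] T, of "\<lambda>j. f (i, j)"] f that unfolding g_def by auto
  define h where "h = cotuple C I P \<iota> T g"
  have h: "h \<in> Hom C P T" "i \<in> I \<Longrightarrow> h \<cdot> \<iota> i = g i" for i
    using cotuple[OF P T, of g] g unfolding h_def by auto
  have "h \<cdot> \<iota> i \<cdot> \<kappa> i j = f (i, j)" if "i \<in> I" "j \<in> J i" for i j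
    using g(2)[OF that] h that comp_assoc[OF h(1) coproductD(3)[OF P] coproductD(3)[OF Q]] by metis
  then show "\<exists>h. h \<in> Hom C P T \<and> (\<forall>ij\<in>Sigma I J. h \<cdot> (case ij of (i, j) \<Rightarrow> \<iota> i \<cdot> \<kappa> i j) = f ij)"
    using h(1) by auto
next
  fix T h h' assume T: "T \<in> Ob C" and h: "h \<in> Hom C P T" "h' \<in> Hom C P T"
    and eq: "\<And>ij. ij \<in> Sigma I J \<Longrightarrow> h \<cdot> (case ij of (i, j) \<Rightarrow> \<iota> i \<cdot> \<kappa> i j) =
      h' \<cdot> (case ij of (i, j) \<Rightarrow> \<iota> i \<cdot> \<kappa> i j)"
  show "h = h'"
  proof (rule coproduct_eqI[OF P h T category_axioms])
    fix i assume i: "i \<in> I"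
    show "h \<cdot> \<iota> i = h' \<cdot> \<iota> i"
    proof (rule coproduct_eqI[OF Q[OF i] _ _ T category_axioms])
      show "h \<cdot> \<iota> i \<in> Hom C (M i) T" "h' \<cdot> \<iota> i \<in> Hom C (M i) T"
        using comp_hom h coproductD(3)[OF P i] by blast+
      fix j assume j: "j \<in> J i"
      show "(h \<cdot> \<iota> i) \<cdot> \<kappa> i j = (h' \<cdot> \<iota> i) \<cdot> \<kappa> i j"
        using eq[of "(i, j)"] i j comp_assoc[OF _ coproductD(3)[OF P i] coproductD(3)[OF Q[OF i] j]] h
        by auto
    qed
  qed
qed

lemma coproduct_single:
  assumes "X \<in> Ob C"
  shows "coproduct C {i} (\<lambda>_. X) X (\<lambda>_. Id C X)"
proof (rule coproductI)
  fix T f assume "\<And>j. j \<in> {i} \<Longrightarrow> f j \<in> Hom C X T"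
  then show "\<exists>h. h \<in> Hom C X T \<and> (\<forall>j\<in>{i}. h \<cdot> Id C X = f j)"
    using id_right by (intro exI[of _ "f i"]) auto
next
  fix T h h' assume "h \<in> Hom C X T" "h' \<in> Hom C X T" "\<And>j. j \<in> {i} \<Longrightarrow> h \<cdot> Id C X = h' \<cdot> Id C X"
  then show "h = h'" using id_right by auto
qed (use assms id_hom in auto)

lemma coproduct_unique:
  assumes P: "coproduct C I M P \<iota>" and Q: "coproduct C I M Q \<kappa>"
  shows "\<exists>h\<in>Hom C P Q. \<exists>k\<in>Hom C Q P. k \<cdot> h = Id C P \<and> h \<cdot> k = Id C Q \<and>
    (\<forall>i\<in>I. h \<cdot> \<iota> i = \<kappa> i) \<and> (\<forall>i\<in>I. k \<cdot> \<kappa> i = \<iota> i)"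
proof -
  define h where "h = cotuple C I P \<iota> Q \<kappa>"
  define k where "k = cotuple C I Q \<kappa> P \<iota>"
  note PD = coproductD[OF P] and QD = coproductD[OF Q]
  have h: "h \<in> Hom C P Q" "i \<in> I \<Longrightarrow> h \<cdot> \<iota> i = \<kappa> i" for i
    using cotuple[OF P QD(1), of \<kappa>] QD(3) unfolding h_def by auto
  have k: "k \<in> Hom C Q P" "i \<in> I \<Longrightarrow> k \<cdot> \<kappa> i = \<iota> i" for i
    using cotuple[OF Q PD(1), of \<iota>] PD(3) unfolding k_def by auto
  note hk = HomD[OF h(1)] HomD[OF k(1)]
  have "k \<cdot> h = Id C P"
    by (rule coproduct_eqI[OF P _ _ PD(1) category_axioms])
      (use hk h k PD in \<open>simp_all add: Hom_iff\<close>)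
  moreover have "h \<cdot> k = Id C Q"
    by (rule coproduct_eqI[OF Q _ _ QD(1) category_axioms])
      (use hk h k QD in \<open>simp_all add: Hom_iff\<close>)
  ultimately show ?thesis using h k by blast
qed

end

lemma has_coproducts_small:
  fixes I :: "'i set"
  assumes "inaccessible (U :: 'u rel)" "category C" "has_coproducts U C" "small U I"
    "\<And>i. i \<in> I \<Longrightarrow> M i \<in> Ob C"
  shows "\<exists>P \<iota>. coproduct C I M P \<iota>"
proof -
  obtain \<phi> :: "'i \<Rightarrow> 'u" where \<phi>: "inj_on \<phi> I" using small_embed[OF assms(1,4)] .
  have "\<exists>P \<iota>. coproduct C (\<phi> ` I) (M \<circ> inv_into I \<phi>) P \<iota>"
    using small_image[OF assms(4)] assms(5) \<phi>
    by (intro assms(3)[unfolded has_coproducts_def, rule_format]) simp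
  then obtain P \<iota> where "coproduct C (\<phi> ` I) (M \<circ> inv_into I \<phi>) P \<iota>" by blast
  then have "coproduct C I M P (\<iota> \<circ> \<phi>)"
    by (rule category.coproduct_reindex[OF assms(2), of _ _ _ _ \<phi>])
      (use \<phi> in \<open>auto simp: bij_betw_def\<close>)
  then show ?thesis by blast
qed

lemma coproduct_to_index_type:
  fixes I :: "'i set"
  assumes "inaccessible (U :: 'u rel)" "category C" "coproduct C I M P \<iota>" "small U I"
  obtains I' :: "'u set" and M' \<iota>' where "small U I'" "coproduct C I' M' P \<iota>'" "M' ` I' = M ` I"
proof -
  obtain \<phi> :: "'i \<Rightarrow> 'u" where \<phi>: "inj_on \<phi> I" using small_embed[OF assms(1,4)] .
  have "bij_betw (inv_into I \<phi>) (\<phi> ` I) I"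
    using \<phi> by (simp add: bij_betw_imageI bij_betw_inv_into)
  then have "coproduct C (\<phi> ` I) (M \<circ> inv_into I \<phi>) P (\<iota> \<circ> inv_into I \<phi>)"
    by (rule category.coproduct_reindex[OF assms(2,3)]) simp_all
  moreover have "(M \<circ> inv_into I \<phi>) ` \<phi> ` I = M ` I"
    using \<phi> by (simp add: image_image)
  ultimately show ?thesis by (intro that[OF small_image[OF assms(4)]])
qed

lemma closed_under_coproductsD:
  assumes "inaccessible (U :: 'u rel)" "category C" "closed_under_coproducts U C B"
    "coproduct C I M P \<iota>" "small U I" "\<And>i. i \<in> I \<Longrightarrow> M i \<in> B"
  shows "P \<in> B"
proof -
  obtain I' :: "'u set" and M' \<iota>' where *: "small U I'" "coproduct C I' M' P \<iota>'" "M' ` I' = M ` I"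
    using coproduct_to_index_type[OF assms(1,2,4,5)] .
  have "M' ` I' \<subseteq> B"
    unfolding *(3) using assms(6) by auto
  then show ?thesis
    by (intro assms(3)[unfolded closed_under_coproducts_def, rule_format, of I' M' P \<iota>'])
      (use *(1,2) in auto)
qed

text \<open>\<open>Add\<close> without the passage to direct summands. Unlike \<open>Add\<close>, it
  is seen to be closed under coproducts without splitting anything.\<close>

definition coproducts_of :: "'u rel \<Rightarrow> ('o, 'm, 'z) cat_scheme \<Rightarrow> 'o set \<Rightarrow> 'o set" where
  "coproducts_of U C S = {P. \<exists>(I :: 'u set) M \<iota>. small U I \<and> (\<forall>i\<in>I. M i \<in> S) \<and> coproduct C I M P \<iota>}"

lemma coproducts_ofI:
  assumes "inaccessible (U :: 'u rel)" "category C" "coproduct C I M P \<iota>" "small U I" "\<And>i. i \<in> I \<Longrightarrow> M i \<in> S"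
  shows "P \<in> coproducts_of U C S"
proof -
  obtain I' :: "'u set" and M' \<iota>' where *: "small U I'" "coproduct C I' M' P \<iota>'" "M' ` I' = M ` I"
    using coproduct_to_index_type[OF assms(1-4)] .
  have "M' ` I' \<subseteq> S"
    unfolding *(3) using assms(5) by auto
  then show ?thesis
    unfolding coproducts_of_def by (intro CollectI exI[of _ I'] exI[of _ M'] exI[of _ \<iota>']) (use *(1,2) in auto)
qed

lemma subset_coproducts_of:
  assumes "inaccessible U" "category C" "X \<in> S" "S \<subseteq> Ob C"
  shows "X \<in> coproducts_of U C S"
  by (rule coproducts_ofI[OF assms(1,2) category.coproduct_single[OF assms(2), of X "()"]])
    (use assms in \<open>auto intro: small_finite\<close>)

lemma closed_coproducts_of:
  assumes "inaccessible U" "category C"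
  shows "closed_under_coproducts U C (coproducts_of U C S)"
  unfolding closed_under_coproducts_def
proof (intro allI impI, elim conjE)
  fix I :: "'a set" and M P \<iota>
  assume *: "small U I" "\<forall>i\<in>I. M i \<in> coproducts_of U C S" "coproduct C I M P \<iota>"
  then have "\<forall>i\<in>I. \<exists>(J :: 'a set) N \<kappa>. small U J \<and> (\<forall>j\<in>J. N j \<in> S) \<and> coproduct C J N (M i) \<kappa>"
    unfolding coproducts_of_def by simp
  then obtain J :: "_ \<Rightarrow> 'a set" and N \<kappa> where
    J: "\<forall>i\<in>I. small U (J i) \<and> (\<forall>j\<in>J i. N i j \<in> S) \<and> coproduct C (J i) (N i) (M i) (\<kappa> i)"
    unfolding bchoice_iff by blast
  have "coproduct C (Sigma I J) (\<lambda>(i, j). N i j) P (\<lambda>(i, j). \<iota> i \<cdot>\<^bsub>C\<^esub> \<kappa> i j)"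
    by (rule category.coproduct_Sigma[OF assms(2) *(3)]) (simp add: J)
  moreover have "small U (Sigma I J)"
    by (rule small_Sigma[OF assms(1) *(1)]) (simp add: J)
  ultimately show "P \<in> coproducts_of U C S"
    by (rule coproducts_ofI[OF assms]) (use J in auto)
qed

context preadditive_category
begin

text \<open>The definition of a biproduct does not list the mixed relations. They follow by
  inserting the identity of \<open>P\<close> between \<open>p\<close> and \<open>j\<close>: this
  gives \<open>p \<cdot> j\<close> as the sum of itself with itself, hence zero.\<close>

lemma biproduct_coproduct:
  assumes "i \<in> Hom C X P" "j \<in> Hom C Y P" "p \<in> Hom C P X" "q \<in> Hom C P Y"
    "p \<cdot> i = Id C X" "q \<cdot> j = Id C Y" "(i \<cdot> p) \<^bold>+ (j \<cdot> q) = Id C P"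
  shows "p \<cdot> j = zr Y X" "q \<cdot> i = zr X Y"
    "coproduct C UNIV (case_bool X Y) P (case_bool i j)"
proof -
  note D = HomD[OF assms(1)] HomD[OF assms(2)] HomD[OF assms(3)] HomD[OF assms(4)]
  have ob: "X \<in> Ob C" "Y \<in> Ob C" "P \<in> Ob C"
    using Hom_ob[OF assms(1)] Hom_ob[OF assms(2)] by auto
  have r: "p \<cdot> i \<cdot> k = k" if "k \<in> Arr C" "Cod C k = X" for k
    using arr_assoc[of p i k] that D assms(5) by simp
  have r': "q \<cdot> j \<cdot> k = k" if "k \<in> Arr C" "Cod C k = Y" for k
    using arr_assoc[of q j k] that D assms(6) by simp
  have "p \<cdot> ((i \<cdot> p) \<^bold>+ (j \<cdot> q)) \<cdot> j = p \<cdot> j" using assms(7) D ob by simp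
  then have "(p \<cdot> j) \<^bold>+ (p \<cdot> j) = p \<cdot> j" using D ob r assms(6) by simp
  then show pj: "p \<cdot> j = zr Y X" using add_eq_selfD[of "p \<cdot> j"] D by simp
  have "q \<cdot> ((i \<cdot> p) \<^bold>+ (j \<cdot> q)) \<cdot> i = q \<cdot> i" using assms(7) D ob by simp
  then have "(q \<cdot> i) \<^bold>+ (q \<cdot> i) = q \<cdot> i" using D ob r' assms(5) by simp
  then show qi: "q \<cdot> i = zr X Y" using add_eq_selfD[of "q \<cdot> i"] D by simp
  show "coproduct C UNIV (case_bool X Y) P (case_bool i j)"
  proof (rule coproductI)
    fix T f assume T: "T \<in> Ob C" and "\<And>b. b \<in> UNIV \<Longrightarrow> f b \<in> Hom C (case_bool X Y b) T"
    then have f: "f True \<in> Hom C X T" "f False \<in> Hom C Y T" by (metis UNIV_I bool.case)+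
    note fD = HomD[OF f(1)] HomD[OF f(2)]
    show "\<exists>h. h \<in> Hom C P T \<and> (\<forall>b\<in>UNIV. h \<cdot> case_bool i j b = f b)"
      by (rule exI[of _ "(f True \<cdot> p) \<^bold>+ (f False \<cdot> q)"])
        (use fD D ob T assms(5,6) pj qi in \<open>simp add: Hom_iff split: bool.split\<close>)
  next
    fix T h h' assume h: "h \<in> Hom C P T" "h' \<in> Hom C P T"
      and "\<And>b. b \<in> UNIV \<Longrightarrow> h \<cdot> case_bool i j b = h' \<cdot> case_bool i j b"
    then have eq: "h \<cdot> i = h' \<cdot> i" "h \<cdot> j = h' \<cdot> j" by (metis UNIV_I bool.case)+
    note hD = HomD[OF h(1)] HomD[OF h(2)]
    have "h = h \<cdot> ((i \<cdot> p) \<^bold>+ (j \<cdot> q))" using hD ob assms(7) by simp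
    also have "\<dots> = ((h \<cdot> i) \<cdot> p) \<^bold>+ ((h \<cdot> j) \<cdot> q)" using hD D by simp
    also have "\<dots> = h' \<cdot> ((i \<cdot> p) \<^bold>+ (j \<cdot> q))" unfolding eq using hD D by simp
    also have "\<dots> = h'" using hD ob assms(7) by simp
    finally show "h = h'" .
  qed (use assms ob in \<open>auto split: bool.split\<close>)
qed

lemma coproduct_biproduct:
  assumes "coproduct C UNIV (case_bool X Y) P \<iota>"
  shows "biproduct C X Y P"
proof -
  note D = coproductD[OF assms]
  have ob: "X \<in> Ob C" "Y \<in> Ob C" "P \<in> Ob C"
    using D(1) D(2)[of True] D(2)[of False] by auto
  have i: "\<iota> True \<in> Hom C X P" "\<iota> False \<in> Hom C Y P"
    using D(3)[of True] D(3)[of False] by auto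
  note iD = HomD[OF i(1)] HomD[OF i(2)]
  define p where "p = cotuple C UNIV P \<iota> X (case_bool (Id C X) (zr Y X))"
  define q where "q = cotuple C UNIV P \<iota> Y (case_bool (zr X Y) (Id C Y))"
  have "case_bool (Id C X) (zr Y X) b \<in> Hom C (case_bool X Y b) X"
    "case_bool (zr X Y) (Id C Y) b \<in> Hom C (case_bool X Y b) Y" for b
    using ob by (auto simp: Hom_iff split: bool.split)
  with cotuple[OF assms ob(1), of "case_bool (Id C X) (zr Y X)"]
    cotuple[OF assms ob(2), of "case_bool (zr X Y) (Id C Y)"]
  have p: "p \<in> Hom C P X" "\<And>b. p \<cdot> \<iota> b = case_bool (Id C X) (zr Y X) b"
    and q: "q \<in> Hom C P Y" "\<And>b. q \<cdot> \<iota> b = case_bool (zr X Y) (Id C Y) b"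
    unfolding p_def q_def by blast+
  note pq = HomD[OF p(1)] HomD[OF q(1)]
  have "(\<iota> True \<cdot> p) \<^bold>+ (\<iota> False \<cdot> q) = Id C P"
  proof (rule coproduct_eqI[OF assms _ _ ob(3) category_axioms])
    fix b
    show "((\<iota> True \<cdot> p) \<^bold>+ (\<iota> False \<cdot> q)) \<cdot> \<iota> b = Id C P \<cdot> \<iota> b"
      using pq iD ob p(2) q(2) by (cases b) simp_all
  qed (use pq iD ob in \<open>simp_all add: Hom_iff\<close>)
  then show ?thesis
    unfolding biproduct_def using ob i p(1) q(1) p(2)[of True] q(2)[of False] by fastforce
qed

lemma coproduct_empty_zero_object:
  assumes "coproduct C {} M Z \<iota>"
  shows "zero_object C Z"
  by (rule zero_objectI)
    (use coproductD(1)[OF assms] coproduct_eqI[OF assms, of "Id C Z" Z "zr Z Z"] category_axioms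
      Hom_simps id_hom in auto)

text \<open>The idempotent of \<open>P\<close> that projects onto the summands in \<open>J\<close>.
  "\<open>f\<close> is supported on \<open>J\<close>" is expressed as
  \<open>supp I P \<iota> J \<cdot> f = f\<close>, which avoids choosing a coproduct over
  \<open>J\<close>.\<close>

definition supp :: "'i set \<Rightarrow> 'o \<Rightarrow> ('i \<Rightarrow> 'm) \<Rightarrow> 'i set \<Rightarrow> 'm" where
  "supp I P \<iota> J = cotuple C I P \<iota> P (\<lambda>i. if i \<in> J then \<iota> i else zr (Dom C (\<iota> i)) P)"

lemma supp:
  assumes "coproduct C I M P \<iota>"
  shows "supp I P \<iota> J \<in> Hom C P P"
    "i \<in> I \<Longrightarrow> supp I P \<iota> J \<cdot> \<iota> i = (if i \<in> J then \<iota> i else zr (M i) P)"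
proof -
  note D = coproductD[OF assms]
  have *: "(if i \<in> J then \<iota> i else zr (Dom C (\<iota> i)) P) \<in> Hom C (M i) P" if "i \<in> I" for i
    using D that by (auto simp: Hom_iff)
  show "supp I P \<iota> J \<in> Hom C P P"
    "i \<in> I \<Longrightarrow> supp I P \<iota> J \<cdot> \<iota> i = (if i \<in> J then \<iota> i else zr (M i) P)"
    using cotuple[OF assms D(1) *] D(5) unfolding supp_def by auto
qed

lemma supp_supp:
  assumes "coproduct C I M P \<iota>"
  shows "supp I P \<iota> J \<cdot> supp I P \<iota> K = supp I P \<iota> (J \<inter> K)"
proof (rule coproduct_eqI[OF assms _ _ coproductD(1)[OF assms] category_axioms])
  note D = coproductD[OF assms] and S = HomD[OF supp(1)[OF assms]] supp(2)[OF assms]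
  fix i assume "i \<in> I"
  then show "(supp I P \<iota> J \<cdot> supp I P \<iota> K) \<cdot> \<iota> i = supp I P \<iota> (J \<inter> K) \<cdot> \<iota> i"
    using D S by auto
qed (use supp(1)[OF assms] comp_hom in blast)+

lemma supp_fixed_mono:
  assumes "coproduct C I M P \<iota>" "f \<in> Hom C X P" "supp I P \<iota> J \<cdot> f = f" "J \<inter> I \<subseteq> K"
  shows "supp I P \<iota> K \<cdot> f = f"
proof -
  note D = coproductD[OF assms(1)] and S = HomD[OF supp(1)[OF assms(1)]] supp(2)[OF assms(1)]
  have "supp I P \<iota> (K \<inter> J) = supp I P \<iota> J"
    by (rule coproduct_eqI[OF assms(1) supp(1)[OF assms(1)] supp(1)[OF assms(1)] D(1) category_axioms])
      (use S(4) assms(4) in auto)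
  then have "supp I P \<iota> K \<cdot> supp I P \<iota> J = supp I P \<iota> J"
    using supp_supp[OF assms(1)] by simp
  then show ?thesis
    using comp_assoc[OF supp(1)[OF assms(1)] supp(1)[OF assms(1)] assms(2), of K J] assms(3) by simp
qed

lemma supp_UNIV:
  assumes "coproduct C I M P \<iota>" "I \<subseteq> J"
  shows "supp I P \<iota> J = Id C P"
  by (rule coproduct_eqI[OF assms(1) supp(1)[OF assms(1)] id_hom coproductD(1)[OF assms(1)] category_axioms])
    (use supp(2)[OF assms(1)] coproductD[OF assms(1)] assms(2) in auto)

text \<open>Agreement on the summands in \<open>J\<close> makes \<open>h\<close> and
  \<open>h'\<close> equal after composition with the projection to \<open>J\<close>, and
  \<open>f\<close> absorbs that projection.\<close>

lemma supp_comp_eqI: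
  assumes "coproduct C I M P \<iota>" "f \<in> Hom C X P" "supp I P \<iota> J \<cdot> f = f"
    "h \<in> Hom C P T" "h' \<in> Hom C P T" "\<And>i. i \<in> I \<Longrightarrow> i \<in> J \<Longrightarrow> h \<cdot> \<iota> i = h' \<cdot> \<iota> i"
  shows "h \<cdot> f = h' \<cdot> f"
proof -
  note D = coproductD[OF assms(1)] and S = HomD[OF supp(1)[OF assms(1)]] supp(2)[OF assms(1)]
  note hD = HomD[OF assms(4)] HomD[OF assms(5)] HomD[OF assms(2)]
  have T: "T \<in> Ob C" using Hom_ob assms by blast
  have "h \<cdot> supp I P \<iota> J = h' \<cdot> supp I P \<iota> J"
    by (rule coproduct_eqI[OF assms(1) _ _ T category_axioms])
      (use S D hD T assms(6) in \<open>auto simp: Hom_iff\<close>)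
  then have "(h \<cdot> supp I P \<iota> J) \<cdot> f = (h' \<cdot> supp I P \<iota> J) \<cdot> f" by simp
  then show ?thesis using hD S assms(3) by simp
qed

text \<open>The empty coproduct is a zero object and a coproduct over \<open>bool\<close> is a
  biproduct. Through this lemma the homotopy category becomes additive.\<close>

lemma additive_categoryI:
  assumes "inaccessible U" "has_coproducts U C"
  shows "additive_category C"
proof
  show "\<exists>Z. zero_object C Z"
    using has_coproducts_small[OF assms(1) category_axioms assms(2), of "{} :: bool set"]
      small_finite[OF assms(1)] coproduct_empty_zero_object by blast
  fix X Y assume "X \<in> Ob C" "Y \<in> Ob C"
  then show "\<exists>P. biproduct C X Y P"
    using has_coproducts_small[OF assms(1) category_axioms assms(2), of "UNIV :: bool set" "case_bool X Y"]
      small_finite[OF assms(1), of "UNIV :: bool set"] coproduct_biproduct[of X Y]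
    by (metis (full_types) bool.case finite_UNIV)
qed

text \<open>A complement of \<open>X\<close> is obtained by splitting the complementary idempotent
  \<open>1 - s r\<close> of \<open>P\<close>.\<close>

lemma retract_direct_summand_if_split:
  assumes "s \<in> Hom C X P" "r \<in> Hom C P X" "r \<cdot> s = Id C X"
    and split: "\<And>e. \<lbrakk>e \<in> Hom C P P; e \<cdot> e = e\<rbrakk> \<Longrightarrow>
      \<exists>L. \<exists>h\<in>Hom C L P. \<exists>k\<in>Hom C P L. h \<cdot> k = e \<and> k \<cdot> h = Id C L"
  shows "direct_summand C X P"
proof -
  note D = HomD[OF assms(1)] HomD[OF assms(2)]
  have ob: "X \<in> Ob C" "P \<in> Ob C" using Hom_ob assms by blast+
  define e where "e = Id C P \<^bold>+ neg (s \<cdot> r)"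
  have "(s \<cdot> r) \<cdot> (s \<cdot> r) = s \<cdot> (r \<cdot> s) \<cdot> r" using D by simp
  then have sr: "s \<cdot> r \<cdot> s \<cdot> r = s \<cdot> r" using D ob assms(3) by simp
  have e: "e \<in> Hom C P P" "e \<cdot> e = e" "(s \<cdot> r) \<^bold>+ e = Id C P"
    using D ob sr by (auto simp: e_def Hom_iff add_left_commute[of "s \<cdot> r"])
  then obtain L h k where L: "h \<in> Hom C L P" "k \<in> Hom C P L" "h \<cdot> k = e" "k \<cdot> h = Id C L"
    using split by blast
  then show ?thesis
    unfolding direct_summand_def biproduct_def using assms e ob Hom_ob[OF L(1)] by blast
qed

end

section \<open>Complexes up to homotopy\<close>

lemma complexes_mono: "B \<subseteq> B' \<Longrightarrow> X \<in> complexes C B \<Longrightarrow> X \<in> complexes C B'"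
  by (auto simp: complexes_def)

lemma complexes_cpt: "X \<in> complexes C B \<Longrightarrow> cpt X n \<in> B"
  by (simp add: complexes_def)

context preadditive_category
begin

abbreviation cx :: "('o, 'm) cochain \<Rightarrow> bool" where "cx X \<equiv> X \<in> complexes C (Ob C)"

definition cls :: "('o, 'm) cochain \<Rightarrow> ('o, 'm) cochain \<Rightarrow> (int \<Rightarrow> 'm) \<Rightarrow> ('o, 'm) harrow" where
  "cls X Y f = (X, Y, homotopic C X Y `` {f})"

definition null_homotopic :: "('o, 'm) cochain \<Rightarrow> ('o, 'm) cochain \<Rightarrow> (int \<Rightarrow> 'm) \<Rightarrow> bool" where
  "null_homotopic X Y f \<longleftrightarrow> (\<exists>s. \<forall>n. s n \<in> Hom C (cpt X n) (cpt Y (n - 1)) \<and>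
     f n = (diff Y (n - 1) \<cdot> s n) \<^bold>+ (s (n + 1) \<cdot> diff X n))"

lemma cxD:
  assumes "cx X"
  shows "cpt X n \<in> Ob C" "diff X n \<in> Arr C" "Dom C (diff X n) = cpt X n"
    "Cod C (diff X n) = cpt X (n + 1)"
    "diff X (n + 1) \<cdot> diff X n = zr (cpt X n) (cpt X (n + 2))"
    "diff X n \<cdot> diff X (n - 1) = zr (cpt X (n - 1)) (cpt X (n + 1))"
proof -
  have *: "cpt X n \<in> Ob C" "diff X n \<in> Hom C (cpt X n) (cpt X (n + 1))"
    "diff X (n + 1) \<cdot> diff X n = zr (cpt X n) (cpt X (n + 2))" for n
    using assms unfolding complexes_def by blast+
  show "cpt X n \<in> Ob C" "diff X n \<in> Arr C" "Dom C (diff X n) = cpt X n"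
    "Cod C (diff X n) = cpt X (n + 1)"
    "diff X (n + 1) \<cdot> diff X n = zr (cpt X n) (cpt X (n + 2))"
    using *(1,3) HomD[OF *(2)] by blast+
  have "n - 1 + 2 = n + 1" by simp
  then show "diff X n \<cdot> diff X (n - 1) = zr (cpt X (n - 1)) (cpt X (n + 1))"
    using *(3)[of "n - 1"] by (simp only: diff_add_cancel)
qed

lemma cx_diff_diff:
  assumes "cx X" "k \<in> Arr C" "Cod C k = cpt X n"
  shows "diff X (n + 1) \<cdot> diff X n \<cdot> k = zr (Dom C k) (cpt X (n + 2))"
  using comp_reduce[OF cxD(5)[OF assms(1), of n], of k] assms cxD[OF assms(1)] by simp

lemma chain_mapD:
  assumes "f \<in> chain_maps C X Y"
  shows "f n \<in> Hom C (cpt X n) (cpt Y n)" "f n \<in> Arr C" "Dom C (f n) = cpt X n" "Cod C (f n) = cpt Y n"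
    "f (n + 1) \<cdot> diff X n = diff Y n \<cdot> f n"
  using assms by (auto simp: chain_maps_def Hom_def)

lemma chain_mapI:
  assumes "\<And>n. f n \<in> Hom C (cpt X n) (cpt Y n)" "\<And>n. f (n + 1) \<cdot> diff X n = diff Y n \<cdot> f n"
  shows "f \<in> chain_maps C X Y"
  using assms by (auto simp: chain_maps_def)

lemma chain_map_comm_comp:
  assumes "f \<in> chain_maps C X Y" "cx X" "cx Y" "k \<in> Arr C" "Cod C k = cpt X n"
  shows "f (n + 1) \<cdot> diff X n \<cdot> k = diff Y n \<cdot> f n \<cdot> k"
  using comp_reduce[OF chain_mapD(5)[OF assms(1)], of n k] chain_mapD[OF assms(1)] cxD[OF assms(2)]
    cxD[OF assms(3)] assms(4,5) by simp

lemma chain_maps_closed: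
  assumes "cx X" "cx Y"
  shows "(\<lambda>n. zr (cpt X n) (cpt Y n)) \<in> chain_maps C X Y"
    "f \<in> chain_maps C X Y \<Longrightarrow> g \<in> chain_maps C X Y \<Longrightarrow> (\<lambda>n. f n \<^bold>+ g n) \<in> chain_maps C X Y"
    "f \<in> chain_maps C X Y \<Longrightarrow> (\<lambda>n. neg (f n)) \<in> chain_maps C X Y"
proof -
  note D = cxD[OF assms(1)] cxD[OF assms(2)]
  show "(\<lambda>n. zr (cpt X n) (cpt Y n)) \<in> chain_maps C X Y"
    by (rule chain_mapI) (use D in \<open>simp_all add: Hom_iff\<close>)
  show "(\<lambda>n. neg (f n)) \<in> chain_maps C X Y" if f: "f \<in> chain_maps C X Y"
    by (rule chain_mapI) (use D chain_mapD[OF f] in \<open>simp_all add: Hom_iff\<close>)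
  show "(\<lambda>n. f n \<^bold>+ g n) \<in> chain_maps C X Y" if f: "f \<in> chain_maps C X Y" and g: "g \<in> chain_maps C X Y"
    by (rule chain_mapI) (use D chain_mapD[OF f] chain_mapD[OF g] in \<open>simp_all add: Hom_iff\<close>)
qed

lemma chain_map_Id: "cx X \<Longrightarrow> (\<lambda>n. Id C (cpt X n)) \<in> chain_maps C X X"
  by (rule chain_mapI) (use cxD in \<open>auto simp: Hom_iff\<close>)

lemma chain_map_comp:
  assumes "cx X" "cx Y" "cx Z" "g \<in> chain_maps C Y Z" "f \<in> chain_maps C X Y"
  shows "(\<lambda>n. g n \<cdot> f n) \<in> chain_maps C X Z"
proof (rule chain_mapI)
  note D = cxD[OF assms(1)] cxD[OF assms(2)] cxD[OF assms(3)] chain_mapD[OF assms(4)] chain_mapD[OF assms(5)]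
  show "g n \<cdot> f n \<in> Hom C (cpt X n) (cpt Z n)" for n using D by (simp add: Hom_iff)
  show "(g (n + 1) \<cdot> f (n + 1)) \<cdot> diff X n = diff Z n \<cdot> g n \<cdot> f n" for n
    using D chain_map_comm_comp[OF assms(4,2,3), of "f n" n] by simp
qed

lemma null_homotopicI:
  assumes "\<And>n. s n \<in> Hom C (cpt X n) (cpt Y (n - 1))"
    "\<And>n. f n = (diff Y (n - 1) \<cdot> s n) \<^bold>+ (s (n + 1) \<cdot> diff X n)"
  shows "null_homotopic X Y f"
  unfolding null_homotopic_def using assms by blast

lemma null_homotopicE:
  assumes "null_homotopic X Y f"
  obtains s where "\<And>n. s n \<in> Hom C (cpt X n) (cpt Y (n - 1))"
    "\<And>n. f n = (diff Y (n - 1) \<cdot> s n) \<^bold>+ (s (n + 1) \<cdot> diff X n)"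
proof -
  obtain s where "\<forall>n. s n \<in> Hom C (cpt X n) (cpt Y (n - 1)) \<and>
      f n = (diff Y (n - 1) \<cdot> s n) \<^bold>+ (s (n + 1) \<cdot> diff X n)"
    using assms unfolding null_homotopic_def ..
  then show thesis by (intro that[of s]) blast+
qed

lemma null_homotopic_closed:
  assumes "cx X" "cx Y"
  shows "null_homotopic X Y (\<lambda>n. zr (cpt X n) (cpt Y n))"
    "null_homotopic X Y f \<Longrightarrow> null_homotopic X Y g \<Longrightarrow> null_homotopic X Y (\<lambda>n. f n \<^bold>+ g n)"
    "null_homotopic X Y f \<Longrightarrow> null_homotopic X Y (\<lambda>n. neg (f n))"
proof -
  note D = cxD[OF assms(1)] cxD[OF assms(2)]
  show "null_homotopic X Y (\<lambda>n. zr (cpt X n) (cpt Y n))"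
    by (rule null_homotopicI[of "\<lambda>n. zr (cpt X n) (cpt Y (n - 1))"]) (use D in \<open>simp_all add: Hom_iff\<close>)
  assume "null_homotopic X Y f"
  then obtain s where s: "\<And>n. s n \<in> Hom C (cpt X n) (cpt Y (n - 1))"
    "\<And>n. f n = (diff Y (n - 1) \<cdot> s n) \<^bold>+ (s (n + 1) \<cdot> diff X n)" by (rule null_homotopicE) (rule that)
  show "null_homotopic X Y (\<lambda>n. neg (f n))"
    by (rule null_homotopicI[of "\<lambda>n. neg (s n)"])
      (use D HomD[OF s(1)] in \<open>simp_all add: Hom_iff s(2) neg_add\<close>)
  assume "null_homotopic X Y g"
  then obtain t where t: "\<And>n. t n \<in> Hom C (cpt X n) (cpt Y (n - 1))"
    "\<And>n. g n = (diff Y (n - 1) \<cdot> t n) \<^bold>+ (t (n + 1) \<cdot> diff X n)" by (rule null_homotopicE) (rule that)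
  show "null_homotopic X Y (\<lambda>n. f n \<^bold>+ g n)"
    by (rule null_homotopicI[of "\<lambda>n. s n \<^bold>+ t n"])
      (use D HomD[OF s(1)] HomD[OF t(1)] in \<open>simp_all add: Hom_iff s(2) t(2) add_ac\<close>)
qed

lemma null_homotopic_comp:
  assumes "cx X" "cx Y" "cx Z"
  shows "null_homotopic X Y f \<Longrightarrow> g \<in> chain_maps C Y Z \<Longrightarrow> null_homotopic X Z (\<lambda>n. g n \<cdot> f n)"
    "f \<in> chain_maps C X Y \<Longrightarrow> null_homotopic Y Z g \<Longrightarrow> null_homotopic X Z (\<lambda>n. g n \<cdot> f n)"
proof -
  note D = cxD[OF assms(1)] cxD[OF assms(2)] cxD[OF assms(3)]
  show "null_homotopic X Z (\<lambda>n. g n \<cdot> f n)" if nh: "null_homotopic X Y f" and g: "g \<in> chain_maps C Y Z"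
  proof -
    obtain s where s: "\<And>n. s n \<in> Hom C (cpt X n) (cpt Y (n - 1))"
      "\<And>n. f n = (diff Y (n - 1) \<cdot> s n) \<^bold>+ (s (n + 1) \<cdot> diff X n)"
      using nh by (rule null_homotopicE) (rule that)
    note E = D HomD[OF s(1)] chain_mapD[OF g]
    show ?thesis
    proof (rule null_homotopicI[of "\<lambda>n. g (n - 1) \<cdot> s n"])
      show "g (n - 1) \<cdot> s n \<in> Hom C (cpt X n) (cpt Z (n - 1))" for n using E by (simp add: Hom_iff)
      show "g n \<cdot> f n = (diff Z (n - 1) \<cdot> g (n - 1) \<cdot> s n) \<^bold>+ ((g (n + 1 - 1) \<cdot> s (n + 1)) \<cdot> diff X n)" for n
        using E chain_map_comm_comp[OF g assms(2,3), of "s n" "n - 1"] by (simp add: s(2))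
    qed
  qed
  show "null_homotopic X Z (\<lambda>n. g n \<cdot> f n)" if nh: "null_homotopic Y Z g" and f: "f \<in> chain_maps C X Y"
  proof -
    obtain s where s: "\<And>n. s n \<in> Hom C (cpt Y n) (cpt Z (n - 1))"
      "\<And>n. g n = (diff Z (n - 1) \<cdot> s n) \<^bold>+ (s (n + 1) \<cdot> diff Y n)"
      using nh by (rule null_homotopicE) (rule that)
    note E = D HomD[OF s(1)] chain_mapD[OF f]
    show ?thesis
      by (rule null_homotopicI[of "\<lambda>n. s n \<cdot> f n"]) (use E in \<open>simp_all add: Hom_iff s(2)\<close>)
  qed
qed

lemma homotopic_iff:
  assumes "cx X" "cx Y"
  shows "(f, g) \<in> homotopic C X Y \<longleftrightarrow>
    f \<in> chain_maps C X Y \<and> g \<in> chain_maps C X Y \<and> null_homotopic X Y (\<lambda>n. f n \<^bold>+ neg (g n))"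
proof -
  note D = cxD[OF assms(1)] cxD[OF assms(2)]
  have "f n = g n \<^bold>+ ((diff Y (n - 1) \<cdot> s n) \<^bold>+ (s (n + 1) \<cdot> diff X n)) \<longleftrightarrow>
      f n \<^bold>+ neg (g n) = (diff Y (n - 1) \<cdot> s n) \<^bold>+ (s (n + 1) \<cdot> diff X n)"
    if f: "f \<in> chain_maps C X Y" and g: "g \<in> chain_maps C X Y"
      and s: "\<forall>n. s n \<in> Hom C (cpt X n) (cpt Y (n - 1))" for s n
  proof -
    define u where "u = (diff Y (n - 1) \<cdot> s n) \<^bold>+ (s (n + 1) \<cdot> diff X n)"
    note fg = chain_mapD[OF f, of n] chain_mapD[OF g, of n]
    have u: "u \<in> Arr C" "Dom C u = cpt X n" "Cod C u = cpt Y n"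
      using D HomD[OF s[rule_format]] by (simp_all add: u_def)
    have "(f n \<^bold>+ neg (g n)) \<^bold>+ g n = f n" "(g n \<^bold>+ u) \<^bold>+ neg (g n) = u" "u \<^bold>+ g n = g n \<^bold>+ u"
      using fg u by (simp_all add: add_assoc add_left_commute[of "g n" u "neg (g n)"] add_commute[of u])
    then show ?thesis unfolding u_def[symmetric] by metis
  qed
  then show ?thesis
    unfolding homotopic_def null_homotopic_def by (simp add: conj_commute) metis
qed

lemma homotopic_equiv:
  assumes "cx X" "cx Y"
  shows "equiv (chain_maps C X Y) (homotopic C X Y)"
proof (rule equivI)
  note D = cxD[OF assms(1)] cxD[OF assms(2)]
  note H = homotopic_iff[OF assms] and N = null_homotopic_closed[OF assms]
  show "homotopic C X Y \<subseteq> chain_maps C X Y \<times> chain_maps C X Y"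
    by (auto simp: homotopic_def)
  show "refl_on (chain_maps C X Y) (homotopic C X Y)"
  proof (rule refl_onI)
    fix f assume f: "f \<in> chain_maps C X Y"
    then show "(f, f) \<in> homotopic C X Y"
      using N(1) chain_mapD[OF f] by (simp add: H)
  qed
  show "sym (homotopic C X Y)"
  proof (rule symI)
    fix f g assume fg: "(f, g) \<in> homotopic C X Y"
    then have c: "f \<in> chain_maps C X Y" "g \<in> chain_maps C X Y" by (simp_all add: H)
    have "neg (f n \<^bold>+ neg (g n)) = g n \<^bold>+ neg (f n)" for n
      using chain_mapD[OF c(1)] chain_mapD[OF c(2)] by (simp add: neg_add add_commute)
    then show "(g, f) \<in> homotopic C X Y" using N(3)[of "\<lambda>n. f n \<^bold>+ neg (g n)"] fg by (simp add: H)
  qed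
  show "trans (homotopic C X Y)"
  proof (rule transI)
    fix f g h assume fg: "(f, g) \<in> homotopic C X Y" and gh: "(g, h) \<in> homotopic C X Y"
    then have c: "f \<in> chain_maps C X Y" "g \<in> chain_maps C X Y" "h \<in> chain_maps C X Y" by (simp_all add: H)
    have "(f n \<^bold>+ neg (g n)) \<^bold>+ (g n \<^bold>+ neg (h n)) = f n \<^bold>+ neg (h n)" for n
      using chain_mapD[OF c(1)] chain_mapD[OF c(2)] chain_mapD[OF c(3)] by (simp add: add_assoc)
    then show "(f, h) \<in> homotopic C X Y"
      using N(2)[of "\<lambda>n. f n \<^bold>+ neg (g n)" "\<lambda>n. g n \<^bold>+ neg (h n)"] fg gh by (simp add: H)
  qed
qed

lemma cls_eq_iff:
  assumes "cx X" "cx Y" "f \<in> chain_maps C X Y" "g \<in> chain_maps C X Y"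
  shows "cls X Y f = cls X Y g \<longleftrightarrow> null_homotopic X Y (\<lambda>n. f n \<^bold>+ neg (g n))"
  using eq_equiv_class_iff[OF homotopic_equiv[OF assms(1,2)] assms(3,4)] homotopic_iff[OF assms(1,2)]
    assms(3,4) by (simp add: cls_def)

lemma cls_zero_iff:
  assumes "cx X" "cx Y" "f \<in> chain_maps C X Y"
  shows "cls X Y f = cls X Y (\<lambda>n. zr (cpt X n) (cpt Y n)) \<longleftrightarrow> null_homotopic X Y f"
proof -
  have "f n \<^bold>+ neg (zr (cpt X n) (cpt Y n)) = f n" for n
    using chain_mapD[OF assms(3)] cxD[OF assms(1)] cxD[OF assms(2)] by simp
  then show ?thesis
    using cls_eq_iff[OF assms(1-3) chain_maps_closed(1)[OF assms(1,2)]] by simp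
qed

lemma homotopic_cong:
  assumes "cx X" "cx Y" "cx Z"
  shows "(f, f') \<in> homotopic C X Y \<Longrightarrow> (g, g') \<in> homotopic C Y Z \<Longrightarrow>
      (\<lambda>n. g n \<cdot> f n, \<lambda>n. g' n \<cdot> f' n) \<in> homotopic C X Z"
    "(f, f') \<in> homotopic C X Y \<Longrightarrow> (h, h') \<in> homotopic C X Y \<Longrightarrow>
      (\<lambda>n. f n \<^bold>+ h n, \<lambda>n. f' n \<^bold>+ h' n) \<in> homotopic C X Y"
proof -
  note D = cxD[OF assms(1)] cxD[OF assms(2)] cxD[OF assms(3)]
  assume ff: "(f, f') \<in> homotopic C X Y"
  then have f: "f \<in> chain_maps C X Y" "f' \<in> chain_maps C X Y" "null_homotopic X Y (\<lambda>n. f n \<^bold>+ neg (f' n))"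
    using homotopic_iff[OF assms(1,2)] by blast+
  note fD = chain_mapD[OF f(1)] chain_mapD[OF f(2)]
  show "(\<lambda>n. f n \<^bold>+ h n, \<lambda>n. f' n \<^bold>+ h' n) \<in> homotopic C X Y" if "(h, h') \<in> homotopic C X Y"
  proof -
    have h: "h \<in> chain_maps C X Y" "h' \<in> chain_maps C X Y" "null_homotopic X Y (\<lambda>n. h n \<^bold>+ neg (h' n))"
      using that homotopic_iff[OF assms(1,2)] by blast+
    note hD = chain_mapD[OF h(1)] chain_mapD[OF h(2)]
    have "(f n \<^bold>+ neg (f' n)) \<^bold>+ (h n \<^bold>+ neg (h' n)) = (f n \<^bold>+ h n) \<^bold>+ neg (f' n \<^bold>+ h' n)" for n
      using fD hD by (simp add: neg_add add_assoc add_left_commute[of "neg (f' n)" "h n"])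
    then show ?thesis
      using null_homotopic_closed(2)[OF assms(1,2) f(3) h(3)] chain_maps_closed(2)[OF assms(1,2)] f h
      by (simp add: homotopic_iff[OF assms(1,2)])
  qed
  show "(\<lambda>n. g n \<cdot> f n, \<lambda>n. g' n \<cdot> f' n) \<in> homotopic C X Z" if "(g, g') \<in> homotopic C Y Z"
  proof -
    have g: "g \<in> chain_maps C Y Z" "g' \<in> chain_maps C Y Z" "null_homotopic Y Z (\<lambda>n. g n \<^bold>+ neg (g' n))"
      using that homotopic_iff[OF assms(2,3)] by blast+
    note gD = chain_mapD[OF g(1)] chain_mapD[OF g(2)]
    have "(g n \<cdot> (f n \<^bold>+ neg (f' n))) \<^bold>+ ((g n \<^bold>+ neg (g' n)) \<cdot> f' n) = (g n \<cdot> f n) \<^bold>+ neg (g' n \<cdot> f' n)" for n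
      using fD gD by (simp add: add_assoc)
    then show ?thesis
      using null_homotopic_closed(2)[OF assms(1,3) null_homotopic_comp(1)[OF assms f(3) g(1)]
          null_homotopic_comp(2)[OF assms f(2) g(3)]] chain_map_comp[OF assms] f g
      by (simp add: homotopic_iff[OF assms(1,3)])
  qed
qed

end

section \<open>The homotopy category as a preadditive category\<close>

locale homotopy_cat = preadditive_category C
  for C :: "('o, 'm, 'z) preadd_scheme" (structure) +
  fixes B :: "'o set"
  assumes B_ob: "B \<subseteq> Ob C"
begin

abbreviation "K \<equiv> homotopy_category C B"
abbreviation cxB :: "('o, 'm) cochain \<Rightarrow> bool" where "cxB X \<equiv> X \<in> complexes C B"

lemma cxB_cx: "cxB X \<Longrightarrow> cx X"
  using complexes_mono[OF B_ob] .

lemma K_Ob: "Ob K = complexes C B"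
  by (simp add: homotopy_category_def)

lemma K_Hom: "cxB X \<Longrightarrow> cxB Y \<Longrightarrow> Hom K X Y = cls X Y ` chain_maps C X Y"
  by (auto simp: homotopy_category_def Hom_def cls_def quotient_def)

lemma K_HomI: "cxB X \<Longrightarrow> cxB Y \<Longrightarrow> f \<in> chain_maps C X Y \<Longrightarrow> cls X Y f \<in> Hom K X Y"
  using K_Hom by blast

lemma K_HomE:
  assumes "u \<in> Hom K X Y"
  obtains f where "f \<in> chain_maps C X Y" "u = cls X Y f" "cxB X" "cxB Y"
proof -
  have "cxB X" "cxB Y" using assms by (auto simp: homotopy_category_def Hom_def)
  then show ?thesis using that assms K_Hom by blast
qed

lemma K_Id: "Id K X = cls X X (\<lambda>n. Id C (cpt X n))"
  by (simp add: homotopy_category_def cls_def)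

lemma K_zero: "hom_zero K X Y = cls X Y (\<lambda>n. zr (cpt X n) (cpt Y n))"
  by (simp add: homotopy_category_def cls_def)

text \<open>The definition takes a union over all pairs of representatives; since composition
  respects homotopy, every pair contributes the same class.\<close>

lemma K_comp:
  assumes "cxB X" "cxB Y" "cxB Z" "g \<in> chain_maps C Y Z" "f \<in> chain_maps C X Y"
  shows "cls Y Z g \<cdot>\<^bsub>K\<^esub> cls X Y f = cls X Z (\<lambda>n. g n \<cdot> f n)"
proof -
  note cx = cxB_cx[OF assms(1)] cxB_cx[OF assms(2)] cxB_cx[OF assms(3)]
  note E = homotopic_equiv[OF cx(1,2)] homotopic_equiv[OF cx(2,3)] homotopic_equiv[OF cx(1,3)]
  have "homotopic C X Z `` {\<lambda>n. g' n \<cdot> f' n} = homotopic C X Z `` {\<lambda>n. g n \<cdot> f n}"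
    if "g' \<in> homotopic C Y Z `` {g}" "f' \<in> homotopic C X Y `` {f}" for g' f'
    using equiv_class_eq[OF E(3) homotopic_cong(1)[OF cx]] that by blast
  moreover have "g \<in> homotopic C Y Z `` {g}" "f \<in> homotopic C X Y `` {f}"
    using equiv_class_self[OF E(2) assms(4)] equiv_class_self[OF E(1) assms(5)] .
  ultimately have "(\<Union>g'\<in>homotopic C Y Z `` {g}. \<Union>f'\<in>homotopic C X Y `` {f}.
      homotopic C X Z `` {\<lambda>n. g' n \<cdot> f' n}) = homotopic C X Z `` {\<lambda>n. g n \<cdot> f n}"
    by blast
  then show ?thesis by (simp add: homotopy_category_def cls_def)
qed

lemma K_add:
  assumes "cxB X" "cxB Y" "f \<in> chain_maps C X Y" "g \<in> chain_maps C X Y"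
  shows "cls X Y f \<^bold>+\<^bsub>K\<^esub> cls X Y g = cls X Y (\<lambda>n. f n \<^bold>+ g n)"
proof -
  note cx = cxB_cx[OF assms(1)] cxB_cx[OF assms(2)]
  note E = homotopic_equiv[OF cx]
  have "homotopic C X Y `` {\<lambda>n. f' n \<^bold>+ g' n} = homotopic C X Y `` {\<lambda>n. f n \<^bold>+ g n}"
    if "g' \<in> homotopic C X Y `` {g}" "f' \<in> homotopic C X Y `` {f}" for g' f'
    using equiv_class_eq[OF E homotopic_cong(2)[OF cx(1,2,2)]] that by blast
  moreover have "g \<in> homotopic C X Y `` {g}" "f \<in> homotopic C X Y `` {f}"
    using equiv_class_self[OF E] assms by blast+
  ultimately have "(\<Union>f'\<in>homotopic C X Y `` {f}. \<Union>g'\<in>homotopic C X Y `` {g}.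
      homotopic C X Y `` {\<lambda>n. f' n \<^bold>+ g' n}) = homotopic C X Y `` {\<lambda>n. f n \<^bold>+ g n}"
    by blast
  then show ?thesis by (simp add: homotopy_category_def cls_def)
qed

lemma K_cls_zero_iff:
  "cxB X \<Longrightarrow> cxB Y \<Longrightarrow> f \<in> chain_maps C X Y \<Longrightarrow> cls X Y f = hom_zero K X Y \<longleftrightarrow> null_homotopic X Y f"
  using cls_zero_iff cxB_cx by (simp add: K_zero)

lemma K_category: "category K"
proof
  show "Dom K u \<in> Ob K \<and> Cod K u \<in> Ob K" if "u \<in> Arr K" for u
    using that by (auto simp: homotopy_category_def)
  show "Id K X \<in> Hom K X X" if "X \<in> Ob K" for X
    using K_HomI[OF _ _ chain_map_Id[OF cxB_cx]] that by (simp add: K_Ob K_Id)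
next
  fix X Y Z v u assume "v \<in> Hom K Y Z" "u \<in> Hom K X Y"
  then show "v \<cdot>\<^bsub>K\<^esub> u \<in> Hom K X Z"
    by (elim K_HomE) (simp add: K_comp K_HomI chain_map_comp[where Y = Y] cxB_cx)
next
  fix X Y u assume "u \<in> Hom K X Y"
  then obtain f where f: "f \<in> chain_maps C X Y" "u = cls X Y f" "cxB X" "cxB Y" by (elim K_HomE)
  then show "Id K Y \<cdot>\<^bsub>K\<^esub> u = u" "u \<cdot>\<^bsub>K\<^esub> Id K X = u"
    using chain_map_Id cxB_cx chain_mapD[OF f(1)] by (simp_all add: K_Id K_comp)
next
  fix W X Y Z w v u assume "w \<in> Hom K Y Z" "v \<in> Hom K X Y" "u \<in> Hom K W X"
  then obtain h g f where *: "h \<in> chain_maps C Y Z" "w = cls Y Z h" "cxB Y" "cxB Z"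
    "g \<in> chain_maps C X Y" "v = cls X Y g" "cxB X"
    "f \<in> chain_maps C W X" "u = cls W X f" "cxB W" by (elim K_HomE)
  then show "(w \<cdot>\<^bsub>K\<^esub> v) \<cdot>\<^bsub>K\<^esub> u = w \<cdot>\<^bsub>K\<^esub> (v \<cdot>\<^bsub>K\<^esub> u)"
    using chain_mapD[OF *(1)] chain_mapD[OF *(5)] chain_mapD[OF *(8)]
      chain_map_comp[of X Y Z h g] chain_map_comp[of W X Y g f]
    by (simp add: K_comp cxB_cx)
qed

lemma K_preadditive: "preadditive_category K"
proof (intro preadditive_category.intro[OF K_category] preadditive_category_axioms.intro)
  fix X Y assume "X \<in> Ob K" "Y \<in> Ob K"
  then have X: "cxB X" and Y: "cxB Y" by (simp_all add: K_Ob)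
  note cx = cxB_cx[OF X] cxB_cx[OF Y]
  let ?G = "\<lparr>carrier = Hom K X Y, mult = hom_add K, one = hom_zero K X Y\<rparr>"
  show "comm_group ?G"
  proof (rule comm_groupI)
    show "\<one>\<^bsub>?G\<^esub> \<in> carrier ?G"
      using K_HomI[OF X Y chain_maps_closed(1)[OF cx]] by (simp add: K_zero)
  next
    fix u v assume "u \<in> carrier ?G" "v \<in> carrier ?G"
    then obtain f g where *: "f \<in> chain_maps C X Y" "u = cls X Y f" "g \<in> chain_maps C X Y" "v = cls X Y g"
      by (auto elim!: K_HomE)
    note fg = chain_mapD[OF *(1)] chain_mapD[OF *(3)]
    show "u \<otimes>\<^bsub>?G\<^esub> v \<in> carrier ?G"
      using * X Y by (simp add: K_add K_HomI chain_maps_closed cx)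
    show "u \<otimes>\<^bsub>?G\<^esub> v = v \<otimes>\<^bsub>?G\<^esub> u"
      using * X Y fg by (simp add: K_add add_commute)
    fix w assume "w \<in> carrier ?G"
    then obtain h where h: "h \<in> chain_maps C X Y" "w = cls X Y h"
      by (auto elim!: K_HomE)
    show "(u \<otimes>\<^bsub>?G\<^esub> v) \<otimes>\<^bsub>?G\<^esub> w = u \<otimes>\<^bsub>?G\<^esub> (v \<otimes>\<^bsub>?G\<^esub> w)"
      using * h X Y fg chain_mapD[OF h(1)] by (simp add: K_add chain_maps_closed cx add_assoc)
  next
    fix u assume "u \<in> carrier ?G"
    then obtain f where *: "f \<in> chain_maps C X Y" "u = cls X Y f" by (auto elim!: K_HomE)
    show "\<one>\<^bsub>?G\<^esub> \<otimes>\<^bsub>?G\<^esub> u = u"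
      using * X Y chain_mapD[OF *(1)] by (simp add: K_zero K_add chain_maps_closed cx)
    have "cls X Y (\<lambda>n. neg (f n)) \<in> carrier ?G"
      using * X Y by (simp add: K_HomI chain_maps_closed cx)
    moreover have "cls X Y (\<lambda>n. neg (f n)) \<otimes>\<^bsub>?G\<^esub> u = \<one>\<^bsub>?G\<^esub>"
      using * X Y chain_mapD[OF *(1)] by (simp add: K_zero K_add chain_maps_closed cx)
    ultimately show "\<exists>y\<in>carrier ?G. y \<otimes>\<^bsub>?G\<^esub> u = \<one>\<^bsub>?G\<^esub>" by blast
  qed
next
  fix X Y Z u u' v assume "u \<in> Hom K X Y" "u' \<in> Hom K X Y" "v \<in> Hom K Y Z"
  then obtain f f' g where *: "f \<in> chain_maps C X Y" "u = cls X Y f" "cxB X" "cxB Y"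
    "f' \<in> chain_maps C X Y" "u' = cls X Y f'" "g \<in> chain_maps C Y Z" "v = cls Y Z g" "cxB Z"
    by (elim K_HomE)
  then show "v \<cdot>\<^bsub>K\<^esub> (u \<^bold>+\<^bsub>K\<^esub> u') = (v \<cdot>\<^bsub>K\<^esub> u) \<^bold>+\<^bsub>K\<^esub> (v \<cdot>\<^bsub>K\<^esub> u')"
    using chain_mapD[OF *(1)] chain_mapD[OF *(5)] chain_mapD[OF *(7)]
      chain_map_comp[of X Y Z g f] chain_map_comp[of X Y Z g f']
    by (simp add: K_comp K_add chain_maps_closed cxB_cx)
next
  fix X Y Z u v v' assume "u \<in> Hom K X Y" "v \<in> Hom K Y Z" "v' \<in> Hom K Y Z"
  then obtain f g' g where *: "f \<in> chain_maps C X Y" "u = cls X Y f" "cxB X" "cxB Y"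
    "g' \<in> chain_maps C Y Z" "v' = cls Y Z g'" "g \<in> chain_maps C Y Z" "v = cls Y Z g" "cxB Z"
    by (elim K_HomE)
  then show "(v \<^bold>+\<^bsub>K\<^esub> v') \<cdot>\<^bsub>K\<^esub> u = (v \<cdot>\<^bsub>K\<^esub> u) \<^bold>+\<^bsub>K\<^esub> (v' \<cdot>\<^bsub>K\<^esub> u)"
    using chain_mapD[OF *(1)] chain_mapD[OF *(5)] chain_mapD[OF *(7)]
      chain_map_comp[of X Y Z g f] chain_map_comp[of X Y Z g' f]
    by (simp add: K_comp K_add chain_maps_closed cxB_cx)
qed

end

text \<open>The arithmetic simprocs turn \<open>n + 1 + 1\<close> into \<open>2 + n\<close>.\<close>

lemma numeral_add_commute [simp]: "(1::int) + n = n + 1" "(2::int) + n = n + 2" "(3::int) + n = n + 3"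
  by simp_all

section \<open>Coproducts of complexes, degree by degree\<close>

context preadditive_category
begin

text \<open>More rigid than a coproduct in \<open>K\<close>: the inclusions are actual chain maps
  and a coproduct is present in every degree. Equations can thus be proved strictly on summands
  instead of up to homotopy.\<close>

definition cpt_coproduct ::
  "'i set \<Rightarrow> ('i \<Rightarrow> ('o, 'm) cochain) \<Rightarrow> ('o, 'm) cochain \<Rightarrow> ('i \<Rightarrow> int \<Rightarrow> 'm) \<Rightarrow> bool" where
  "cpt_coproduct I M P \<iota> \<longleftrightarrow> cx P \<and> (\<forall>i\<in>I. cx (M i) \<and> \<iota> i \<in> chain_maps C (M i) P) \<and>
     (\<forall>n. coproduct C I (\<lambda>i. cpt (M i) n) (cpt P n) (\<lambda>i. \<iota> i n))"

lemma cpt_coproductD: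
  assumes "cpt_coproduct I M P \<iota>"
  shows "cx P" "i \<in> I \<Longrightarrow> cx (M i)" "i \<in> I \<Longrightarrow> \<iota> i \<in> chain_maps C (M i) P"
    "coproduct C I (\<lambda>i. cpt (M i) n) (cpt P n) (\<lambda>i. \<iota> i n)"
  using assms by (auto simp: cpt_coproduct_def)

lemma cpt_coproduct_eqI:
  assumes "cpt_coproduct I M P \<iota>" "h \<in> Hom C (cpt P n) T" "h' \<in> Hom C (cpt P n) T"
    "\<And>i. i \<in> I \<Longrightarrow> h \<cdot> \<iota> i n = h' \<cdot> \<iota> i n"
  shows "h = h'"
  using coproduct_eqI[OF cpt_coproductD(4)[OF assms(1)] assms(2,3) _ category_axioms] assms(4)
    Hom_ob[OF assms(2)] by simp

lemma cpt_coproduct_map: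
  assumes P: "cpt_coproduct I M P \<iota>" and T: "cx T" and f: "\<And>i. i \<in> I \<Longrightarrow> f i \<in> chain_maps C (M i) T"
  shows "\<exists>h\<in>chain_maps C P T. \<forall>i\<in>I. \<forall>n. h n \<cdot> \<iota> i n = f i n"
proof -
  define h where "h n = cotuple C I (cpt P n) (\<lambda>i. \<iota> i n) (cpt T n) (\<lambda>i. f i n)" for n
  have h: "h n \<in> Hom C (cpt P n) (cpt T n)" "i \<in> I \<Longrightarrow> h n \<cdot> \<iota> i n = f i n" for i n
    using cotuple[OF cpt_coproductD(4)[OF P] cxD(1)[OF T], of "\<lambda>i. f i n"] chain_mapD(1)[OF f]
    unfolding h_def by auto
  have "h \<in> chain_maps C P T"
  proof (rule chain_mapI[OF h(1)])
    fix n
    note D = cxD[OF cpt_coproductD(1)[OF P]] cxD[OF T] HomD[OF h(1)]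
    show "h (n + 1) \<cdot> diff P n = diff T n \<cdot> h n"
    proof (rule cpt_coproduct_eqI[OF P, where n = n and T = "cpt T (n + 1)"])
      fix i assume i: "i \<in> I"
      note E = cxD[OF cpt_coproductD(2)[OF P i]] chain_mapD[OF cpt_coproductD(3)[OF P i]] chain_mapD[OF f[OF i]]
      have "(h (n + 1) \<cdot> diff P n) \<cdot> \<iota> i n = h (n + 1) \<cdot> \<iota> i (n + 1) \<cdot> diff (M i) n"
        using D E by simp
      also have "\<dots> = diff T n \<cdot> f i n"
        using comp_reduce[OF h(2)[OF i, of "n + 1"], of "diff (M i) n"] D E by simp
      also have "\<dots> = (diff T n \<cdot> h n) \<cdot> \<iota> i n" using h(2)[OF i, of n] D E by simp
      finally show "(h (n + 1) \<cdot> diff P n) \<cdot> \<iota> i n = (diff T n \<cdot> h n) \<cdot> \<iota> i n" .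
    qed (use D in \<open>simp_all add: Hom_iff\<close>)
  qed
  then show ?thesis using h(2) by blast
qed

text \<open>Null homotopies on the summands, chosen independently, are glued in each degree by the
  universal property. This yields uniqueness of the mediating map in \<open>K\<close>.\<close>

lemma cpt_coproduct_null_homotopic:
  assumes P: "cpt_coproduct I M P \<iota>" and T: "cx T" and h: "h \<in> chain_maps C P T"
    and null: "\<And>i. i \<in> I \<Longrightarrow> null_homotopic (M i) T (\<lambda>n. h n \<cdot> \<iota> i n)"
  shows "null_homotopic P T h"
proof -
  have "\<forall>i\<in>I. \<exists>s. \<forall>n. s n \<in> Hom C (cpt (M i) n) (cpt T (n - 1)) \<and>
     h n \<cdot> \<iota> i n = (diff T (n - 1) \<cdot> s n) \<^bold>+ (s (n + 1) \<cdot> diff (M i) n)"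
    using null unfolding null_homotopic_def by simp
  then obtain s where s: "\<And>i n. i \<in> I \<Longrightarrow> s i n \<in> Hom C (cpt (M i) n) (cpt T (n - 1))"
    "\<And>i n. i \<in> I \<Longrightarrow> h n \<cdot> \<iota> i n = (diff T (n - 1) \<cdot> s i n) \<^bold>+ (s i (n + 1) \<cdot> diff (M i) n)"
    unfolding bchoice_iff by blast
  define t where "t n = cotuple C I (cpt P n) (\<lambda>i. \<iota> i n) (cpt T (n - 1)) (\<lambda>i. s i n)" for n
  have t: "t n \<in> Hom C (cpt P n) (cpt T (n - 1))" "i \<in> I \<Longrightarrow> t n \<cdot> \<iota> i n = s i n" for i n
    using cotuple[OF cpt_coproductD(4)[OF P] cxD(1)[OF T], of "\<lambda>i. s i n" n "n - 1"] s(1)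
    unfolding t_def by auto
  note D = cxD[OF cpt_coproductD(1)[OF P]] cxD[OF T] HomD[OF t(1)] chain_mapD[OF h]
  show ?thesis
  proof (rule null_homotopicI[OF t(1)])
    fix n
    show "h n = (diff T (n - 1) \<cdot> t n) \<^bold>+ (t (n + 1) \<cdot> diff P n)"
    proof (rule cpt_coproduct_eqI[OF P])
      fix i assume i: "i \<in> I"
      note E = cxD[OF cpt_coproductD(2)[OF P i]] chain_mapD[OF cpt_coproductD(3)[OF P i]] HomD[OF s(1)[OF i]]
      have *: "t (n + 1) \<cdot> \<iota> i (n + 1) \<cdot> diff (M i) n = s i (n + 1) \<cdot> diff (M i) n"
        using comp_reduce[OF t(2)[OF i, of "n + 1"], of "diff (M i) n"] D E by simp
      show "h n \<cdot> \<iota> i n = ((diff T (n - 1) \<cdot> t n) \<^bold>+ (t (n + 1) \<cdot> diff P n)) \<cdot> \<iota> i n"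
        unfolding s(2)[OF i] using D E * t(2)[OF i] by simp
    qed (use D in \<open>simp_all add: Hom_iff\<close>)
  qed
qed

end

locale homotopy_cat_coproducts = homotopy_cat C B
  for C :: "('o, 'm, 'z) preadd_scheme" (structure) and B +
  fixes U :: "'u rel"
  assumes inaccessible: "inaccessible U"
    and has_coproducts: "has_coproducts U C"
    and closed_B: "closed_under_coproducts U C B"
begin

lemma ex_cpt_coproduct:
  fixes M :: "'i \<Rightarrow> ('o, 'm) cochain"
  assumes "small U I" "\<And>i. i \<in> I \<Longrightarrow> cxB (M i)"
  shows "\<exists>P \<iota>. cxB P \<and> cpt_coproduct I M P \<iota>"
proof -
  have cx: "i \<in> I \<Longrightarrow> cx (M i)" for i using assms(2) cxB_cx by blast
  have "\<forall>n. \<exists>P \<iota>. coproduct C I (\<lambda>i. cpt (M i) n) P \<iota>"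
    by (intro allI has_coproducts_small[OF inaccessible category_axioms has_coproducts assms(1)] cxD(1)[OF cx])
  then obtain P \<iota> where P: "\<And>n. coproduct C I (\<lambda>i. cpt (M i) n) (P n) (\<iota> n)" by metis
  note PD = coproductD[OF P]
  define d where "d n = cotuple C I (P n) (\<iota> n) (P (n + 1)) (\<lambda>i. \<iota> (n + 1) i \<cdot> diff (M i) n)" for n
  have d: "d n \<in> Hom C (P n) (P (n + 1))" "i \<in> I \<Longrightarrow> d n \<cdot> \<iota> n i = \<iota> (n + 1) i \<cdot> diff (M i) n" for n i
  proof -
    have "\<iota> (n + 1) i \<cdot> diff (M i) n \<in> Hom C (cpt (M i) n) (P (n + 1))" if "i \<in> I" for i
      using cxD[OF cx[OF that]] PD that by (simp add: Hom_iff)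
    from cotuple[OF P PD(1) this] show "d n \<in> Hom C (P n) (P (n + 1))"
      "i \<in> I \<Longrightarrow> d n \<cdot> \<iota> n i = \<iota> (n + 1) i \<cdot> diff (M i) n"
      unfolding d_def by auto
  qed
  note dD = HomD[OF d(1)]
  define Q where "Q = \<lparr>cpt = P, diff = d\<rparr>"
  have PB: "P n \<in> B" for n
    using closed_under_coproductsD[OF inaccessible category_axioms closed_B P assms(1)]
      complexes_cpt[OF assms(2)] by blast
  have "d (n + 1) \<cdot> d n = zr (P n) (P (n + 2))" for n
  proof (rule coproduct_eqI[OF P])
    fix i assume i: "i \<in> I"
    note E = PD(4-6)[OF i] PD(1) cxD[OF cx[OF i]] dD
    have "(d (n + 1) \<cdot> d n) \<cdot> \<iota> n i = d (n + 1) \<cdot> \<iota> (n + 1) i \<cdot> diff (M i) n"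
      using E d(2)[OF i] by simp
    also have "\<dots> = \<iota> (n + 2) i \<cdot> diff (M i) (n + 1) \<cdot> diff (M i) n"
      using comp_reduce[OF d(2)[OF i, of "n + 1", simplified], of "diff (M i) n"] E by simp
    also have "\<dots> = zr (P n) (P (n + 2)) \<cdot> \<iota> n i"
      using E by simp
    finally show "(d (n + 1) \<cdot> d n) \<cdot> \<iota> n i = zr (P n) (P (n + 2)) \<cdot> \<iota> n i" .
  qed (use dD[of n] dD[of "n + 1"] PD(1) category_axioms in \<open>simp_all add: Hom_iff\<close>)
  then have Q: "cxB Q" using d(1) PB by (simp add: Q_def complexes_def)
  moreover have "cpt_coproduct I M Q (\<lambda>i n. \<iota> n i)"
    unfolding cpt_coproduct_def
    using cxB_cx[OF Q] cx PD(3) d(2) P by (simp add: Q_def chain_maps_def)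
  ultimately show ?thesis by blast
qed

lemma K_coproduct:
  assumes P: "cpt_coproduct I M P \<iota>" and B: "cxB P" "\<And>i. i \<in> I \<Longrightarrow> cxB (M i)"
  shows "coproduct K I M P (\<lambda>i. cls (M i) P (\<iota> i))"
proof (rule category.coproductI[OF K_category])
  note D = cpt_coproductD[OF P]
  show "P \<in> Ob K" using B by (simp add: K_Ob)
  show "cls (M i) P (\<iota> i) \<in> Hom K (M i) P" if "i \<in> I" for i
    using K_HomI[OF B(2)[OF that] B(1) D(3)[OF that]] .
next
  note D = cpt_coproductD[OF P]
  fix T u assume T: "T \<in> Ob K" and u: "\<And>i. i \<in> I \<Longrightarrow> u i \<in> Hom K (M i) T"
  then have TB: "cxB T" by (simp add: K_Ob)
  have "\<forall>i\<in>I. \<exists>f. f \<in> chain_maps C (M i) T \<and> u i = cls (M i) T f"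
    using u K_HomE by blast
  then obtain f where f: "\<And>i. i \<in> I \<Longrightarrow> f i \<in> chain_maps C (M i) T" "\<And>i. i \<in> I \<Longrightarrow> u i = cls (M i) T (f i)"
    unfolding bchoice_iff by blast
  obtain h where h: "h \<in> chain_maps C P T" "\<And>i n. i \<in> I \<Longrightarrow> h n \<cdot> \<iota> i n = f i n"
    using cpt_coproduct_map[OF P cxB_cx[OF TB], of f] f(1) by blast
  have "cls P T h \<cdot>\<^bsub>K\<^esub> cls (M i) P (\<iota> i) = u i" if "i \<in> I" for i
    using K_comp[OF B(2)[OF that] B(1) TB h(1) D(3)[OF that]] f(2)[OF that] h(2)[OF that] by simp
  then show "\<exists>v. v \<in> Hom K P T \<and> (\<forall>i\<in>I. v \<cdot>\<^bsub>K\<^esub> cls (M i) P (\<iota> i) = u i)"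
    using K_HomI[OF B(1) TB h(1)] by blast
next
  note D = cpt_coproductD[OF P]
  fix T v v' assume "T \<in> Ob K" "v \<in> Hom K P T" "v' \<in> Hom K P T"
    and eq: "\<And>i. i \<in> I \<Longrightarrow> v \<cdot>\<^bsub>K\<^esub> cls (M i) P (\<iota> i) = v' \<cdot>\<^bsub>K\<^esub> cls (M i) P (\<iota> i)"
  then obtain f g where f: "f \<in> chain_maps C P T" "v = cls P T f" and TB: "cxB T"
    and g: "g \<in> chain_maps C P T" "v' = cls P T g"
    by (metis K_HomE)
  note cx = cxB_cx[OF B(1)] cxB_cx[OF TB]
  note fg = chain_mapD[OF f(1)] chain_mapD[OF g(1)]
  have fg': "(\<lambda>n. f n \<^bold>+ neg (g n)) \<in> chain_maps C P T"
    using f(1) g(1) chain_maps_closed[OF cx] by blast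
  have "null_homotopic P T (\<lambda>n. f n \<^bold>+ neg (g n))"
  proof (rule cpt_coproduct_null_homotopic[OF P cx(2) fg'])
    fix i assume i: "i \<in> I"
    note E = chain_mapD[OF D(3)[OF i]]
    have c: "(\<lambda>n. f n \<cdot> \<iota> i n) \<in> chain_maps C (M i) T" "(\<lambda>n. g n \<cdot> \<iota> i n) \<in> chain_maps C (M i) T"
      using chain_map_comp[OF D(2)[OF i] D(1) cx(2) _ D(3)[OF i]] f g by blast+
    have "cls (M i) T (\<lambda>n. f n \<cdot> \<iota> i n) = cls (M i) T (\<lambda>n. g n \<cdot> \<iota> i n)"
      using eq[OF i] f g K_comp[OF B(2)[OF i] B(1) TB _ D(3)[OF i]] by simp
    then have "null_homotopic (M i) T (\<lambda>n. (f n \<cdot> \<iota> i n) \<^bold>+ neg (g n \<cdot> \<iota> i n))"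
      using cls_eq_iff[OF D(2)[OF i] cx(2) c] by simp
    moreover have "(f n \<^bold>+ neg (g n)) \<cdot> \<iota> i n = (f n \<cdot> \<iota> i n) \<^bold>+ neg (g n \<cdot> \<iota> i n)" for n
      using fg E by simp
    ultimately show "null_homotopic (M i) T (\<lambda>n. (f n \<^bold>+ neg (g n)) \<cdot> \<iota> i n)" by simp
  qed
  then show "v = v'" using cls_eq_iff[OF cx f(1) g(1)] f g by simp
qed

lemma K_has_coproducts: "has_coproducts U K"
  unfolding has_coproducts_def
proof (intro allI impI, elim conjE)
  fix I :: "'u set" and M
  assume "small U I" "\<forall>i\<in>I. M i \<in> Ob K"
  then have M: "\<And>i. i \<in> I \<Longrightarrow> cxB (M i)" by (simp add: K_Ob)
  show "\<exists>P \<iota>. coproduct K I M P \<iota>"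
    using ex_cpt_coproduct[where M = M, OF \<open>small U I\<close>] K_coproduct[of I M] M by blast
qed

lemma K_additive: "additive_category K"
  using preadditive_category.additive_categoryI[OF K_preadditive inaccessible K_has_coproducts] .

lemma K_zero_object_iff:
  assumes "cxB M"
  shows "zero_object K M \<longleftrightarrow> null_homotopic M M (\<lambda>n. Id C (cpt M n))"
proof -
  interpret K: preadditive_category K by (rule K_preadditive)
  show ?thesis
    using K.zero_objectI[of M] K.zero_objectD(2)[of M] K_cls_zero_iff[OF assms assms chain_map_Id] assms
      cxB_cx by (auto simp: K_Ob K_Id)
qed

end

section \<open>Direct limits of Hom sets\<close>

lemma direct_systemD:
  assumes "direct_system C r D t"
  shows "Partial_order r" "i \<in> Field r \<Longrightarrow> D i \<in> Ob C" "i \<in> Field r \<Longrightarrow> t i i = Id C (D i)"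
    "(i, j) \<in> r \<Longrightarrow> t i j \<in> Hom C (D i) (D j)"
    "(i, j) \<in> r \<Longrightarrow> (j, k) \<in> r \<Longrightarrow> t j k \<cdot>\<^bsub>C\<^esub> t i j = t i k"
  using assms unfolding direct_system_def by blast+

lemma coconeD:
  assumes "cocone C r D t L \<iota>"
  shows "L \<in> Ob C" "i \<in> Field r \<Longrightarrow> \<iota> i \<in> Hom C (D i) L"
    "(i, j) \<in> r \<Longrightarrow> \<iota> j \<cdot>\<^bsub>C\<^esub> t i j = \<iota> i"
  using assms unfolding cocone_def by blast+

context category
begin

lemma dirlim_map_class:
  assumes "direct_system C r D t" "cocone C r D t L \<iota>" "i \<in> Field r" "x \<in> Hom C X (D i)"
  shows "dirlim_map (\<lambda>i f. \<iota> i \<cdot> f)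
     (dirlim_rel r (\<lambda>i. Hom C X (D i)) (\<lambda>i j f. t i j \<cdot> f) `` {(i, x)}) = \<iota> i \<cdot> x"
proof -
  note S = direct_systemD[OF assms(1)] and cc = coconeD[OF assms(2)]
  let ?rel = "dirlim_rel r (\<lambda>i. Hom C X (D i)) (\<lambda>i j f. t i j \<cdot> f)"
  have step: "\<iota> k \<cdot> t j k \<cdot> y = \<iota> j \<cdot> y" if "(j, k) \<in> r" "y \<in> Hom C X (D j)" for j k y
  proof -
    have "k \<in> Field r" using that(1) by (auto simp: Field_def)
    then show ?thesis using comp_assoc[OF cc(2) S(4)[OF that(1)] that(2)] cc(3)[OF that(1)] by simp
  qed
  have "(i, i) \<in> r"
    using S(1) assms(3) by (auto simp: partial_order_on_def preorder_on_def refl_on_def)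
  then have self: "(i, x) \<in> ?rel `` {(i, x)}" using assms(4) by (auto simp: dirlim_rel_def)
  have "(case p of (j, y) \<Rightarrow> \<iota> j \<cdot> y) = \<iota> i \<cdot> x" if "p \<in> ?rel `` {(i, x)}" for p
  proof (cases p)
    case (Pair j y)
    with that obtain k where k: "(i, k) \<in> r" "(j, k) \<in> r" "t i k \<cdot> x = t j k \<cdot> y"
      "x \<in> Hom C X (D i)" "y \<in> Hom C X (D j)"
      by (auto simp: dirlim_rel_def)
    show ?thesis using step[OF k(1,4)] step[OF k(2,5)] k(3) Pair by simp
  qed
  then have "(\<lambda>(j, y). \<iota> j \<cdot> y) ` (?rel `` {(i, x)}) = {\<iota> i \<cdot> x}"
    using self by (auto simp: image_iff)
  then show ?thesis unfolding dirlim_map_def by simp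
qed

lemma Hom_preserves_factor:
  assumes "direct_system C r D t" "cocone C r D t L \<iota>" "Hom_preserves C X r D t L \<iota>" "f \<in> Hom C X L"
  shows "\<exists>i\<in>Field r. \<exists>g\<in>Hom C X (D i). f = \<iota> i \<cdot> g"
proof -
  let ?rel = "dirlim_rel r (\<lambda>i. Hom C X (D i)) (\<lambda>i j f. t i j \<cdot> f)"
  obtain K where K: "K \<in> dirlim r (\<lambda>i. Hom C X (D i)) (\<lambda>i j f. t i j \<cdot> f)"
    "f = dirlim_map (\<lambda>i f. \<iota> i \<cdot> f) K"
    using assms(3,4) unfolding Hom_preserves_def bij_betw_def by blast
  then obtain i x where "i \<in> Field r" "x \<in> Hom C X (D i)" "K = ?rel `` {(i, x)}"
    unfolding dirlim_def by (auto elim!: quotientE)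
  then show ?thesis using dirlim_map_class[OF assms(1,2)] K(2) by blast
qed

text \<open>The hypothesis \<open>inj\<close> is the strong form of injectivity in which no passage
  to a later index occurs. It is available for sequences of split monomorphisms, where the maps into
  the colimit have left inverses.\<close>

lemma Hom_preservesI:
  assumes sys: "direct_system C r D t" "cocone C r D t L \<iota>"
    and dir: "\<And>i j. i \<in> Field r \<Longrightarrow> j \<in> Field r \<Longrightarrow> \<exists>k. (i, k) \<in> r \<and> (j, k) \<in> r"
    and surj: "\<And>f. f \<in> Hom C X L \<Longrightarrow> \<exists>i\<in>Field r. \<exists>g\<in>Hom C X (D i). f = \<iota> i \<cdot> g"
    and inj: "\<And>i g g'. \<lbrakk>i \<in> Field r; g \<in> Hom C X (D i); g' \<in> Hom C X (D i); \<iota> i \<cdot> g = \<iota> i \<cdot> g'\<rbrakk> \<Longrightarrow> g = g'"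
  shows "Hom_preserves C X r D t L \<iota>"
  unfolding Hom_preserves_def bij_betw_def
proof
  note S = direct_systemD[OF sys(1)] and cc = coconeD[OF sys(2)]
  let ?rel = "dirlim_rel r (\<lambda>i. Hom C X (D i)) (\<lambda>i j f. t i j \<cdot> f)"
  let ?lim = "dirlim r (\<lambda>i. Hom C X (D i)) (\<lambda>i j f. t i j \<cdot> f)"
  have F: "(i, k) \<in> r \<Longrightarrow> i \<in> Field r" "(i, k) \<in> r \<Longrightarrow> k \<in> Field r" for i k
    by (auto simp: Field_def)
  have step: "t k l \<cdot> t j k \<cdot> y = t j l \<cdot> y" if "(j, k) \<in> r" "(k, l) \<in> r" "y \<in> Hom C X (D j)" for j k l y
    using comp_assoc[OF S(4)[OF that(2)] S(4)[OF that(1)] that(3)] S(5)[OF that(1,2)] by simp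
  have tr: "(i, j) \<in> r \<Longrightarrow> (j, k) \<in> r \<Longrightarrow> (i, k) \<in> r" for i j k
    using S(1) unfolding partial_order_on_def preorder_on_def by (blast dest: transD)
  have "equiv (Sigma (Field r) (\<lambda>i. Hom C X (D i))) ?rel"
  proof (rule equivI)
    show "?rel \<subseteq> Sigma (Field r) (\<lambda>i. Hom C X (D i)) \<times> Sigma (Field r) (\<lambda>i. Hom C X (D i))"
      by (auto simp: dirlim_rel_def Field_def)
    show "refl_on (Sigma (Field r) (\<lambda>i. Hom C X (D i))) ?rel"
      using S(1) by (auto simp: refl_on_def dirlim_rel_def partial_order_on_def preorder_on_def)
    show "sym ?rel" unfolding dirlim_rel_def sym_def by fastforce
    show "trans ?rel"
    proof (rule transI)
      fix a b c assume "(a, b) \<in> ?rel" "(b, c) \<in> ?rel"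
      then obtain i x j y m z k l where abc: "a = (i, x)" "b = (j, y)" "c = (m, z)"
        and *: "x \<in> Hom C X (D i)" "y \<in> Hom C X (D j)" "z \<in> Hom C X (D m)"
        "(i, k) \<in> r" "(j, k) \<in> r" "t i k \<cdot> x = t j k \<cdot> y" "(j, l) \<in> r" "(m, l) \<in> r" "t j l \<cdot> y = t m l \<cdot> z"
        by (auto simp: dirlim_rel_def)
      obtain u where u: "(k, u) \<in> r" "(l, u) \<in> r" using dir F * by blast
      have "t i u \<cdot> x = t k u \<cdot> t i k \<cdot> x" using step[OF *(4) u(1) *(1)] by simp
      also have "\<dots> = t j u \<cdot> y" using *(6) step[OF *(5) u(1) *(2)] by simp
      also have "\<dots> = t l u \<cdot> t j l \<cdot> y" using step[OF *(7) u(2) *(2)] by simp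
      also have "\<dots> = t m u \<cdot> z" using *(9) step[OF *(8) u(2) *(3)] by simp
      finally show "(a, c) \<in> ?rel"
        using abc * tr[OF *(4) u(1)] tr[OF *(8) u(2)] by (auto simp: dirlim_rel_def)
    qed
  qed
  note eq = this
  note cl = dirlim_map_class[OF sys]
  show "inj_on (dirlim_map (\<lambda>i f. \<iota> i \<cdot> f)) ?lim"
  proof (rule inj_onI)
    fix K K' assume "K \<in> ?lim" "K' \<in> ?lim" and eqm: "dirlim_map (\<lambda>i f. \<iota> i \<cdot> f) K = dirlim_map (\<lambda>i f. \<iota> i \<cdot> f) K'"
    then obtain i x j y where K: "i \<in> Field r" "x \<in> Hom C X (D i)" "K = ?rel `` {(i, x)}"
      "j \<in> Field r" "y \<in> Hom C X (D j)" "K' = ?rel `` {(j, y)}"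
      unfolding dirlim_def by (auto elim!: quotientE)
    with eqm cl have e: "\<iota> i \<cdot> x = \<iota> j \<cdot> y" by simp
    obtain k where k: "(i, k) \<in> r" "(j, k) \<in> r" using dir K by blast
    have "\<iota> k \<cdot> t i k \<cdot> x = \<iota> k \<cdot> t j k \<cdot> y"
      using e comp_assoc[OF cc(2)[OF F(2)[OF k(1)]] S(4)[OF k(1)] K(2)] cc(3)[OF k(1)]
        comp_assoc[OF cc(2)[OF F(2)[OF k(2)]] S(4)[OF k(2)] K(5)] cc(3)[OF k(2)] by simp
    then have "t i k \<cdot> x = t j k \<cdot> y"
      by (rule inj[OF F(2)[OF k(1)] comp_hom[OF S(4)[OF k(1)] K(2)] comp_hom[OF S(4)[OF k(2)] K(5)]])
    then have "((i, x), (j, y)) \<in> ?rel" using K k by (auto simp: dirlim_rel_def)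
    then show "K = K'" using equiv_class_eq[OF eq] K by simp
  qed
  show "dirlim_map (\<lambda>i f. \<iota> i \<cdot> f) ` ?lim = Hom C X L"
  proof (intro equalityI subsetI)
    fix f assume "f \<in> dirlim_map (\<lambda>i f. \<iota> i \<cdot> f) ` ?lim"
    then obtain i x where "i \<in> Field r" "x \<in> Hom C X (D i)" "f = \<iota> i \<cdot> x"
      using cl unfolding dirlim_def by (auto elim!: quotientE)
    then show "f \<in> Hom C X L" using comp_hom[OF cc(2)] by blast
  next
    fix f assume "f \<in> Hom C X L"
    then obtain i g where i: "i \<in> Field r" "g \<in> Hom C X (D i)" "f = \<iota> i \<cdot> g" using surj by blast
    then have "?rel `` {(i, g)} \<in> ?lim" unfolding dirlim_def by (auto intro: quotientI)
    then show "f \<in> dirlim_map (\<lambda>i f. \<iota> i \<cdot> f) ` ?lim" using cl i by (metis imageI)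
  qed
qed

lemma colimit_eqI:
  assumes "direct_system C r D t" "colimit C r D t L \<iota>" "h \<in> Hom C L T" "h' \<in> Hom C L T"
    "\<And>i. i \<in> Field r \<Longrightarrow> h \<cdot> \<iota> i = h' \<cdot> \<iota> i"
  shows "h = h'"
proof -
  have cc: "cocone C r D t L \<iota>" using assms(2) by (simp add: colimit_def)
  note S = direct_systemD[OF assms(1)] and cD = coconeD[OF cc]
  have F: "(i, k) \<in> r \<Longrightarrow> i \<in> Field r \<and> k \<in> Field r" for i k by (auto simp: Field_def)
  have "(h' \<cdot> \<iota> j) \<cdot> t i j = h' \<cdot> \<iota> i" if "(i, j) \<in> r" for i j
    using comp_assoc[OF assms(4) cD(2) S(4)[OF that]] cD(3)[OF that] F[OF that] by simp
  then have "cocone C r D t T (\<lambda>i. h' \<cdot> \<iota> i)"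
    unfolding cocone_def using comp_hom[OF assms(4) cD(2)] Hom_ob[OF assms(4)] by blast
  then have "\<exists>!k. k \<in> Hom C L T \<and> (\<forall>i\<in>Field r. k \<cdot> \<iota> i = h' \<cdot> \<iota> i)"
    using assms(2) unfolding colimit_def by blast
  moreover have "h \<in> Hom C L T \<and> (\<forall>i\<in>Field r. h \<cdot> \<iota> i = h' \<cdot> \<iota> i)"
    "h' \<in> Hom C L T \<and> (\<forall>i\<in>Field r. h' \<cdot> \<iota> i = h' \<cdot> \<iota> i)"
    using assms(3-5) by blast+
  ultimately show ?thesis by blast
qed

lemma colimit_map:
  assumes "colimit C r D t L \<iota>" "cocone C r D t T f"
  shows "\<exists>h\<in>Hom C L T. \<forall>i\<in>Field r. h \<cdot> \<iota> i = f i"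
  using assms unfolding colimit_def by blast

text \<open>In an ordinal sequence the term at a limit stage is a colimit only up to a given
  isomorphism; this makes it the colimit itself.\<close>

lemma colimit_isomorphism:
  assumes sys: "direct_system C r D t" and col: "colimit C r D t L \<iota>" and iso: "isomorphism C L Y h"
    and \<kappa>: "\<And>i. i \<in> Field r \<Longrightarrow> h \<cdot> \<iota> i = \<kappa> i"
  shows "colimit C r D t Y \<kappa>"
proof -
  have cc: "cocone C r D t L \<iota>" using col by (simp add: colimit_def)
  note S = direct_systemD[OF sys] and cD = coconeD[OF cc]
  obtain g where h: "h \<in> Hom C L Y" and g: "g \<in> Hom C Y L" "g \<cdot> h = Id C L" "h \<cdot> g = Id C Y"
    using iso unfolding isomorphism_def by blast
  note hg = HomD[OF h] HomD[OF g(1)]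
  have F: "(i, k) \<in> r \<Longrightarrow> i \<in> Field r \<and> k \<in> Field r" for i k by (auto simp: Field_def)
  have \<kappa>h: "\<kappa> i \<in> Hom C (D i) Y" if "i \<in> Field r" for i
    using comp_hom[OF h cD(2)[OF that]] \<kappa>[OF that] by simp
  have "\<kappa> j \<cdot> t i j = \<kappa> i" if "(i, j) \<in> r" for i j
    using comp_assoc[OF h cD(2) S(4)[OF that]] cD(3)[OF that] F[OF that] \<kappa> by metis
  then have cc': "cocone C r D t Y \<kappa>"
    unfolding cocone_def using \<kappa>h Hom_ob[OF h] by blast
  have "\<exists>!k. k \<in> Hom C Y T \<and> (\<forall>i\<in>Field r. k \<cdot> \<kappa> i = f i)" if f: "cocone C r D t T f" for T f
  proof -
    obtain k where k: "k \<in> Hom C L T" "\<forall>i\<in>Field r. k \<cdot> \<iota> i = f i" using colimit_map[OF col f] by blast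
    note kD = HomD[OF k(1)]
    have "(k \<cdot> g) \<cdot> \<kappa> i = f i" if i: "i \<in> Field r" for i
    proof -
      note \<iota>D = HomD[OF cD(2)[OF i]]
      have "(k \<cdot> g) \<cdot> \<kappa> i = k \<cdot> (g \<cdot> h) \<cdot> \<iota> i"
        unfolding \<kappa>[OF i, symmetric] using kD hg \<iota>D by simp
      then show ?thesis using g k(2) i \<iota>D cD(1) by simp
    qed
    moreover have "k' = k \<cdot> g" if k': "k' \<in> Hom C Y T" "\<forall>i\<in>Field r. k' \<cdot> \<kappa> i = f i" for k'
    proof -
      note k'D = HomD[OF k'(1)]
      have "k' \<cdot> h = k"
      proof (rule colimit_eqI[OF sys col _ k(1)])
        fix i assume i: "i \<in> Field r"
        show "(k' \<cdot> h) \<cdot> \<iota> i = k \<cdot> \<iota> i"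
          using comp_assoc[OF k'(1) h cD(2)[OF i]] \<kappa>[OF i] k'(2) k(2) i by simp
      qed (rule comp_hom[OF k'(1) h])
      then have "k \<cdot> g = k' \<cdot> h \<cdot> g" using k'D hg by auto
      then show ?thesis using g(3) k'D Hom_ob[OF h] by simp
    qed
    moreover have "k \<cdot> g \<in> Hom C Y T" using comp_hom[OF k(1) g(1)] .
    ultimately show ?thesis by (intro ex1I[of _ "k \<cdot> g"]) blast+
  qed
  with cc' show ?thesis unfolding colimit_def by blast
qed

end

section \<open>Objects that are small relative to coproducts\<close>

context preadditive_category
begin

text \<open>The bound is given by a set \<open>T\<close> and not by a cardinal, so that a common
  bound for several objects is simply a union.\<close>

definition coproduct_small :: "'u rel \<Rightarrow> 'u set \<Rightarrow> 'o \<Rightarrow> bool" where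
  "coproduct_small U T X \<longleftrightarrow> X \<in> Ob C \<and>
     (\<forall>(I :: 'u set) M P \<iota>. small U I \<and> coproduct C I M P \<iota> \<longrightarrow>
       (\<forall>f\<in>Hom C X P. \<exists>J\<subseteq>I. |J| \<le>o |T| \<and> supp I P \<iota> J \<cdot> f = f))"

text \<open>A coproduct is the \<kappa>-directed colimit of its subcoproducts with fewer than
  \<kappa> summands, and a map from a presentable object factors through one of them. The
  subcoproducts are represented by their idempotents: the diagram is constant with value
  \<open>P\<close>, and \<open>supp I P \<iota> J\<close> serves both as transition map out of
  \<open>J\<close> and as the map from \<open>J\<close> into the colimit.\<close>

lemma presentable_supp:
  assumes U: "inaccessible U" and \<kappa>: "regular_cardinal (\<kappa> :: 'u rel)" and X: "presentable U \<kappa> C X"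
    and P: "coproduct C (I :: 'u set) M P \<iota>" and I: "small U I" and f: "f \<in> Hom C X P"
  shows "\<exists>J\<subseteq>I. |J| <o \<kappa> \<and> supp I P \<iota> J \<cdot> f = f"
proof (cases "|I| <o \<kappa>")
  case True
  then show ?thesis using supp_UNIV[OF P subset_refl] HomD[OF f] by (intro exI[of _ I]) simp
next
  case False
  note PD = coproductD[OF P] and sD = supp[OF P]
  note sA = HomD[OF sD(1)]
  define W where "W = {J. J \<subseteq> I \<and> |J| <o \<kappa>}"
  have "small U W" by (rule small_subset[OF small_Pow[OF U I]]) (auto simp: W_def)
  then obtain \<phi> :: "'u set \<Rightarrow> 'u" where \<phi>: "inj_on \<phi> W" using small_embed[OF U] by blast
  define \<psi> where "\<psi> = inv_into W \<phi>"
  have \<psi>: "J \<in> W \<Longrightarrow> \<psi> (\<phi> J) = J" for J using \<phi> unfolding \<psi>_def by simp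
  \<comment> \<open>Inclusion of the subsets in \<open>W\<close>, transported along
    \<open>\<phi>\<close> to the index type, where \<open>\<psi>\<close> decodes an index.\<close>
  define r where "r = {(\<phi> J, \<phi> J') | J J'. J \<in> W \<and> J' \<in> W \<and> J \<subseteq> J'}"
  have FW: "Field r = \<phi> ` W" unfolding r_def Field_def by auto
  have r_iff: "(a, b) \<in> r \<longleftrightarrow> a \<in> Field r \<and> b \<in> Field r \<and> \<psi> a \<subseteq> \<psi> b" for a b
    unfolding FW unfolding r_def using \<psi> by (auto; blast)
  have \<psi>_inj: "a \<in> Field r \<Longrightarrow> b \<in> Field r \<Longrightarrow> \<psi> a = \<psi> b \<Longrightarrow> a = b" for a b
    unfolding FW using \<psi> by auto
  have \<psi>W: "a \<in> Field r \<Longrightarrow> \<psi> a \<in> W" for a unfolding FW using \<psi> by auto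
  have po: "Partial_order r"
    unfolding partial_order_on_def preorder_on_def
  proof (intro conjI)
    show "Refl r" by (rule refl_onI) (simp add: r_iff)
    show "trans r" by (rule transI) (auto simp: r_iff)
    show "antisym r" by (rule antisymI) (use \<psi>_inj r_iff in blast)
    show "r \<subseteq> Field r \<times> Field r" by (auto simp: Field_def)
  qed
  have \<kappa>': "Card_order \<kappa>" "infinite (Field \<kappa>)" "regularCard \<kappa>" "Cinfinite \<kappa>"
    using \<kappa> by (auto simp: regular_cardinal_def cinfinite_def)
  have dir: "directed_poset \<kappa> r"
    unfolding directed_poset_def
  proof (intro conjI po allI impI)
    fix S assume S: "S \<subseteq> Field r" "|S| <o \<kappa>"
    have "|\<Union>a\<in>S. \<psi> a| <o \<kappa>"
      using card_of_UNION_ordLess_infinite_Field_regularCard[of \<kappa> S \<psi>] \<kappa>' S \<psi>W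
      by (auto simp: W_def)
    moreover have "(\<Union>a\<in>S. \<psi> a) \<subseteq> I" using S(1) \<psi>W by (auto simp: W_def)
    ultimately have W: "(\<Union>a\<in>S. \<psi> a) \<in> W" by (simp add: W_def)
    then show "\<exists>u\<in>Field r. \<forall>s\<in>S. (s, u) \<in> r"
      by (intro bexI[of _ "\<phi> (\<Union>a\<in>S. \<psi> a)"]) (use \<psi>[OF W] S(1) FW r_iff in auto)
  qed
  \<comment> \<open>A direct system must have identities on the diagonal, so the idempotent can
    appear only between distinct indices.\<close>
  define t where "t a b = (if a = b then Id C P else supp I P \<iota> (\<psi> a))" for a b
  have sys: "direct_system C r (\<lambda>_. P) t"
    unfolding direct_system_def
  proof (intro conjI po ballI allI impI)
    show "P \<in> Ob C" using PD(1) .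
    show "t a a = Id C P" for a by (simp add: t_def)
    show "case p of (i, j) \<Rightarrow> t i j \<in> Hom C P P" for p
      using sD(1) id_hom[OF PD(1)] by (auto simp: t_def split: prod.split)
    fix a b c assume "(a, b) \<in> r \<and> (b, c) \<in> r"
    then have abc: "a \<in> Field r" "b \<in> Field r" "c \<in> Field r" "\<psi> a \<subseteq> \<psi> b" "\<psi> b \<subseteq> \<psi> c"
      using r_iff by auto
    then have "a \<noteq> b \<Longrightarrow> a \<noteq> c" using \<psi>_inj by blast
    then show "t b c \<cdot> t a b = t a c"
      using supp_supp[OF P] PD(1) sA abc by (auto simp: t_def Int_absorb1)
  qed
  have single: "{i} \<in> W" if "i \<in> I" for i
  proof -
    have "|{i}| <o natLeq" by (simp add: finite_iff_ordLess_natLeq[symmetric])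
    then have "|{i}| <o \<kappa>"
      using natLeq_ordLeq_cinfinite[OF \<kappa>'(4)] ordLess_ordLeq_trans by blast
    then show ?thesis using that by (simp add: W_def)
  qed
  \<comment> \<open>With \<open>|I|\<close> at least \<kappa> no \<open>J\<close> in
    \<open>W\<close> is everything. Every index therefore has a proper successor, and the idempotent
    of \<open>J\<close> really occurs among the transition maps.\<close>
  have grow: "\<exists>J'\<in>W. J \<subset> J'" if "J \<in> W" for J
  proof -
    have "J \<noteq> I" using that False by (auto simp: W_def)
    then obtain i where i: "i \<in> I" "i \<notin> J" using \<open>J \<in> W\<close> unfolding W_def by blast
    have "|{i} \<union> J| <o \<kappa>"
      by (rule Un_Cinfinite_bound_strict) (use single[OF i(1)] that \<kappa>' in \<open>auto simp: W_def\<close>)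
    then show ?thesis using i that by (intro bexI[of _ "{i} \<union> J"]) (auto simp: W_def)
  qed
  have cc: "cocone C r (\<lambda>_. P) t P (\<lambda>a. supp I P \<iota> (\<psi> a))"
    unfolding cocone_def
  proof (intro conjI ballI)
    fix p assume "p \<in> r"
    then obtain a b where "p = (a, b)" "\<psi> a \<subseteq> \<psi> b" using r_iff by (cases p) auto
    then show "case p of (i, j) \<Rightarrow> supp I P \<iota> (\<psi> j) \<cdot> t i j = supp I P \<iota> (\<psi> i)"
      using supp_supp[OF P] sA by (auto simp: t_def Int_absorb1)
  qed (use PD(1) sD(1) in auto)
  have "colimit C r (\<lambda>_. P) t P (\<lambda>a. supp I P \<iota> (\<psi> a))"
    unfolding colimit_def
  proof (intro conjI cc allI impI)
    fix Z c assume c: "cocone C r (\<lambda>_. P) t Z c"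
    note cD = coconeD[OF c]
    have cs: "c (\<phi> J) \<cdot> \<iota> i = c (\<phi> {i}) \<cdot> \<iota> i" if "J \<in> W" "i \<in> I" "i \<in> J" for i J
    proof (cases "J = {i}")
      case False
      note W = single[OF that(2)] that(1)
      have "\<phi> {i} \<noteq> \<phi> J" using inj_on_eq_iff[OF \<phi> W] False by simp
      moreover have "(\<phi> {i}, \<phi> J) \<in> r" using W that r_def by blast
      ultimately have "c (\<phi> J) \<cdot> supp I P \<iota> {i} = c (\<phi> {i})"
        using cD(3)[of "\<phi> {i}" "\<phi> J"] \<psi>[OF W(1)] by (simp add: t_def)
      then have "c (\<phi> {i}) \<cdot> \<iota> i = (c (\<phi> J) \<cdot> supp I P \<iota> {i}) \<cdot> \<iota> i" by simp
      also have "\<dots> = c (\<phi> J) \<cdot> \<iota> i"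
        using HomD[OF cD(2)] W FW sA sD(2)[OF that(2)] PD(1) PD(2-6)[of i] that by simp
      finally show ?thesis by simp
    qed simp
    \<comment> \<open>A cocone vanishes off \<open>J\<close> at the index \<open>J\<close>, because
      it factors through the transition map to a strictly larger \<open>J'\<close>, and that map is
      the projection to \<open>J\<close>.\<close>
    have c0: "c (\<phi> J) \<cdot> \<iota> i = zr (M i) Z" if "J \<in> W" "i \<in> I" "i \<notin> J" for i J
    proof -
      obtain J' where J': "J' \<in> W" "J \<subset> J'" using grow[OF \<open>J \<in> W\<close>] by blast
      then have "\<phi> J \<noteq> \<phi> J'" using inj_on_eq_iff[OF \<phi> \<open>J \<in> W\<close> J'(1)] by auto
      moreover have "(\<phi> J, \<phi> J') \<in> r" using J' that r_def by blast
      ultimately have "c (\<phi> J') \<cdot> supp I P \<iota> J = c (\<phi> J)"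
        using cD(3)[of "\<phi> J" "\<phi> J'"] \<psi>[OF that(1)] by (simp add: t_def)
      then have "c (\<phi> J) \<cdot> \<iota> i = (c (\<phi> J') \<cdot> supp I P \<iota> J) \<cdot> \<iota> i" by simp
      also have "\<dots> = zr (M i) Z"
        using HomD[OF cD(2)] J' FW sA sD(2)[OF that(2)] PD(1) PD(2-6)[of i] that by simp
      finally show ?thesis .
    qed
    define h where "h = cotuple C I P \<iota> Z (\<lambda>i. c (\<phi> {i}) \<cdot> \<iota> i)"
    have "c (\<phi> {i}) \<cdot> \<iota> i \<in> Hom C (M i) Z" if "i \<in> I" for i
      using comp_hom[OF cD(2)[of "\<phi> {i}"] PD(3)[OF that]] single[OF that] FW by blast
    then have h: "h \<in> Hom C P Z" "\<And>i. i \<in> I \<Longrightarrow> h \<cdot> \<iota> i = c (\<phi> {i}) \<cdot> \<iota> i"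
      using cotuple[OF P cD(1), of "\<lambda>i. c (\<phi> {i}) \<cdot> \<iota> i"] unfolding h_def by auto
    have hc: "h \<cdot> supp I P \<iota> (\<psi> a) = c a" if a: "a \<in> Field r" for a
    proof (rule coproduct_eqI[OF P comp_hom[OF h(1) sD(1)] cD(2)[OF a] cD(1) category_axioms])
      fix i assume i: "i \<in> I"
      have J: "\<psi> a \<in> W" "\<phi> (\<psi> a) = a" using \<psi>W[OF a] a FW \<psi> by auto
      show "(h \<cdot> supp I P \<iota> (\<psi> a)) \<cdot> \<iota> i = c a \<cdot> \<iota> i"
        using cs[OF J(1) i] c0[OF J(1) i] J(2) HomD[OF h(1)] sA PD(1) PD(2-6)[of i] i sD(2)[OF i, of "\<psi> a"]
          h(2)[OF i] cD(1) by (cases "i \<in> \<psi> a") simp_all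
    qed
    moreover have "h' = h" if h': "h' \<in> Hom C P Z" "\<forall>a\<in>Field r. h' \<cdot> supp I P \<iota> (\<psi> a) = c a" for h'
    proof (rule coproduct_eqI[OF P h'(1) h(1) cD(1) category_axioms])
      fix i assume i: "i \<in> I"
      have a: "\<phi> {i} \<in> Field r" "\<psi> (\<phi> {i}) = {i}" using single[OF i] FW \<psi> by auto
      have "h' \<cdot> \<iota> i = (h' \<cdot> supp I P \<iota> {i}) \<cdot> \<iota> i"
        using HomD[OF h'(1)] sA PD(1) PD(2-6)[of i] i sD(2)[OF i, of "{i}"] by simp
      also have "\<dots> = c (\<phi> {i}) \<cdot> \<iota> i" using h'(2) a by metis
      finally show "h' \<cdot> \<iota> i = h \<cdot> \<iota> i" using h(2)[OF i] by simp
    qed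
    ultimately show "\<exists>!h. h \<in> Hom C P Z \<and> (\<forall>i\<in>Field r. h \<cdot> supp I P \<iota> (\<psi> i) = c i)"
      using h(1) by (intro ex1I[of _ h]) blast+
  qed
  moreover have "small U (Field r)" unfolding FW using small_image[OF \<open>small U W\<close>] .
  ultimately have "Hom_preserves C X r (\<lambda>_. P) t P (\<lambda>a. supp I P \<iota> (\<psi> a))"
    using X dir sys unfolding presentable_def by blast
  then obtain a g where a: "a \<in> Field r" "g \<in> Hom C X P" "f = supp I P \<iota> (\<psi> a) \<cdot> g"
    using Hom_preserves_factor[OF sys cc _ f] by blast
  have "supp I P \<iota> (\<psi> a) \<cdot> f = f"
    unfolding a(3) using comp_assoc[OF sD(1) sD(1) a(2)] supp_supp[OF P] by (metis Int_absorb)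
  then show ?thesis using \<psi>W[OF a(1)] by (auto simp: W_def)
qed

lemma coproduct_small_any_index:
  fixes I :: "'i set"
  assumes "inaccessible U" "coproduct_small U (T :: 'u set) X" "coproduct C I M P \<iota>" "small U I" "f \<in> Hom C X P"
  shows "\<exists>J\<subseteq>I. |J| \<le>o |T| \<and> supp I P \<iota> J \<cdot> f = f"
proof -
  obtain \<phi> :: "'i \<Rightarrow> 'u" where \<phi>: "inj_on \<phi> I" using small_embed[OF assms(1,4)] .
  define \<psi> where "\<psi> = inv_into I \<phi>"
  have \<psi>: "i \<in> I \<Longrightarrow> \<psi> (\<phi> i) = i" for i using \<phi> by (simp add: \<psi>_def)
  have "bij_betw \<psi> (\<phi> ` I) I" unfolding \<psi>_def using \<phi> by (simp add: bij_betw_imageI bij_betw_inv_into)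
  then have P': "coproduct C (\<phi> ` I) (M \<circ> \<psi>) P (\<iota> \<circ> \<psi>)"
    by (rule coproduct_reindex[OF assms(3)]) simp_all
  obtain J where J: "J \<subseteq> \<phi> ` I" "|J| \<le>o |T|" "supp (\<phi> ` I) P (\<iota> \<circ> \<psi>) J \<cdot> f = f"
    using assms(2)[unfolded coproduct_small_def, THEN conjunct2, rule_format,
        of "\<phi> ` I" "M \<circ> \<psi>" P "\<iota> \<circ> \<psi>" f] small_image[OF assms(4), of \<phi>] P' assms(5) by blast
  have "supp I P \<iota> (\<psi> ` J) = supp (\<phi> ` I) P (\<iota> \<circ> \<psi>) J"
  proof (rule coproduct_eqI[OF assms(3) supp(1)[OF assms(3)] supp(1)[OF P'] _ category_axioms])
    show "P \<in> Ob C" by (rule coproductD(1)[OF assms(3)])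
    fix i assume i: "i \<in> I"
    have "i \<in> \<psi> ` J \<longleftrightarrow> \<phi> i \<in> J"
    proof
      assume "i \<in> \<psi> ` J"
      then obtain j where j: "j \<in> J" "i = \<psi> j" by blast
      then obtain k where "k \<in> I" "j = \<phi> k" using J(1) by blast
      then show "\<phi> i \<in> J" using j \<psi> by simp
    next
      assume "\<phi> i \<in> J"
      then show "i \<in> \<psi> ` J" using \<psi>[OF i] by (metis imageI)
    qed
    then show "supp I P \<iota> (\<psi> ` J) \<cdot> \<iota> i = supp (\<phi> ` I) P (\<iota> \<circ> \<psi>) J \<cdot> \<iota> i"
      using supp(2)[OF assms(3) i] supp(2)[OF P', of "\<phi> i" J] i \<psi> by auto
  qed
  moreover have "\<psi> ` J \<subseteq> I" using J(1) \<psi> by auto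
  moreover have "|\<psi> ` J| \<le>o |T|" using J(2) card_of_image ordLeq_transitive by blast
  ultimately show ?thesis using J(3) by (intro exI[of _ "\<psi> ` J"]) simp
qed

lemma coproduct_small_mono:
  assumes "coproduct_small U T X" "|T| \<le>o |T'|"
  shows "coproduct_small U T' X"
  using assms ordLeq_transitive unfolding coproduct_small_def by meson

lemma supp_fixed_UN:
  assumes "coproduct C I M P \<iota>" "f \<in> Hom C X P" "\<And>j. j \<in> N \<Longrightarrow> g j \<in> Hom C (Y j) X"
    "\<And>j. j \<in> N \<Longrightarrow> supp I P \<iota> (J j) \<cdot> f \<cdot> g j = f \<cdot> g j" "j \<in> N"
  shows "(supp I P \<iota> (\<Union>j\<in>N. J j) \<cdot> f) \<cdot> g j = f \<cdot> g j"
proof -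
  have "supp I P \<iota> (\<Union>j\<in>N. J j) \<cdot> f \<cdot> g j = f \<cdot> g j"
    by (rule supp_fixed_mono[OF assms(1) comp_hom[OF assms(2) assms(3)[OF assms(5)]] assms(4)[OF assms(5)]])
      (use assms(5) in auto)
  then show ?thesis
    using comp_assoc[OF supp(1)[OF assms(1)] assms(2) assms(3)[OF assms(5)]] by simp
qed

text \<open>The support of \<open>f\<close> is the union of the supports of its restrictions to the
  summands: at most \<open>|T|\<close> sets of size at most \<open>|T|\<close>.\<close>

lemma coproduct_small_coproduct:
  assumes "infinite T" "coproduct C K N X \<kappa>" "|K| \<le>o |T|" "\<And>k. k \<in> K \<Longrightarrow> coproduct_small U T (N k)"
  shows "coproduct_small U T X"
  unfolding coproduct_small_def
proof (intro conjI coproductD(1)[OF assms(2)] allI impI ballI, elim conjE)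
  note XD = coproductD[OF assms(2)]
  fix I :: "'a set" and M P \<iota> f
  assume I: "small U I" "coproduct C I M P \<iota>" and f: "f \<in> Hom C X P"
  have "\<forall>k\<in>K. \<exists>J\<subseteq>I. |J| \<le>o |T| \<and> supp I P \<iota> J \<cdot> f \<cdot> \<kappa> k = f \<cdot> \<kappa> k"
    using assms(4) I comp_hom[OF f XD(3)] unfolding coproduct_small_def by meson
  then obtain J where J: "\<forall>k\<in>K. J k \<subseteq> I \<and> |J k| \<le>o |T| \<and> supp I P \<iota> (J k) \<cdot> f \<cdot> \<kappa> k = f \<cdot> \<kappa> k"
    by metis
  have "|\<Union>k\<in>K. J k| \<le>o |T|"
    by (rule card_of_UNION_ordLeq_infinite[OF assms(1,3)]) (use J in blast)
  moreover have "supp I P \<iota> (\<Union>k\<in>K. J k) \<cdot> f = f"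
  proof (rule coproduct_eqI[OF assms(2) comp_hom[OF supp(1)[OF I(2)] f] f _ category_axioms])
    show "P \<in> Ob C" using coproductD(1)[OF I(2)] .
    show "(supp I P \<iota> (\<Union>k\<in>K. J k) \<cdot> f) \<cdot> \<kappa> k = f \<cdot> \<kappa> k" if "k \<in> K" for k
      by (rule supp_fixed_UN[OF I(2) f XD(3)]) (use J that in auto)
  qed
  ultimately show "\<exists>J\<subseteq>I. |J| \<le>o |T| \<and> supp I P \<iota> J \<cdot> f = f"
    using J by (intro exI[of _ "\<Union>k\<in>K. J k"]) auto
qed

text \<open>Write \<open>X\<close> as a \<kappa>-directed colimit of presentable objects. On each of
  them \<open>f\<close> has a support of size below \<kappa>, and the union of these supports is a
  support of \<open>f\<close>, since maps out of \<open>X\<close> are determined on the terms of the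
  diagram. The set \<open>T\<close> is large enough for the index poset and for \<kappa>.\<close>

lemma ex_coproduct_small:
  fixes U :: "'u rel"
  assumes U: "inaccessible U" and \<kappa>: "regular_cardinal \<kappa>" "\<kappa> <o U" and acc: "accessible_at U \<kappa> C"
    and X: "X \<in> Ob C"
  shows "\<exists>T :: 'u set. small U T \<and> infinite T \<and> coproduct_small U T X"
proof -
  obtain r :: "'u rel" and D t \<iota> where r: "small U (Field r)" "direct_system C r D t"
    "\<And>i. i \<in> Field r \<Longrightarrow> presentable U \<kappa> C (D i)" "colimit C r D t X \<iota>"
    using acc X unfolding accessible_at_def by metis
  define T where "T = Field r \<union> Field \<kappa>"
  have \<kappa>': "Card_order \<kappa>" "infinite (Field \<kappa>)" "\<kappa> =o |Field \<kappa>|"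
    using \<kappa> card_of_Field_ordIso ordIso_symmetric
    by (auto simp: regular_cardinal_def cinfinite_def)
  have "small U (Field \<kappa>)"
    using \<kappa>(2) \<kappa>'(3) ordIso_ordLess_trans ordIso_symmetric unfolding small_def by blast
  then have T: "small U T" "infinite T" unfolding T_def using small_Un[OF U r(1)] \<kappa>'(2) by auto
  have cc: "cocone C r D t X \<iota>" using r(4) by (simp add: colimit_def)
  note cD = coconeD[OF cc]
  have FT: "|Field r| \<le>o |T|" "\<kappa> \<le>o |T|"
    using \<kappa>'(3) card_of_mono1[of "Field \<kappa>" T] card_of_mono1[of "Field r" T] ordIso_ordLeq_trans
    unfolding T_def by blast+
  have "coproduct_small U T X"
    unfolding coproduct_small_def
  proof (intro conjI X allI impI ballI, elim conjE)
    fix I :: "'u set" and M P \<iota>' f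
    assume I: "small U I" "coproduct C I M P \<iota>'" and f: "f \<in> Hom C X P"
    have "\<forall>k\<in>Field r. \<exists>J\<subseteq>I. |J| <o \<kappa> \<and> supp I P \<iota>' J \<cdot> f \<cdot> \<iota> k = f \<cdot> \<iota> k"
      using presentable_supp[OF U \<kappa>(1) r(3) I(2,1)] comp_hom[OF f cD(2)] by blast
    then obtain J where J: "\<forall>k\<in>Field r. J k \<subseteq> I \<and> |J k| <o \<kappa> \<and> supp I P \<iota>' (J k) \<cdot> f \<cdot> \<iota> k = f \<cdot> \<iota> k"
      by metis
    have "|\<Union>k\<in>Field r. J k| \<le>o |T|"
      by (rule card_of_UNION_ordLeq_infinite[OF T(2) FT(1)])
        (use J FT(2) ordLess_imp_ordLeq ordLeq_transitive in blast)
    moreover have "supp I P \<iota>' (\<Union>k\<in>Field r. J k) \<cdot> f = f"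
    proof (rule colimit_eqI[OF r(2,4) comp_hom[OF supp(1)[OF I(2)] f] f])
      show "(supp I P \<iota>' (\<Union>k\<in>Field r. J k) \<cdot> f) \<cdot> \<iota> k = f \<cdot> \<iota> k" if "k \<in> Field r" for k
        by (rule supp_fixed_UN[OF I(2) f cD(2)]) (use J that in auto)
    qed
    ultimately show "\<exists>J\<subseteq>I. |J| \<le>o |T| \<and> supp I P \<iota>' J \<cdot> f = f"
      using J by (intro exI[of _ "\<Union>k\<in>Field r. J k"]) auto
  qed
  with T show ?thesis by blast
qed

lemma ex_uniform_coproduct_small:
  fixes U :: "'u rel"
  assumes U: "inaccessible U" and acc: "accessible U C" and S: "small U S" "S \<subseteq> Ob C"
  shows "\<exists>T :: 'u set. small U T \<and> infinite T \<and> (\<forall>X\<in>S. coproduct_small U T X)"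
proof -
  obtain \<kappa> :: "'u rel" where \<kappa>: "regular_cardinal \<kappa>" "\<kappa> <o U" "accessible_at U \<kappa> C"
    using acc unfolding accessible_def by blast
  have "\<forall>X\<in>S. \<exists>T :: 'u set. small U T \<and> infinite T \<and> coproduct_small U T X"
    using ex_coproduct_small[OF U \<kappa>] S(2) by blast
  then obtain T :: "_ \<Rightarrow> 'u set" where
    T: "\<forall>X\<in>S. small U (T X) \<and> infinite (T X) \<and> coproduct_small U (T X) X" by metis
  \<comment> \<open>A copy of the naturals keeps \<open>T'\<close> infinite even when
    \<open>S\<close> is empty.\<close>
  obtain T0 :: "nat \<Rightarrow> 'u" where T0: "inj T0" using small_embed[OF U small_countable(1)[OF U]] .
  define T' where "T' = range T0 \<union> (\<Union>X\<in>S. T X)"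
  have "small U T'" unfolding T'_def
    by (intro small_Un[OF U] small_image small_countable U small_UNION S) (use T in blast)
  moreover have "infinite T'" unfolding T'_def using T0 by (simp add: finite_image_iff)
  moreover have "coproduct_small U T' X" if "X \<in> S" for X
    by (rule coproduct_small_mono[of U "T X"])
      (use T that in \<open>auto simp: T'_def intro!: card_of_mono1\<close>)
  ultimately show ?thesis by blast
qed

end

section \<open>Sequences of split monomorphisms\<close>

lemma Well_orderD:
  assumes "Well_order r"
  shows "wf (r - Relation.Id)" "(a, b) \<in> r \<Longrightarrow> (b, c) \<in> r \<Longrightarrow> (a, c) \<in> r"
    "a \<in> Field r \<Longrightarrow> b \<in> Field r \<Longrightarrow> (a, b) \<in> r \<or> (b, a) \<in> r"
    "a \<in> Field r \<Longrightarrow> (a, a) \<in> r" "(a, b) \<in> r \<Longrightarrow> (b, a) \<in> r \<Longrightarrow> a = b"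
proof -
  have "Linear_order r" and wf: "wf (r - Relation.Id)" using assms by (auto simp: well_order_on_def)
  then have po: "Partial_order r" and tot: "Total r" by (auto simp: linear_order_on_def)
  show "wf (r - Relation.Id)" by fact
  show "(a, b) \<in> r \<Longrightarrow> (b, c) \<in> r \<Longrightarrow> (a, c) \<in> r"
    using po by (auto simp: partial_order_on_def preorder_on_def dest: transD)
  show refl: "a \<in> Field r \<Longrightarrow> (a, a) \<in> r" for a
    using po by (auto simp: partial_order_on_def preorder_on_def refl_on_def)
  show "a \<in> Field r \<Longrightarrow> b \<in> Field r \<Longrightarrow> (a, b) \<in> r \<or> (b, a) \<in> r"
    using tot refl unfolding total_on_def by metis
  show "(a, b) \<in> r \<Longrightarrow> (b, a) \<in> r \<Longrightarrow> a = b"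
    using po by (auto simp: partial_order_on_def dest: antisymD)
qed

lemma direct_system_Restr:
  assumes "direct_system C r D t" "Partial_order (Restr r A)"
  shows "direct_system C (Restr r A) D t"
proof -
  have "Field (Restr r A) \<subseteq> Field r" by (auto simp: Field_def)
  then show ?thesis using assms unfolding direct_system_def by blast
qed

context preadditive_category
begin

text \<open>
  For a \<open>\<lambda>\<close>-sequence of split monomorphisms with colimit \<open>L\<close>, writing
  \<open>Y (a + 1) = Y a + ker\<close> for a chosen retraction suggests that \<open>L\<close> is a retract of
  \<open>\<Coprod> Y a\<close>: the maps \<open>\<tau> b\<close> record the components of \<open>Y b\<close> in the successive complements,
  which need not exist as objects.
\<close>

lemma ex_split_sequence_map:
  assumes seq: "ordinal_sequence C r Y t"
    and split: "\<And>a b. imm_succ r a b \<Longrightarrow> split_mono C (Y a) (Y b) (t a b)"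
    and P: "coproduct C (Field r) Y P \<nu>"
  shows "\<exists>\<tau>. (\<forall>b\<in>Field r. \<tau> b \<in> Hom C (Y b) P \<and> (\<forall>a\<in>underS r b. \<tau> b \<cdot> t a b = \<tau> a)) \<and>
     (\<forall>A Z c s. A \<subseteq> Field r \<and> (\<forall>b\<in>A. underS r b \<subseteq> A) \<and> s \<in> Hom C P Z \<and>
        (\<forall>b\<in>A. c b \<in> Hom C (Y b) Z \<and> s \<cdot> \<nu> b = c b \<and> (\<forall>a\<in>underS r b. c b \<cdot> t a b = c a)) \<longrightarrow>
        (\<forall>b\<in>A. s \<cdot> \<tau> b = c b))"
proof -
  have wo: "Well_order r" and sys: "direct_system C r Y t" using seq by (auto simp: ordinal_sequence_def)
  note W = Well_orderD[OF wo] and S = direct_systemD[OF sys] and PD = coproductD[OF P]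
  have underS: "a \<in> underS r b \<longleftrightarrow> (a, b) \<in> r \<and> a \<noteq> b" for a b by (auto simp: underS_def)
  have F: "(a, b) \<in> r \<Longrightarrow> a \<in> Field r \<and> b \<in> Field r" for a b by (auto simp: Field_def)
  define pred where "pred b = (SOME a. imm_succ r a b)" for b
  have pred: "imm_succ r a b \<Longrightarrow> imm_succ r (pred b) b" for a b
    unfolding pred_def by (rule someI)
  have "\<forall>b. \<exists>g. imm_succ r (pred b) b \<longrightarrow> g \<in> Hom C (Y b) (Y (pred b)) \<and> g \<cdot> t (pred b) b = Id C (Y (pred b))"
    using split unfolding split_mono_def by blast
  then obtain ret where ret: "imm_succ r (pred b) b \<Longrightarrow> ret b \<in> Hom C (Y b) (Y (pred b))"
    "imm_succ r (pred b) b \<Longrightarrow> ret b \<cdot> t (pred b) b = Id C (Y (pred b))" for b by metis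
  \<comment> \<open>One step of the recursion. At a successor, \<open>ret b\<close> splits
    \<open>Y b\<close> into the image of the predecessor, where the earlier value is reused, and the
    complementary idempotent, which is sent into the new summand by \<open>\<nu> b\<close>. At the
    least element it is \<open>\<nu> b\<close>; at a limit it is induced by the earlier
    values.\<close>
  define H where "H \<tau> b = (if imm_succ r (pred b) b
      then (\<tau> (pred b) \<cdot> ret b) \<^bold>+ (\<nu> b \<cdot> (Id C (Y b) \<^bold>+ neg (t (pred b) b \<cdot> ret b)))
      else if underS r b = {} then \<nu> b
      else THE h. h \<in> Hom C (Y b) P \<and> (\<forall>a\<in>underS r b. h \<cdot> t a b = \<tau> a))" for \<tau> b
  define \<tau> where "\<tau> = wfrec (r - Relation.Id) H"
  have "adm_wf (r - Relation.Id) H"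
    unfolding adm_wf_def
  proof (intro allI impI)
    fix f g :: "_ \<Rightarrow> 'm" and x assume eq: "\<forall>z. (z, x) \<in> r - Relation.Id \<longrightarrow> f z = g z"
    then have e: "\<forall>a\<in>underS r x. f a = g a" by (auto simp: underS)
    then have "imm_succ r (pred x) x \<Longrightarrow> f (pred x) = g (pred x)" by (auto simp: imm_succ_def)
    moreover have "(\<lambda>h. h \<in> Hom C (Y x) P \<and> (\<forall>a\<in>underS r x. h \<cdot> t a x = f a)) =
        (\<lambda>h. h \<in> Hom C (Y x) P \<and> (\<forall>a\<in>underS r x. h \<cdot> t a x = g a))"
      using e by fastforce
    ultimately show "H f x = H g x" unfolding H_def by simp
  qed
  then have \<tau>: "\<tau> b = H \<tau> b" for b
    unfolding \<tau>_def using wfrec_fixpoint[OF W(1)] by metis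
  have lim: "colimit C (Restr r (underS r b)) Y t (Y b) (\<lambda>a. t a b)" "Field (Restr r (underS r b)) = underS r b"
    "direct_system C (Restr r (underS r b)) Y t"
    if b: "b \<in> Field r" "underS r b \<noteq> {}" "\<not> imm_succ r (pred b) b" for b
  proof -
    have sub: "underS r b \<subseteq> Field r" by (auto simp: underS F)
    show FR: "Field (Restr r (underS r b)) = underS r b"
      using sub W(4) by (force simp: Field_def)
    have "Partial_order (Restr r (underS r b))"
      unfolding partial_order_on_def preorder_on_def FR
    proof (intro conjI)
      show "refl_on (underS r b) (Restr r (underS r b))"
        using W(4) sub by (auto simp: refl_on_def)
      show "trans (Restr r (underS r b))" by (rule transI) (use W(2) in blast)
      show "antisym (Restr r (underS r b))" by (rule antisymI) (use W(5) in blast)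
    qed auto
    then show sysR: "direct_system C (Restr r (underS r b)) Y t"
      by (rule direct_system_Restr[OF sys])
    have "limit_element r b" using b pred unfolding limit_element_def by blast
    then obtain L \<iota> h where h: "colimit C (Restr r (underS r b)) Y t L \<iota>" "isomorphism C L (Y b) h"
      "\<forall>a\<in>underS r b. h \<cdot> \<iota> a = t a b"
      using seq unfolding ordinal_sequence_def by blast
    show "colimit C (Restr r (underS r b)) Y t (Y b) (\<lambda>a. t a b)"
      by (rule colimit_isomorphism[OF sysR h(1,2)]) (use h(3) FR in simp)
  qed
  have main: "b \<in> Field r \<longrightarrow> \<tau> b \<in> Hom C (Y b) P \<and> (\<forall>a\<in>underS r b. \<tau> b \<cdot> t a b = \<tau> a)" for b
  proof (induction b rule: wf_induct[OF W(1)])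
    case (1 b)
    then have IH: "\<tau> a \<in> Hom C (Y a) P" "a' \<in> underS r a \<Longrightarrow> \<tau> a \<cdot> t a' a = \<tau> a'" if "a \<in> underS r b" for a a'
      using that F by (auto simp: underS)
    show ?case
    proof
      assume b: "b \<in> Field r"
      consider "imm_succ r (pred b) b" | "\<not> imm_succ r (pred b) b" "underS r b = {}" |
        "\<not> imm_succ r (pred b) b" "underS r b \<noteq> {}" by blast
      then show "\<tau> b \<in> Hom C (Y b) P \<and> (\<forall>a\<in>underS r b. \<tau> b \<cdot> t a b = \<tau> a)"
      proof cases
        case 1
        then have p: "pred b \<in> underS r b" "\<And>c. c \<in> underS r b \<Longrightarrow> (c, pred b) \<in> r"
          by (auto simp: imm_succ_def)
        have pr: "(pred b, b) \<in> r" using p(1) by (simp add: underS)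
        have pF: "pred b \<in> Field r" using F[OF pr] by simp
        note D = HomD[OF IH(1)[OF p(1)]] HomD[OF ret(1)[OF 1]] HomD[OF S(4)[OF pr]] S(2)[OF b] S(2)[OF pF]
          PD(4-6)[OF b]
        have eq: "\<tau> b = (\<tau> (pred b) \<cdot> ret b) \<^bold>+ (\<nu> b \<cdot> (Id C (Y b) \<^bold>+ neg (t (pred b) b \<cdot> ret b)))"
          using \<tau>[of b] 1 by (simp add: H_def)
        have hom: "\<tau> b \<in> Hom C (Y b) P" unfolding eq using D by (simp add: Hom_iff)
        have tp: "\<tau> b \<cdot> t (pred b) b = \<tau> (pred b)"
          unfolding eq using D ret(2)[OF 1] PD(1) by simp
        have "\<tau> b \<cdot> t a b = \<tau> a" if a: "a \<in> underS r b" for a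
        proof (cases "a = pred b")
          case False
          have ar: "(a, pred b) \<in> r" using p(2)[OF a] .
          then have "\<tau> (pred b) \<cdot> t a (pred b) = \<tau> a" using IH(2)[OF p(1)] False by (simp add: underS)
          then show ?thesis
            using comp_assoc[OF hom S(4)[OF pr] S(4)[OF ar]] S(5)[OF ar pr] tp by simp
        qed (simp add: tp)
        with hom show ?thesis by blast
      next
        case 2
        then have "\<tau> b = \<nu> b" using \<tau>[of b] by (simp add: H_def)
        then show ?thesis using 2 PD(3)[OF b] by simp
      next
        case 3
        note L = lim[OF b 3(2,1)]
        have eq: "\<tau> b = (THE h. h \<in> Hom C (Y b) P \<and> (\<forall>a\<in>underS r b. h \<cdot> t a b = \<tau> a))"
          using \<tau>[of b] 3 by (simp add: H_def)
        have "cocone C (Restr r (underS r b)) Y t P \<tau>"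
          unfolding cocone_def L(2) using PD(1) IH(1) IH(2) S(3)
          by (auto simp: underS)
            (metis (no_types, lifting) F HomD(1,2) IH(1) arr_Id_right underS)
        then have "\<exists>!h. h \<in> Hom C (Y b) P \<and> (\<forall>a\<in>underS r b. h \<cdot> t a b = \<tau> a)"
          using L(1) unfolding colimit_def L(2) by blast
        from theI'[OF this, folded eq] show ?thesis .
      qed
    qed
  qed
  \<comment> \<open>If \<open>s\<close> restricts on each summand \<open>Y b\<close> to the leg
    \<open>c b\<close> of a cocone, then so does its composite with \<open>\<tau> b\<close>: at a
    successor the two contributions of the predecessor cancel. The restriction to a downward closed
    \<open>A\<close> admits maps \<open>s\<close> that behave like a cocone only on an initial
    segment.\<close>
  have "s \<cdot> \<tau> b = c b" if A: "A \<subseteq> Field r" "\<forall>b\<in>A. underS r b \<subseteq> A" and s: "s \<in> Hom C P Z"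
    and c: "\<forall>b\<in>A. c b \<in> Hom C (Y b) Z \<and> s \<cdot> \<nu> b = c b \<and> (\<forall>a\<in>underS r b. c b \<cdot> t a b = c a)"
    and "b \<in> A" for A Z c s b
    using \<open>b \<in> A\<close>
  proof (induction b rule: wf_induct_rule[OF W(1)])
    case (1 b)
    have IH: "s \<cdot> \<tau> a = c a" if "a \<in> underS r b" for a
      using that A(2) 1 by (blast dest: underS[THEN iffD1])
    have b: "b \<in> Field r" using 1 A by blast
    have cb: "c b \<in> Hom C (Y b) Z" "s \<cdot> \<nu> b = c b" "\<And>a. a \<in> underS r b \<Longrightarrow> c b \<cdot> t a b = c a"
      using c 1 by blast+
    have m: "\<tau> b \<in> Hom C (Y b) P" "\<And>a. a \<in> underS r b \<Longrightarrow> \<tau> b \<cdot> t a b = \<tau> a"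
      using main b by blast+
    consider "imm_succ r (pred b) b" | "\<not> imm_succ r (pred b) b" "underS r b = {}" |
      "\<not> imm_succ r (pred b) b" "underS r b \<noteq> {}" by blast
    then show "s \<cdot> \<tau> b = c b"
    proof cases
      case succ: 1
      then have p: "pred b \<in> underS r b" by (auto simp: imm_succ_def)
      have pr: "(pred b, b) \<in> r" using p(1) by (simp add: underS)
      have pF: "pred b \<in> Field r" using F[OF pr] by simp
      note D = HomD[OF main[rule_format, OF pF, THEN conjunct1]] HomD[OF ret(1)[OF succ]] HomD[OF S(4)[OF pr]]
        S(2)[OF b] S(2)[OF pF] PD(4-6)[OF b] HomD[OF s] HomD[OF cb(1)]
      have "s \<cdot> \<tau> b = ((s \<cdot> \<tau> (pred b)) \<cdot> ret b) \<^bold>+ ((s \<cdot> \<nu> b) \<cdot> (Id C (Y b) \<^bold>+ neg (t (pred b) b \<cdot> ret b)))"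
        using \<tau>[of b] succ D by (simp add: H_def)
      also have "\<dots> = (c (pred b) \<cdot> ret b) \<^bold>+ (c b \<^bold>+ neg ((c b \<cdot> t (pred b) b) \<cdot> ret b))"
        unfolding IH[OF p] cb(2) using D by simp
      also have "\<dots> = c b"
      proof -
        have "pred b \<in> A" using A(2) 1(2) p by blast
        then have cp: "c (pred b) \<in> Hom C (Y (pred b)) Z" using c by blast
        show ?thesis unfolding cb(3)[OF p] using D HomD[OF cp]
          by (simp add: add_left_commute[of "c (pred b) \<cdot> ret b"])
      qed
      finally show ?thesis .
    next
      case 2
      then have "\<tau> b = \<nu> b" using \<tau>[of b] by (simp add: H_def)
      then show ?thesis using cb by simp
    next
      case 3
      note L = lim[OF b 3(2,1)]
      show ?thesis
      proof (rule colimit_eqI[OF L(3,1) comp_hom[OF s m(1)] cb(1)])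
        fix a assume "a \<in> Field (Restr r (underS r b))"
        then have a: "a \<in> underS r b" using L(2) by simp
        then have "(a, b) \<in> r" by (simp add: underS)
        then show "(s \<cdot> \<tau> b) \<cdot> t a b = c b \<cdot> t a b"
          using comp_assoc[OF s m(1) S(4)] m(2)[OF a] IH[OF a] cb(3)[OF a] by simp
      qed
    qed
  qed
  then show ?thesis using main by (intro exI[of _ \<tau>]) blast
qed

text \<open>The colimit \<open>L\<close> is a retract of the coproduct \<open>P\<close> of the terms
  via \<open>s \<cdot> \<tau>L = 1\<close>. A map from \<open>X\<close> to \<open>L\<close>, pushed
  into \<open>P\<close>, has a support of size below \<kappa>, which is bounded by some index
  \<open>i\<close> because of the cofinality; so the map factors through \<open>Y i\<close>.\<close>

lemma small_rel_split_monosI: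
  assumes U: "inaccessible (U :: 'u rel)" and cop: "has_coproducts U C"
    and X: "coproduct_small U T X" and T: "|T| <o \<kappa>"
  shows "small_rel_split_monos U \<kappa> C X"
  unfolding small_rel_split_monos_def
proof (intro allI impI, elim conjE)
  fix r :: "'u rel" and Y t L \<iota>
  assume r: "small U (Field r)" "cofinality_ge \<kappa> r" and seq: "ordinal_sequence C r Y t"
    and split: "\<forall>a b. imm_succ r a b \<longrightarrow> split_mono C (Y a) (Y b) (t a b)"
    and col: "colimit C r Y t L \<iota>"
  have wo: "Well_order r" and sys: "direct_system C r Y t" using seq by (auto simp: ordinal_sequence_def)
  have cc: "cocone C r Y t L \<iota>" using col by (simp add: colimit_def)
  note W = Well_orderD[OF wo] and S = direct_systemD[OF sys] and cD = coconeD[OF cc]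
  have underS: "a \<in> underS r b \<longleftrightarrow> (a, b) \<in> r \<and> a \<noteq> b" for a b by (auto simp: underS_def)
  have F: "(a, b) \<in> r \<Longrightarrow> a \<in> Field r \<and> b \<in> Field r" for a b by (auto simp: Field_def)
  have "\<exists>P \<nu>. coproduct C (Field r) Y P \<nu>"
    using cop r(1) S(2) unfolding has_coproducts_def by blast
  then obtain P \<nu> where P: "coproduct C (Field r) Y P \<nu>" by blast
  note PD = coproductD[OF P]
  obtain \<tau> where \<tau>: "\<And>b. b \<in> Field r \<Longrightarrow> \<tau> b \<in> Hom C (Y b) P"
    "\<And>a b. b \<in> Field r \<Longrightarrow> a \<in> underS r b \<Longrightarrow> \<tau> b \<cdot> t a b = \<tau> a"
    and uniq: "\<And>A Z c s. \<lbrakk>A \<subseteq> Field r; \<forall>b\<in>A. underS r b \<subseteq> A; s \<in> Hom C P Z;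
        \<forall>b\<in>A. c b \<in> Hom C (Y b) Z \<and> s \<cdot> \<nu> b = c b \<and> (\<forall>a\<in>underS r b. c b \<cdot> t a b = c a)\<rbrakk> \<Longrightarrow>
        \<forall>b\<in>A. s \<cdot> \<tau> b = c b"
    using ex_split_sequence_map[OF seq _ P] split by (smt (verit))
  have "\<tau> b \<cdot> t a b = \<tau> a" if "(a, b) \<in> r" for a b
  proof (cases "a = b")
    case True
    then show ?thesis using S(3)[of a] F[OF that] id_right[OF \<tau>(1)] by simp
  qed (use \<tau>(2) F[OF that] that in \<open>simp add: underS\<close>)
  then have "cocone C r Y t P \<tau>" unfolding cocone_def using PD(1) \<tau>(1) by blast
  then obtain \<tau>L where \<tau>L: "\<tau>L \<in> Hom C L P" "\<And>b. b \<in> Field r \<Longrightarrow> \<tau>L \<cdot> \<iota> b = \<tau> b"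
    using colimit_map[OF col] by blast
  define s where "s = cotuple C (Field r) P \<nu> L \<iota>"
  have s: "s \<in> Hom C P L" "\<And>b. b \<in> Field r \<Longrightarrow> s \<cdot> \<nu> b = \<iota> b"
    using cotuple[OF P cD(1), of \<iota>] cD(2) unfolding s_def by auto
  have s\<tau>: "\<forall>b\<in>Field r. s \<cdot> \<tau> b = \<iota> b"
    by (rule uniq[OF subset_refl _ s(1)]) (use F s(2) cD(2,3) in \<open>auto simp: underS\<close>)
  have s\<tau>L: "s \<cdot> \<tau>L = Id C L"
  proof (rule colimit_eqI[OF sys col comp_hom[OF s(1) \<tau>L(1)] id_hom[OF cD(1)]])
    fix b assume b: "b \<in> Field r"
    show "(s \<cdot> \<tau>L) \<cdot> \<iota> b = Id C L \<cdot> \<iota> b"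
      using comp_assoc[OF s(1) \<tau>L(1) cD(2)[OF b]] \<tau>L(2)[OF b] s\<tau> b id_left[OF cD(2)[OF b]] by simp
  qed
  \<comment> \<open>\<open>p i\<close> is a retraction of \<open>P\<close> onto the i-th term: the
    transition map on summands up to \<open>i\<close> and zero beyond.\<close>
  define c where "c i a = (if (a, i) \<in> r then t a i else zr (Y a) (Y i))" for i a
  define p where "p i = cotuple C (Field r) P \<nu> (Y i) (c i)" for i
  have cH: "c i a \<in> Hom C (Y a) (Y i)" if "i \<in> Field r" "a \<in> Field r" for i a
    using that S(4) Hom_simps(1) S(2) by (simp add: c_def)
  have p: "p i \<in> Hom C P (Y i)" "\<And>a. a \<in> Field r \<Longrightarrow> p i \<cdot> \<nu> a = c i a" if "i \<in> Field r" for i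
    using cotuple[OF P S(2)[OF that] cH[OF that]] unfolding p_def by auto
  have p\<tau>: "p i \<cdot> \<tau> i = Id C (Y i)" if i: "i \<in> Field r" for i
  proof -
    \<comment> \<open>Uniqueness is applied to the initial segment up to \<open>i\<close> only;
      across \<open>i\<close> the family \<open>c i\<close> is no longer a cocone. Consequently
      \<open>p i \<cdot> \<tau>L\<close> is a left inverse of \<open>\<iota> i\<close>, which gives
      injectivity below.\<close>
    have "\<forall>b\<in>{a. (a, i) \<in> r}. p i \<cdot> \<tau> b = c i b"
    proof (rule uniq[OF _ _ p(1)[OF i]], safe)
      fix a b assume "(b, i) \<in> r" "a \<in> underS r b"
      then show "(a, i) \<in> r" "c i b \<cdot> t a b = c i a"
        using W(2)[of a b i] S(5)[of a b i] by (auto simp: underS c_def)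
    qed (use F p[OF i] cH[OF i] in blast)+
    then show ?thesis using W(4)[OF i] S(3)[OF i] by (simp add: c_def)
  qed
  show "Hom_preserves C X r Y t L \<iota>"
  proof (rule Hom_preservesI[OF sys cc])
    show "i \<in> Field r \<Longrightarrow> j \<in> Field r \<Longrightarrow> \<exists>k. (i, k) \<in> r \<and> (j, k) \<in> r" for i j
      using W(3,4) by blast
  next
    fix i g g' assume i: "i \<in> Field r" and g: "g \<in> Hom C X (Y i)" "g' \<in> Hom C X (Y i)" "\<iota> i \<cdot> g = \<iota> i \<cdot> g'"
    have "k = p i \<cdot> \<tau>L \<cdot> \<iota> i \<cdot> k" if k: "k \<in> Hom C X (Y i)" for k
    proof -
      note D = HomD[OF p(1)[OF i]] HomD[OF \<tau>L(1)] HomD[OF cD(2)[OF i]] HomD[OF k] HomD[OF \<tau>(1)[OF i]]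
      have "p i \<cdot> \<tau>L \<cdot> \<iota> i \<cdot> k = (p i \<cdot> (\<tau>L \<cdot> \<iota> i)) \<cdot> k" using D by simp
      then show ?thesis unfolding \<tau>L(2)[OF i] p\<tau>[OF i] using D by simp
    qed
    then show "g = g'" using g by metis
  next
    fix f assume f: "f \<in> Hom C X L"
    have \<tau>f: "\<tau>L \<cdot> f \<in> Hom C X P" using comp_hom[OF \<tau>L(1) f] .
    obtain J where J: "J \<subseteq> Field r" "|J| \<le>o |T|" "supp (Field r) P \<nu> J \<cdot> \<tau>L \<cdot> f = \<tau>L \<cdot> f"
      using X r(1) P \<tau>f unfolding coproduct_small_def by blast
    \<comment> \<open>\<open>J\<close> is too small to be cofinal, so some \<open>i\<close> has no
      element of \<open>J\<close> at or above it; by linearity all of \<open>J\<close> lies below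
      \<open>i\<close>.\<close>
    have "\<not> \<kappa> \<le>o |J|" using J(2) T not_ordLess_ordLeq ordLeq_ordLess_trans by blast
    then obtain i where i: "i \<in> Field r" "\<forall>b\<in>J. (i, b) \<notin> r"
      using r(2) J(1) unfolding cofinality_ge_def by blast
    then have Ji: "a \<in> J \<Longrightarrow> (a, i) \<in> r" for a using W(3) J(1) by blast
    have "f = (s \<cdot> \<tau>L) \<cdot> f" using s\<tau>L id_left[OF f] by simp
    also have "\<dots> = s \<cdot> \<tau>L \<cdot> f" using comp_assoc[OF s(1) \<tau>L(1) f] .
    also have "\<dots> = (\<iota> i \<cdot> p i) \<cdot> \<tau>L \<cdot> f"
    proof (rule supp_comp_eqI[OF P \<tau>f J(3) s(1) comp_hom[OF cD(2)[OF i(1)] p(1)[OF i(1)]]])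
      fix a assume a: "a \<in> Field r" "a \<in> J"
      show "s \<cdot> \<nu> a = (\<iota> i \<cdot> p i) \<cdot> \<nu> a"
        using s(2)[OF a(1)] comp_assoc[OF cD(2)[OF i(1)] p(1)[OF i(1)] PD(3)[OF a(1)]] p(2)[OF i(1) a(1)]
          Ji[OF a(2)] cD(3)[OF Ji[OF a(2)]] by (simp add: c_def)
    qed
    also have "\<dots> = \<iota> i \<cdot> p i \<cdot> \<tau>L \<cdot> f" using comp_assoc[OF cD(2)[OF i(1)] p(1)[OF i(1)] \<tau>f] .
    finally show "\<exists>i\<in>Field r. \<exists>g\<in>Hom C X (Y i). f = \<iota> i \<cdot> g"
      using i(1) comp_hom[OF p(1)[OF i(1)] \<tau>f] by blast
  qed
qed

end

section \<open>Complexes of coproducts\<close>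

text \<open>
  \<open>R\<close> bounds the support of the differential: \<open>R\<close>-closed sets of basis elements span subcomplexes.
\<close>

locale based_complex = preadditive_category C
  for C :: "('o, 'm, 'z) preadd_scheme" (structure) +
  fixes Q :: "('o, 'm) cochain" and E :: "int \<Rightarrow> 'i set" and N :: "int \<Rightarrow> 'i \<Rightarrow> 'o"
    and \<iota> :: "int \<Rightarrow> 'i \<Rightarrow> 'm" and R :: "(int \<times> 'i) rel"
  assumes Q: "cx Q"
    and basis: "\<And>n. coproduct C (E n) (N n) (cpt Q n) (\<iota> n)"
    and R_sub: "((n, e), x) \<in> R \<Longrightarrow> e \<in> E n \<and> (\<exists>e'\<in>E (n + 1). x = (n + 1, e'))"
    and R_supp: "e \<in> E n \<Longrightarrow> supp (E (n + 1)) (cpt Q (n + 1)) (\<iota> (n + 1)) {e'. ((n, e), (n + 1, e')) \<in> R} \<cdot>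
      diff Q n \<cdot> \<iota> n e = diff Q n \<cdot> \<iota> n e"
begin

lemmas QD = cxD[OF Q] and bD = coproductD[OF basis]

text \<open>Since \<open>G\<close> is closed under \<open>R\<close>, the differential of a basis
  element of \<open>G\<close> is supported on \<open>G\<close>, so only the values of
  \<open>h\<close> and \<open>h'\<close> on \<open>G\<close> matter.\<close>

lemma diff_comp_eqI:
  assumes G: "R `` G \<subseteq> G" and e: "e \<in> E n" "(n, e) \<in> G"
    and h: "h \<in> Hom C (cpt Q (n + 1)) Z" "h' \<in> Hom C (cpt Q (n + 1)) Z"
    and eq: "\<And>e'. e' \<in> E (n + 1) \<Longrightarrow> (n + 1, e') \<in> G \<Longrightarrow> h \<cdot> \<iota> (n + 1) e' = h' \<cdot> \<iota> (n + 1) e'"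
  shows "h \<cdot> diff Q n \<cdot> \<iota> n e = h' \<cdot> diff Q n \<cdot> \<iota> n e"
proof (rule supp_comp_eqI[OF basis _ R_supp[OF e(1)] h])
  show "diff Q n \<cdot> \<iota> n e \<in> Hom C (N n e) (cpt Q (n + 1))"
    using QD bD e by (simp add: Hom_iff)
  show "h \<cdot> \<iota> (n + 1) e' = h' \<cdot> \<iota> (n + 1) e'"
    if "e' \<in> E (n + 1)" "e' \<in> {e'. ((n, e), (n + 1, e')) \<in> R}" for e'
    using eq that G e by blast
qed

text \<open>\<open>G\<close> and \<open>G'\<close> span subcomplexes of \<open>Q\<close>;
  \<open>X\<close> is the quotient of the first by its intersection with the second, with the
  remaining basis elements \<open>D\<close> as basis. The maps \<open>i\<close> and \<open>p\<close>
  are the inclusion and projection in each degree and in general are not chain maps; the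
  differential is the compression \<open>p d i\<close>.\<close>

lemma subquotient:
  assumes G: "R `` G \<subseteq> G" "R `` G' \<subseteq> G'" and D: "\<And>n. D n = {e \<in> E n. (n, e) \<in> G \<and> (n, e) \<notin> G'}"
    and P: "\<And>n. coproduct C (D n) (N n) (P n) (\<kappa> n)"
  shows "\<exists>X i p. cx X \<and> cpt X = P \<and> (\<forall>n. diff X n = p (n + 1) \<cdot> diff Q n \<cdot> i n) \<and>
    (\<forall>n. i n \<in> Hom C (P n) (cpt Q n)) \<and> (\<forall>n. p n \<in> Hom C (cpt Q n) (P n)) \<and>
    (\<forall>n. \<forall>e\<in>D n. i n \<cdot> \<kappa> n e = \<iota> n e) \<and>
    (\<forall>n. \<forall>e\<in>D n. p n \<cdot> \<iota> n e = \<kappa> n e) \<and>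
    (\<forall>n. \<forall>e\<in>E n - D n. p n \<cdot> \<iota> n e = zr (N n e) (P n))"
proof -
  note PD = coproductD[OF P]
  have DE: "D n \<subseteq> E n" for n using D by auto
  define i where "i n = cotuple C (D n) (P n) (\<kappa> n) (cpt Q n) (\<iota> n)" for n
  have i: "i n \<in> Hom C (P n) (cpt Q n)" "e \<in> D n \<Longrightarrow> i n \<cdot> \<kappa> n e = \<iota> n e" for n e
    unfolding i_def
    by (rule cotuple(1)[OF P QD(1)] cotuple(2)[OF P QD(1)]; use bD(3) DE in blast)+
  define f where "f n e = (if e \<in> D n then \<kappa> n e else zr (N n e) (P n))" for n e
  define p where "p n = cotuple C (E n) (cpt Q n) (\<iota> n) (P n) (f n)" for n
  have "f n e \<in> Hom C (N n e) (P n)" if "e \<in> E n" for n e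
    using PD(3)[of e n] Hom_simps(1)[OF bD(2)[OF that] PD(1)] by (simp add: f_def)
  then have p: "p n \<in> Hom C (cpt Q n) (P n)" "e \<in> E n \<Longrightarrow> p n \<cdot> \<iota> n e = f n e" for n e
    unfolding p_def by (rule cotuple(1)[OF basis PD(1)] cotuple(2)[OF basis PD(1)]; blast)+
  note iD = HomD[OF i(1)] and pD = HomD[OF p(1)]
  define X where "X = \<lparr>cpt = P, diff = \<lambda>n. p (n + 1) \<cdot> diff Q n \<cdot> i n\<rparr>"
  have dX: "diff X n = p (n + 1) \<cdot> diff Q n \<cdot> i n" "cpt X = P" for n by (simp_all add: X_def)
  \<comment> \<open>The differential sends \<open>G'\<close> into \<open>G'\<close>, on which the
    projection vanishes.\<close>
  have pd: "p (n + 1) \<cdot> diff Q n \<cdot> \<iota> n e = zr (N n e) (P (n + 1))" if e: "e \<in> E n" "(n, e) \<in> G'" for n e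
  proof -
    have "p (n + 1) \<cdot> diff Q n \<cdot> \<iota> n e = zr (cpt Q (n + 1)) (P (n + 1)) \<cdot> diff Q n \<cdot> \<iota> n e"
    proof (rule diff_comp_eqI[OF G(2) e p(1)])
      show "zr (cpt Q (n + 1)) (P (n + 1)) \<in> Hom C (cpt Q (n + 1)) (P (n + 1))"
        using Hom_simps(1)[OF QD(1) PD(1)] .
      fix e' assume "e' \<in> E (n + 1)" "(n + 1, e') \<in> G'"
      then show "p (n + 1) \<cdot> \<iota> (n + 1) e' = zr (cpt Q (n + 1)) (P (n + 1)) \<cdot> \<iota> (n + 1) e'"
        using p(2)[of e' "n + 1"] bD(4-6)[of e' "n + 1"] PD(1) by (simp add: f_def D)
    qed
    then show ?thesis using QD bD(2,4-6)[OF e(1)] PD(1) by simp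
  qed
  have dd: "(p (n + 2) \<cdot> diff Q (n + 1) \<cdot> i (n + 1)) \<cdot> (p (n + 1) \<cdot> diff Q n \<cdot> i n) = zr (P n) (P (n + 2))" for n
  proof (rule coproduct_eqI[OF P _ _ PD(1) category_axioms])
    fix e assume e: "e \<in> D n"
    then have eE: "e \<in> E n" and eG: "(n, e) \<in> G" using D by auto
    note eD = bD(2,4-6)[OF eE] PD(2,4-6)[OF e]
    \<comment> \<open>The inner \<open>i p\<close> may be dropped on \<open>G\<close>: it is the
      identity on \<open>D\<close>, and on \<open>G'\<close> both sides vanish, the left because
      \<open>p\<close> does and the right by \<open>pd\<close>. What remains contains the square of
      the differential of \<open>Q\<close>.\<close>
    have "(p (n + 2) \<cdot> diff Q (n + 1) \<cdot> i (n + 1) \<cdot> p (n + 1)) \<cdot> diff Q n \<cdot> \<iota> n e =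
        (p (n + 2) \<cdot> diff Q (n + 1)) \<cdot> diff Q n \<cdot> \<iota> n e"
    proof (rule diff_comp_eqI[OF G(1) eE eG])
      fix e' assume e': "e' \<in> E (n + 1)" "(n + 1, e') \<in> G"
      note e'D = bD(2,4-6)[OF e'(1)]
      show "(p (n + 2) \<cdot> diff Q (n + 1) \<cdot> i (n + 1) \<cdot> p (n + 1)) \<cdot> \<iota> (n + 1) e' =
        (p (n + 2) \<cdot> diff Q (n + 1)) \<cdot> \<iota> (n + 1) e'"
      proof (cases "(n + 1, e') \<in> G'")
        case True
        then show ?thesis
          using pd[OF e'(1) True] p(2)[OF e'(1)] QD e'D iD pD PD(1) by (simp add: f_def D)
      next
        case False
        then have "e' \<in> D (n + 1)" using e' D by simp
        then show ?thesis
          using i(2) p(2)[OF e'(1)] QD e'D iD pD PD(1,2,4-6) by (simp add: f_def)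
      qed
    qed (use iD pD QD in \<open>simp_all add: Hom_iff\<close>)
    then have *: "p (n + 2) \<cdot> diff Q (n + 1) \<cdot> i (n + 1) \<cdot> p (n + 1) \<cdot> diff Q n \<cdot> \<iota> n e =
        p (n + 2) \<cdot> diff Q (n + 1) \<cdot> diff Q n \<cdot> \<iota> n e"
      using iD pD QD eD by simp
    show "((p (n + 2) \<cdot> diff Q (n + 1) \<cdot> i (n + 1)) \<cdot> p (n + 1) \<cdot> diff Q n \<cdot> i n) \<cdot> \<kappa> n e =
        zr (P n) (P (n + 2)) \<cdot> \<kappa> n e"
      using iD pD QD eD i(2)[OF e] * cx_diff_diff[OF Q, of "\<iota> n e" n] PD(1) by simp
  qed (use iD pD QD PD(1) in \<open>simp_all add: Hom_iff\<close>)
  have "diff X n \<in> Hom C (cpt X n) (cpt X (n + 1))" for n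
    unfolding dX using iD pD QD by (simp add: Hom_iff)
  moreover have "diff X (n + 1) \<cdot> diff X n = zr (cpt X n) (cpt X (n + 2))" for n
    unfolding dX using dd[of n] by simp
  ultimately have "cx X"
    using PD(1) dX(2) unfolding complexes_def by simp
  moreover have "\<forall>n. \<forall>e\<in>D n. p n \<cdot> \<iota> n e = \<kappa> n e" "\<forall>n. \<forall>e\<in>E n - D n. p n \<cdot> \<iota> n e = zr (N n e) (P n)"
    using p(2) DE[THEN subsetD] by (auto simp: f_def)
  ultimately show ?thesis
    using i p(1) dX by (intro exI[of _ X] exI[of _ i] exI[of _ p]) simp
qed

text \<open>A null homotopy of \<rho> on the subcomplex spanned by \<open>G\<close>, stored as a map
  on all of \<open>Q\<close> that is zero on the other basis elements; it is thus determined by its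
  values on \<open>G\<close>.\<close>

definition partial_null :: "('o, 'm) cochain \<Rightarrow> (int \<Rightarrow> 'm) \<Rightarrow> (int \<times> 'i) set \<Rightarrow> (int \<Rightarrow> 'm) \<Rightarrow> bool" where
  "partial_null M \<rho> G h \<longleftrightarrow> G \<subseteq> Sigma UNIV E \<and> R `` G \<subseteq> G \<and>
     (\<forall>n. h n \<in> Hom C (cpt Q n) (cpt M (n - 1))) \<and>
     (\<forall>n e. (n, e) \<in> G \<longrightarrow>
        \<rho> n \<cdot> \<iota> n e = (diff M (n - 1) \<cdot> h n \<cdot> \<iota> n e) \<^bold>+ (h (n + 1) \<cdot> diff Q n \<cdot> \<iota> n e)) \<and>
     (\<forall>n. \<forall>e\<in>E n. (n, e) \<notin> G \<longrightarrow> h n \<cdot> \<iota> n e = zr (N n e) (cpt M (n - 1)))"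

lemma partial_nullD:
  assumes "partial_null M \<rho> G h"
  shows "G \<subseteq> Sigma UNIV E" "R `` G \<subseteq> G" "h n \<in> Hom C (cpt Q n) (cpt M (n - 1))"
    "(n, e) \<in> G \<Longrightarrow>
        \<rho> n \<cdot> \<iota> n e = (diff M (n - 1) \<cdot> h n \<cdot> \<iota> n e) \<^bold>+ (h (n + 1) \<cdot> diff Q n \<cdot> \<iota> n e)"
    "e \<in> E n \<Longrightarrow> (n, e) \<notin> G \<Longrightarrow> h n \<cdot> \<iota> n e = zr (N n e) (cpt M (n - 1))"
  using assms unfolding partial_null_def by blast+

text \<open>
  A maximal partial null homotopy is total: the defect \<open>\<rho> - (d h + h d)\<close> of a partial one factors through
  a small subquotient complex spanned by further basis elements, where it is null homotopic by assumption.
\<close>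

lemma partial_null_extend:
  assumes M: "cx M" and \<rho>: "\<rho> \<in> chain_maps C Q M" and h: "partial_null M \<rho> G' h"
    and x: "x \<in> Sigma UNIV E"
    and small: "\<And>X f. \<lbrakk>cx X; \<And>n. \<exists>J \<kappa>. J \<subseteq> E n \<inter> {e. (n, e) \<in> R\<^sup>* `` {x}} \<and> coproduct C J (N n) (cpt X n) \<kappa> \<and>
        cpt X n = P n J; f \<in> chain_maps C X M\<rbrakk> \<Longrightarrow> null_homotopic X M f"
    and P: "\<And>n J. J \<subseteq> E n \<inter> {e. (n, e) \<in> R\<^sup>* `` {x}} \<Longrightarrow> \<exists>\<kappa>. coproduct C J (N n) (P n J) \<kappa>"
  shows "\<exists>G h'. partial_null M \<rho> G h' \<and> G' \<subseteq> G \<and> x \<in> G \<and> (\<forall>(n, e)\<in>G'. h' n \<cdot> \<iota> n e = h n \<cdot> \<iota> n e)"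
proof -
  note hD = partial_nullD[OF h] and MD = cxD[OF M] and \<rho>D = chain_mapD[OF \<rho>]
  note hA = HomD[OF hD(3)]
  define F where "F = R\<^sup>* `` {x}"
  have FE: "F \<subseteq> Sigma UNIV E"
  proof
    fix y assume "y \<in> F"
    then have "(x, y) \<in> R\<^sup>*" by (simp add: F_def)
    then show "y \<in> Sigma UNIV E"
    proof (induction rule: rtrancl_induct)
      case (step y z)
      then show ?case using R_sub[of "fst y" "snd y" z] by auto
    qed (rule x)
  qed
  define G where "G = G' \<union> F"
  have RF: "R `` F \<subseteq> F" unfolding F_def by (auto intro: rtrancl.rtrancl_into_rtrancl)
  have RG: "R `` G \<subseteq> G" using RF hD(2) unfolding G_def by blast
  define D where "D n = {e \<in> E n. (n, e) \<in> G \<and> (n, e) \<notin> G'}" for n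
  have DF: "D n \<subseteq> E n \<inter> {e. (n, e) \<in> R\<^sup>* `` {x}}" for n unfolding D_def G_def F_def by auto
  have "\<forall>n. \<exists>\<kappa>. coproduct C (D n) (N n) (P n (D n)) \<kappa>" using P[OF DF] by blast
  then obtain \<kappa> where \<kappa>: "\<And>n. coproduct C (D n) (N n) (P n (D n)) (\<kappa> n)" by metis
  note \<kappa>D = coproductD[OF \<kappa>]
  obtain X i p where X: "cx X" "\<And>n. cpt X n = P n (D n)" and dX: "\<And>n. diff X n = p (n + 1) \<cdot> diff Q n \<cdot> i n"
    and i: "\<And>n. i n \<in> Hom C (P n (D n)) (cpt Q n)" and p: "\<And>n. p n \<in> Hom C (cpt Q n) (P n (D n))"
    and i\<kappa>: "\<And>n e. e \<in> D n \<Longrightarrow> i n \<cdot> \<kappa> n e = \<iota> n e"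
    and p\<iota>: "\<And>n e. e \<in> D n \<Longrightarrow> p n \<cdot> \<iota> n e = \<kappa> n e"
    and p0: "\<And>n e. e \<in> E n - D n \<Longrightarrow> p n \<cdot> \<iota> n e = zr (N n e) (P n (D n))"
    using subquotient[OF RG hD(2) D_def \<kappa>] by (smt (verit))
  note iA = HomD[OF i] and pA = HomD[OF p]
  \<comment> \<open>The chain map that is null homotopic through \<open>h\<close>; \<open>g\<close>
    below is the defect, and it vanishes on \<open>G'\<close> because there \<open>h\<close> is a
    null homotopy of \<rho>.\<close>
  define w where "w n = (diff M (n - 1) \<cdot> h n) \<^bold>+ (h (n + 1) \<cdot> diff Q n)" for n
  have w: "w \<in> chain_maps C Q M"
  proof (rule chain_mapI)
    fix n
    show "w n \<in> Hom C (cpt Q n) (cpt M n)" using QD MD hA by (simp add: w_def Hom_iff)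
    have "diff M n \<cdot> diff M (n - 1) \<cdot> h n = zr (cpt Q n) (cpt M (n + 1))"
      using comp_reduce[OF MD(6)[of n], of "h n"] QD MD hA by simp
    then show "w (n + 1) \<cdot> diff Q n = diff M n \<cdot> w n" using QD MD hA by (simp add: w_def)
  qed
  define g where "g n = \<rho> n \<^bold>+ neg (w n)" for n
  have g: "g \<in> chain_maps C Q M"
    unfolding g_def using \<rho> w chain_maps_closed[OF Q M] by blast
  note gD = chain_mapD[OF g] and wD = chain_mapD[OF w]
  have w\<iota>: "w n \<cdot> \<iota> n e = (diff M (n - 1) \<cdot> h n \<cdot> \<iota> n e) \<^bold>+ (h (n + 1) \<cdot> diff Q n \<cdot> \<iota> n e)" if "e \<in> E n" for n e
    using QD MD hA bD(4-6)[OF that] by (simp add: w_def)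
  have g0: "g n \<cdot> \<iota> n e = zr (N n e) (cpt M n)" if "e \<in> E n" "(n, e) \<in> G'" for n e
  proof -
    have "g n \<cdot> \<iota> n e = (\<rho> n \<cdot> \<iota> n e) \<^bold>+ neg (w n \<cdot> \<iota> n e)"
      using bD(4-6)[OF that(1)] \<rho>D wD by (simp add: g_def)
    also have "\<rho> n \<cdot> \<iota> n e = w n \<cdot> \<iota> n e" using hD(4)[OF that(2)] w\<iota>[OF that(1)] by simp
    finally show ?thesis using bD(4-6)[OF that(1)] wD by simp
  qed
  \<comment> \<open>Although \<open>i\<close> is only a map in each degree, \<open>g i\<close>
    commutes with the differentials: the error of \<open>i\<close> lies in \<open>G'\<close>, where
    \<open>g\<close> is zero.\<close>
  have gi: "(\<lambda>n. g n \<cdot> i n) \<in> chain_maps C X M"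
  proof (rule chain_mapI)
    fix n
    show "g n \<cdot> i n \<in> Hom C (cpt X n) (cpt M n)" using X(2) gD iA by (simp add: Hom_iff)
    show "(g (n + 1) \<cdot> i (n + 1)) \<cdot> diff X n = diff M n \<cdot> g n \<cdot> i n"
      unfolding dX
    proof (rule coproduct_eqI[OF \<kappa> _ _ MD(1) category_axioms])
      fix e assume e: "e \<in> D n"
      then have eE: "e \<in> E n" and eG: "(n, e) \<in> G" by (auto simp: D_def)
      note eD = bD(2,4-6)[OF eE] \<kappa>D(2,4-6)[OF e]
      have *: "(g (n + 1) \<cdot> i (n + 1) \<cdot> p (n + 1)) \<cdot> diff Q n \<cdot> \<iota> n e = g (n + 1) \<cdot> diff Q n \<cdot> \<iota> n e"
      proof (rule diff_comp_eqI[OF RG eE eG _ gD(1)])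
        fix e' assume e': "e' \<in> E (n + 1)" "(n + 1, e') \<in> G"
        note e'D = bD(2,4-6)[OF e'(1)]
        show "(g (n + 1) \<cdot> i (n + 1) \<cdot> p (n + 1)) \<cdot> \<iota> (n + 1) e' = g (n + 1) \<cdot> \<iota> (n + 1) e'"
        proof (cases "(n + 1, e') \<in> G'")
          case True
          then show ?thesis
            using g0[OF e'(1) True] p0[of e' "n + 1"] e' e'D gD iA pA \<kappa>D(1) MD QD by (simp add: D_def)
        next
          case False
          then have "e' \<in> D (n + 1)" using e' by (simp add: D_def)
          then show ?thesis using i\<kappa> p\<iota> e'D gD iA pA by simp
        qed
      qed (use gD iA pA in \<open>simp add: Hom_iff\<close>)
      have "((g (n + 1) \<cdot> i (n + 1)) \<cdot> p (n + 1) \<cdot> diff Q n \<cdot> i n) \<cdot> \<kappa> n e =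
          (g (n + 1) \<cdot> i (n + 1) \<cdot> p (n + 1)) \<cdot> diff Q n \<cdot> \<iota> n e"
        using gD iA pA QD eD i\<kappa>[OF e] by simp
      also have "\<dots> = diff M n \<cdot> g n \<cdot> \<iota> n e"
        unfolding * using chain_map_comm_comp[OF g Q M, of "\<iota> n e" n] eD by simp
      also have "\<dots> = (diff M n \<cdot> g n \<cdot> i n) \<cdot> \<kappa> n e"
        using gD iA MD eD i\<kappa>[OF e] by simp
      finally show "((g (n + 1) \<cdot> i (n + 1)) \<cdot> p (n + 1) \<cdot> diff Q n \<cdot> i n) \<cdot> \<kappa> n e =
          (diff M n \<cdot> g n \<cdot> i n) \<cdot> \<kappa> n e" .
    qed (use gD iA pA QD MD in \<open>simp_all add: Hom_iff\<close>)
  qed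
  have "null_homotopic X M (\<lambda>n. g n \<cdot> i n)"
  proof (rule small[OF X(1) _ gi])
    show "\<exists>J \<kappa>. J \<subseteq> E n \<inter> {e. (n, e) \<in> R\<^sup>* `` {x}} \<and> coproduct C J (N n) (cpt X n) \<kappa> \<and> cpt X n = P n J" for n
      using DF[of n] \<kappa>[of n] unfolding X(2) by (intro exI[of _ "D n"] exI[of _ "\<kappa> n"] conjI refl)
  qed
  then obtain k where k: "\<And>n. k n \<in> Hom C (cpt X n) (cpt M (n - 1))"
    "\<And>n. g n \<cdot> i n = (diff M (n - 1) \<cdot> k n) \<^bold>+ (k (n + 1) \<cdot> diff X n)"
    by (rule null_homotopicE) (rule that)
  note kA = HomD[OF k(1), unfolded X(2)]
  \<comment> \<open>The correction factors through \<open>p\<close>, hence vanishes off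
    \<open>D\<close>: the values on \<open>G'\<close> are untouched and those outside
    \<open>G\<close> stay zero.\<close>
  define h' where "h' n = h n \<^bold>+ (k n \<cdot> p n)" for n
  have h': "h' n \<in> Hom C (cpt Q n) (cpt M (n - 1))" for n
    using hA kA pA by (simp add: h'_def Hom_iff)
  have h'\<iota>: "h' n \<cdot> \<iota> n e = h n \<cdot> \<iota> n e" if "e \<in> E n" "e \<notin> D n" for n e
    using hA kA pA bD(2,4-6)[OF that(1)] p0[of e n] that \<kappa>D(1) MD by (simp add: h'_def)
  have null: "\<rho> n \<cdot> \<iota> n e = (diff M (n - 1) \<cdot> h' n \<cdot> \<iota> n e) \<^bold>+ (h' (n + 1) \<cdot> diff Q n \<cdot> \<iota> n e)"
    if eG: "(n, e) \<in> G" for n e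
  proof -
    have e: "e \<in> E n" using eG hD(1) FE by (auto simp: G_def)
    note eD = bD(2,4-6)[OF e] and A = hA kA pA QD MD iA
    have sum: "(diff M (n - 1) \<cdot> h' n \<cdot> \<iota> n e) \<^bold>+ (h' (n + 1) \<cdot> diff Q n \<cdot> \<iota> n e) =
        (w n \<cdot> \<iota> n e) \<^bold>+ ((diff M (n - 1) \<cdot> k n \<cdot> p n \<cdot> \<iota> n e) \<^bold>+ (k (n + 1) \<cdot> p (n + 1) \<cdot> diff Q n \<cdot> \<iota> n e))"
      using A eD by (simp add: w_def h'_def add_ac)
    have \<rho>g: "\<rho> n \<cdot> \<iota> n e = (w n \<cdot> \<iota> n e) \<^bold>+ (g n \<cdot> \<iota> n e)"
      using \<rho>D wD eD by (simp add: g_def add_left_commute[of "w n \<cdot> \<iota> n e" "\<rho> n \<cdot> \<iota> n e"])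
    have "g n \<cdot> \<iota> n e = (diff M (n - 1) \<cdot> k n \<cdot> p n \<cdot> \<iota> n e) \<^bold>+ (k (n + 1) \<cdot> p (n + 1) \<cdot> diff Q n \<cdot> \<iota> n e)"
    proof (cases "(n, e) \<in> G'")
      case True
      have "p (n + 1) \<cdot> diff Q n \<cdot> \<iota> n e = zr (cpt Q (n + 1)) (P (n + 1) (D (n + 1))) \<cdot> diff Q n \<cdot> \<iota> n e"
      proof (rule diff_comp_eqI[OF hD(2) e True p])
        show "zr (cpt Q (n + 1)) (P (n + 1) (D (n + 1))) \<in> Hom C (cpt Q (n + 1)) (P (n + 1) (D (n + 1)))"
          using Hom_simps(1)[OF QD(1) \<kappa>D(1)] .
        fix e' assume "e' \<in> E (n + 1)" "(n + 1, e') \<in> G'"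
        then show "p (n + 1) \<cdot> \<iota> (n + 1) e' = zr (cpt Q (n + 1)) (P (n + 1) (D (n + 1))) \<cdot> \<iota> (n + 1) e'"
          using p0[of e' "n + 1"] bD(4-6)[of e' "n + 1"] \<kappa>D(1) by (simp add: D_def)
      qed
      then have "p (n + 1) \<cdot> diff Q n \<cdot> \<iota> n e = zr (N n e) (P (n + 1) (D (n + 1)))"
        using A eD \<kappa>D(1) by simp
      then show ?thesis using g0[OF e True] p0[of e n] True e A eD \<kappa>D(1) by (simp add: D_def)
    next
      case False
      then have eDn: "e \<in> D n" using e eG by (simp add: D_def)
      note kD = \<kappa>D(2,4-6)[OF eDn]
      have "g n \<cdot> \<iota> n e = (g n \<cdot> i n) \<cdot> \<kappa> n e"
        using gD iA kD i\<kappa>[OF eDn] by simp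
      also have "\<dots> = (diff M (n - 1) \<cdot> k n \<cdot> \<kappa> n e) \<^bold>+ (k (n + 1) \<cdot> p (n + 1) \<cdot> diff Q n \<cdot> i n \<cdot> \<kappa> n e)"
        unfolding k(2) dX using A kD by simp
      finally show ?thesis using i\<kappa>[OF eDn] p\<iota>[OF eDn] by simp
    qed
    then show ?thesis using sum \<rho>g by simp
  qed
  have "partial_null M \<rho> G h'"
    unfolding partial_null_def
  proof (intro conjI allI impI ballI)
    show "G \<subseteq> Sigma UNIV E" using hD(1) FE by (simp add: G_def)
    fix n e assume "e \<in> E n" "(n, e) \<notin> G"
    then show "h' n \<cdot> \<iota> n e = zr (N n e) (cpt M (n - 1))"
      using h'\<iota> hD(5) by (auto simp: D_def G_def)
  qed (use RG h' null in auto)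
  moreover have "x \<in> G" "G' \<subseteq> G" by (auto simp: G_def F_def)
  moreover have "\<forall>(n, e)\<in>G'. h' n \<cdot> \<iota> n e = h n \<cdot> \<iota> n e"
    using h'\<iota> hD(1) by (auto simp: D_def)
  ultimately show ?thesis by blast
qed

text \<open>Partial null homotopies are encoded by their graphs on basis elements, so that
  restriction becomes inclusion and the members of a chain can be united. A value outside the union
  of the domains is set to zero.\<close>

lemma partial_null_Union:
  assumes M: "cx M" and \<rho>: "\<rho> \<in> chain_maps C Q M"
    and gr: "\<And>G h. gr G h = (\<lambda>(n, e). ((n, e), h n \<cdot> \<iota> n e)) ` G"
    and chain: "\<And>Z. Z \<in> \<C> \<Longrightarrow> \<exists>G h. Z = gr G h \<and> partial_null M \<rho> G h"
      "\<And>Z Z'. Z \<in> \<C> \<Longrightarrow> Z' \<in> \<C> \<Longrightarrow> Z \<subseteq> Z' \<or> Z' \<subseteq> Z"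
  shows "\<exists>G h. \<Union>\<C> = gr G h \<and> partial_null M \<rho> G h"
proof -
  note MD = cxD[OF M]
  have func: "\<eta> = \<eta>'" if mem: "(x, \<eta>) \<in> \<Union>\<C>" "(x, \<eta>') \<in> \<Union>\<C>" for x \<eta> \<eta>'
  proof -
    obtain Z where Z: "Z \<in> \<C>" "(x, \<eta>) \<in> Z" "(x, \<eta>') \<in> Z" using mem chain(2) by blast
    obtain G h where "Z = gr G h" using chain(1)[OF Z(1)] by blast
    then show ?thesis using Z gr by auto
  qed
  define G where "G = fst ` \<Union>\<C>"
  define \<eta> where "\<eta> n e = (if (n, e) \<in> G then (THE u. ((n, e), u) \<in> \<Union>\<C>) else zr (N n e) (cpt M (n - 1)))" for n e
  define h where "h n = cotuple C (E n) (cpt Q n) (\<iota> n) (cpt M (n - 1)) (\<eta> n)" for n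
  have mem: "\<exists>G1 h1. gr G1 h1 \<in> \<C> \<and> partial_null M \<rho> G1 h1 \<and> x \<in> G1" if "x \<in> G" for x
  proof -
    obtain Z u where Z: "Z \<in> \<C>" "(x, u) \<in> Z" using \<open>x \<in> G\<close> by (auto simp: G_def)
    then obtain G1 h1 where "Z = gr G1 h1" "partial_null M \<rho> G1 h1" using chain(1) by blast
    then show ?thesis using Z gr by (intro exI[of _ G1] exI[of _ h1]) auto
  qed
  have sub: "G1 \<subseteq> G" if "gr G1 h1 \<in> \<C>" for G1 h1
    using that gr unfolding G_def by (force simp: image_iff)
  have \<eta>1: "\<eta> n e = h1 n \<cdot> \<iota> n e" if "gr G1 h1 \<in> \<C>" "(n, e) \<in> G1" for G1 h1 n e
  proof -
    have "((n, e), h1 n \<cdot> \<iota> n e) \<in> \<Union>\<C>" using that gr by (force intro!: bexI[of _ "gr G1 h1"])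
    then have "(THE u. ((n, e), u) \<in> \<Union>\<C>) = h1 n \<cdot> \<iota> n e" using func by (intro the_equality) blast+
    then show ?thesis using sub[OF that(1)] that(2) by (auto simp: \<eta>_def)
  qed
  have "\<eta> n e \<in> Hom C (N n e) (cpt M (n - 1))" if "e \<in> E n" for n e
  proof (cases "(n, e) \<in> G")
    case True
    then obtain G1 h1 where G1: "gr G1 h1 \<in> \<C>" "partial_null M \<rho> G1 h1" "(n, e) \<in> G1" using mem by blast
    then show ?thesis
      using \<eta>1 comp_hom[OF partial_nullD(3)[OF G1(2)] bD(3)[OF that]] by simp
  next
    case False
    then show ?thesis using Hom_simps(1)[OF bD(2)[OF that] MD(1)] by (simp add: \<eta>_def)
  qed
  then have h: "h n \<in> Hom C (cpt Q n) (cpt M (n - 1))" "e \<in> E n \<Longrightarrow> h n \<cdot> \<iota> n e = \<eta> n e" for n e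
    unfolding h_def by (rule cotuple(1)[OF basis MD(1)] cotuple(2)[OF basis MD(1)]; blast)+
  have GE: "G \<subseteq> Sigma UNIV E" using mem partial_nullD(1) by blast
  have "R `` G \<subseteq> G"
  proof
    fix y assume "y \<in> R `` G"
    then obtain x where "(x, y) \<in> R" "x \<in> G" by blast
    then show "y \<in> G" using mem[of x] partial_nullD(2) sub by blast
  qed
  moreover have "\<rho> n \<cdot> \<iota> n e = (diff M (n - 1) \<cdot> h n \<cdot> \<iota> n e) \<^bold>+ (h (n + 1) \<cdot> diff Q n \<cdot> \<iota> n e)"
    if x: "(n, e) \<in> G" for n e
  proof -
    obtain G1 h1 where G1: "gr G1 h1 \<in> \<C>" "partial_null M \<rho> G1 h1" "(n, e) \<in> G1" using mem[OF x] by blast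
    have e: "e \<in> E n" using GE x by blast
    note D1 = partial_nullD[OF G1(2)]
    \<comment> \<open>The homotopy identity at one basis element is inherited from one member of the
      chain, because the support of its differential stays in the domain \<open>G1\<close> of that
      member.\<close>
    have "h1 (n + 1) \<cdot> diff Q n \<cdot> \<iota> n e = h (n + 1) \<cdot> diff Q n \<cdot> \<iota> n e"
    proof (rule diff_comp_eqI[OF D1(2) e G1(3)])
      show "h1 (n + 1) \<in> Hom C (cpt Q (n + 1)) (cpt M (n + 1 - 1))" by (rule D1(3))
      show "h (n + 1) \<in> Hom C (cpt Q (n + 1)) (cpt M (n + 1 - 1))" by (rule h(1))
      show "h1 (n + 1) \<cdot> \<iota> (n + 1) e' = h (n + 1) \<cdot> \<iota> (n + 1) e'"
        if "e' \<in> E (n + 1)" "(n + 1, e') \<in> G1" for e'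
        using \<eta>1[OF G1(1) that(2)] h(2)[OF that(1)] by simp
    qed
    moreover have "h1 n \<cdot> \<iota> n e = h n \<cdot> \<iota> n e" using \<eta>1[OF G1(1,3)] h(2)[OF e] by simp
    ultimately show ?thesis using D1(4)[OF G1(3)] by simp
  qed
  moreover have "h n \<cdot> \<iota> n e = zr (N n e) (cpt M (n - 1))" if "e \<in> E n" "(n, e) \<notin> G" for n e
    using h(2)[OF that(1)] that(2) by (simp add: \<eta>_def)
  ultimately have "partial_null M \<rho> G h"
    unfolding partial_null_def using GE h(1) by blast
  moreover have "\<Union>\<C> = gr G h"
  proof (rule Set.set_eqI)
    fix z :: "(int \<times> 'i) \<times> 'm"
    obtain n e u where z: "z = ((n, e), u)" by (metis prod.exhaust)
    have "((n, e), u) \<in> \<Union>\<C> \<longleftrightarrow> (n, e) \<in> G \<and> u = h n \<cdot> \<iota> n e"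
    proof
      assume *: "((n, e), u) \<in> \<Union>\<C>"
      then have nG: "(n, e) \<in> G" unfolding G_def by force
      moreover have "(THE u. ((n, e), u) \<in> \<Union>\<C>) = u" using * func by (intro the_equality) blast+
      ultimately show "(n, e) \<in> G \<and> u = h n \<cdot> \<iota> n e" using h(2) GE by (auto simp: \<eta>_def)
    next
      assume *: "(n, e) \<in> G \<and> u = h n \<cdot> \<iota> n e"
      then obtain G1 h1 where G1: "gr G1 h1 \<in> \<C>" "(n, e) \<in> G1" using mem by blast
      then have "u = h1 n \<cdot> \<iota> n e" using * \<eta>1 h(2) GE by auto
      then have "((n, e), u) \<in> gr G1 h1" using G1(2) gr by auto
      then show "((n, e), u) \<in> \<Union>\<C>" using G1(1) by blast
    qed
    then show "z \<in> \<Union>\<C> \<longleftrightarrow> z \<in> gr G h" unfolding z gr by auto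
  qed
  ultimately show ?thesis by blast
qed

text \<open>The hypothesis \<open>small\<close> is tested only on complexes whose components are the
  chosen coproducts \<open>P n J\<close>; a fixed choice function lets the caller place all these
  components in a prescribed set.\<close>

lemma null_homotopicI_small:
  assumes M: "cx M" and \<rho>: "\<rho> \<in> chain_maps C Q M"
    and P: "\<And>x n J. x \<in> Sigma UNIV E \<Longrightarrow> J \<subseteq> E n \<inter> {e. (n, e) \<in> R\<^sup>* `` {x}} \<Longrightarrow> \<exists>\<kappa>. coproduct C J (N n) (P n J) \<kappa>"
    and small: "\<And>x X f. \<lbrakk>x \<in> Sigma UNIV E; cx X;
        \<And>n. \<exists>J \<kappa>. J \<subseteq> E n \<inter> {e. (n, e) \<in> R\<^sup>* `` {x}} \<and> coproduct C J (N n) (cpt X n) \<kappa> \<and>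
        cpt X n = P n J; f \<in> chain_maps C X M\<rbrakk> \<Longrightarrow> null_homotopic X M f"
  shows "null_homotopic Q M \<rho>"
proof -
  note MD = cxD[OF M] and \<rho>D = chain_mapD[OF \<rho>]
  define gr where "gr G h = (\<lambda>(n, e). ((n, e), h n \<cdot> \<iota> n e)) ` G" for G h
  define \<Z> where "\<Z> = {gr G h | G h. partial_null M \<rho> G h}"
  \<comment> \<open>The case of the empty chain produces the empty partial null homotopy, so the set
    of graphs is inhabited.\<close>
  have "\<exists>Z\<in>\<Z>. \<forall>Z'\<in>\<Z>. Z \<subseteq> Z' \<longrightarrow> Z' = Z"
  proof (rule subset_Zorn')
    fix \<C> assume "subset.chain \<Z> \<C>"
    then have \<C>: "\<And>Z. Z \<in> \<C> \<Longrightarrow> \<exists>G h. Z = gr G h \<and> partial_null M \<rho> G h"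
      "\<And>Z Z'. Z \<in> \<C> \<Longrightarrow> Z' \<in> \<C> \<Longrightarrow> Z \<subseteq> Z' \<or> Z' \<subseteq> Z"
      unfolding subset_chain_def \<Z>_def by blast+
    show "\<Union>\<C> \<in> \<Z>"
      using partial_null_Union[OF M \<rho> gr_def \<C>] unfolding \<Z>_def by blast
  qed
  then obtain Z where Z: "Z \<in> \<Z>" "\<And>Z'. Z' \<in> \<Z> \<Longrightarrow> Z \<subseteq> Z' \<Longrightarrow> Z' = Z" by blast
  then obtain G h where h: "partial_null M \<rho> G h" and ZG: "Z = gr G h"
    unfolding \<Z>_def by blast
  have max: "gr G' h' = gr G h" if "partial_null M \<rho> G' h'" "gr G h \<subseteq> gr G' h'" for G' h'
    using Z(2)[of "gr G' h'"] that unfolding ZG \<Z>_def by blast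
  note hD = partial_nullD[OF h]
  have fst_gr: "fst ` gr G h = G" for G h unfolding gr_def by force
  have "x \<in> G" if x: "x \<in> Sigma UNIV E" for x
  proof -
    obtain G' h' where *: "partial_null M \<rho> G' h'" "G \<subseteq> G'" "x \<in> G'"
      "\<forall>(n, e)\<in>G. h' n \<cdot> \<iota> n e = h n \<cdot> \<iota> n e"
      using partial_null_extend[OF M \<rho> h x small[OF x] P[OF x]] by blast
    have "gr G h \<subseteq> gr G' h'" using *(2,4) unfolding gr_def by force
    then have "gr G' h' = gr G h" using max *(1) by blast
    then show ?thesis using *(3) fst_gr by metis
  qed
  then have all: "(n, e) \<in> G" if "e \<in> E n" for n e using that by blast
  show ?thesis
  proof (rule null_homotopicI[OF hD(3)])
    fix n
    show "\<rho> n = (diff M (n - 1) \<cdot> h n) \<^bold>+ (h (n + 1) \<cdot> diff Q n)"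
    proof (rule coproduct_eqI[OF basis _ _ MD(1) category_axioms])
      fix e assume e: "e \<in> E n"
      show "\<rho> n \<cdot> \<iota> n e = ((diff M (n - 1) \<cdot> h n) \<^bold>+ (h (n + 1) \<cdot> diff Q n)) \<cdot> \<iota> n e"
        using hD(4)[OF all[OF e]] HomD[OF hD(3)] MD QD bD(4-6)[OF e] by simp
    qed (use \<rho>D MD QD HomD[OF hD(3)] in \<open>simp_all add: Hom_iff\<close>)
  qed
qed

end

section \<open>The set of generators built from \<open>S\<close> and \<open>T\<close>\<close>

lemma small_complexes:
  fixes C :: "('o, 'm, 'z) preadd_scheme"
  assumes "inaccessible U" "locally_small U C" "\<T> \<subseteq> Ob C" "small U \<T>"
  shows "small U (complexes C \<T>)"
proof -
  let ?H = "\<Union>X\<in>\<T>. \<Union>Y\<in>\<T>. Hom C X Y"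
  define \<Phi> where "\<Phi> X = (\<lambda>n :: int. (cpt X n, diff X n))" for X :: "('o, 'm) cochain"
  have "small U (\<Phi> ` complexes C \<T>)"
  proof (rule small_functions[OF assms(1) small_countable(2)[OF assms(1)]])
    show "small U (\<T> \<times> ?H)"
      using assms(2,3) unfolding locally_small_def
      by (intro small_Sigma[OF assms(1)] small_UNION[OF assms(1)] assms(4)) blast
    show "\<phi> n \<in> \<T> \<times> ?H" if "\<phi> \<in> \<Phi> ` complexes C \<T>" for \<phi> n
      using that by (fastforce simp: \<Phi>_def complexes_def)
    show "\<phi> = \<psi>" if "\<And>n. n \<in> UNIV \<Longrightarrow> \<phi> n = \<psi> n" for \<phi> \<psi> :: "int \<Rightarrow> 'o \<times> 'm"
      using that by auto
  qed
  moreover have "inj_on \<Phi> (complexes C \<T>)"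
  proof (rule inj_onI)
    fix X Y :: "('o, 'm) cochain" assume "\<Phi> X = \<Phi> Y"
    then have "cpt X n = cpt Y n \<and> diff X n = diff Y n" for n
      unfolding \<Phi>_def by (metis prod.inject)
    then show "X = Y" by (intro cochain.equality) auto
  qed
  ultimately show ?thesis by (simp add: small_inj_image_iff)
qed

context homotopy_cat_coproducts
begin

text \<open>A family of objects of \<open>S\<close> indexed by a subset of \<open>T\<close> is
  encoded as a single-valued relation in \<open>T \<times> S\<close>; there is only a small set of
  these, and one coproduct is chosen for each. A family indexed by any set of size at most
  \<open>|T|\<close> is reindexed into \<open>T\<close> by an injection.\<close>

lemma ex_small_set_of_coproducts:
  assumes S: "small U S" "S \<subseteq> B" and T: "small U (T :: 'u set)"
  shows "\<exists>\<T>\<subseteq>B. small U \<T> \<and>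
    (\<forall>P\<in>\<T>. \<exists>(I :: 'u set) N \<iota>. |I| \<le>o |T| \<and> (\<forall>i\<in>I. N i \<in> S) \<and> coproduct C I N P \<iota>) \<and>
    (\<forall>(I :: 'u set) N. |I| \<le>o |T| \<and> (\<forall>i\<in>I. N i \<in> S) \<longrightarrow> (\<exists>P\<in>\<T>. \<exists>\<iota>. coproduct C I N P \<iota>))"
proof -
  define val where "val g i = (THE s. (i, s) \<in> g)" for g :: "('u \<times> 'o) set" and i
  define rep where "rep g = (SOME P. \<exists>\<iota>. coproduct C (Domain g) (val g) P \<iota>)" for g
  define \<G> where "\<G> = {g \<in> Pow (T \<times> S). single_valued g}"
  have val: "val g i = s" if "g \<in> \<G>" "(i, s) \<in> g" for g i s
    using that unfolding val_def \<G>_def single_valued_def by blast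
  have valS: "val g i \<in> S" if "g \<in> \<G>" "i \<in> Domain g" for g i
    using that val by (auto simp: \<G>_def)
  have DT: "Domain g \<subseteq> T" if "g \<in> \<G>" for g using that by (auto simp: \<G>_def)
  have rep: "\<exists>\<iota>. coproduct C (Domain g) (val g) (rep g) \<iota>" if g: "g \<in> \<G>" for g
  proof -
    have "\<exists>P \<iota>. coproduct C (Domain g) (val g) P \<iota>"
      using has_coproducts small_subset[OF T DT[OF g]] valS[OF g] S(2) B_ob
      unfolding has_coproducts_def by (meson subset_iff)
    then show ?thesis unfolding rep_def by (rule someI_ex)
  qed
  define \<T> where "\<T> = rep ` \<G>"
  have "\<T> \<subseteq> B"
  proof
    fix P assume "P \<in> \<T>"
    then obtain g where g: "g \<in> \<G>" "P = rep g" by (auto simp: \<T>_def)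
    then show "P \<in> B"
      using rep[OF g(1)] closed_B small_subset[OF T DT[OF g(1)]] valS[OF g(1)] S(2)
      unfolding closed_under_coproducts_def by (meson subset_iff)
  qed
  moreover have "small U \<T>" unfolding \<T>_def
    by (rule small_image, rule small_subset[OF small_Pow[OF inaccessible small_Sigma[OF inaccessible T S(1)]]])
      (auto simp: \<G>_def)
  moreover have "\<exists>(I :: 'u set) N \<iota>. |I| \<le>o |T| \<and> (\<forall>i\<in>I. N i \<in> S) \<and> coproduct C I N P \<iota>" if "P \<in> \<T>" for P
  proof -
    obtain g where g: "g \<in> \<G>" "P = rep g" using \<open>P \<in> \<T>\<close> by (auto simp: \<T>_def)
    then show ?thesis
      using rep[OF g(1)] card_of_mono1[OF DT[OF g(1)]] valS[OF g(1)] by blast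
  qed
  moreover have "\<exists>P\<in>\<T>. \<exists>\<iota>. coproduct C I N P \<iota>" if I: "|I| \<le>o |T|" "\<forall>i\<in>I. N i \<in> S" for I :: "'u set" and N
  proof -
    obtain \<phi> where \<phi>: "inj_on \<phi> I" "\<phi> ` I \<subseteq> T" using I(1) card_of_ordLeq[of I T] by blast
    define g where "g = (\<lambda>i. (\<phi> i, N i)) ` I"
    have g: "g \<in> \<G>" unfolding \<G>_def g_def single_valued_def using \<phi> I(2) by (auto dest: inj_onD)
    then obtain \<iota> where \<iota>: "coproduct C (Domain g) (val g) (rep g) \<iota>" using rep by blast
    have "coproduct C I N (rep g) (\<iota> \<circ> \<phi>)"
    proof (rule coproduct_reindex[OF \<iota>, of \<phi>])
      show "bij_betw \<phi> I (Domain g)" using \<phi>(1) by (auto simp: bij_betw_def g_def)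
      show "N i = val g (\<phi> i)" if "i \<in> I" for i using val[OF g, of "\<phi> i" "N i"] that by (auto simp: g_def)
    qed simp
    then show ?thesis using g unfolding \<T>_def by blast
  qed
  ultimately show ?thesis by (intro exI[of _ \<T>]) blast
qed

end

locale small_generators = homotopy_cat_coproducts C B U
  for C :: "('o, 'm, 'z) preadd_scheme" (structure) and B and U :: "'u rel" +
  fixes S :: "'o set" and T :: "'u set" and \<T> :: "'o set"
  assumes S_B: "S \<subseteq> B" and B_Add: "B \<subseteq> Add U C S"
    and T: "infinite T" and S_small: "X \<in> S \<Longrightarrow> coproduct_small U T X"
    and \<T>_B: "\<T> \<subseteq> B"
    and \<T>_coproduct: "P \<in> \<T> \<Longrightarrow> \<exists>(I :: 'u set) N \<iota>. |I| \<le>o |T| \<and> (\<forall>i\<in>I. N i \<in> S) \<and> coproduct C I N P \<iota>"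
    and \<T>_ex: "|I| \<le>o |T| \<Longrightarrow> (\<And>i. i \<in> I \<Longrightarrow> N i \<in> S) \<Longrightarrow> \<exists>P\<in>\<T>. \<exists>\<iota>. coproduct C (I :: 'u set) N P \<iota>"
begin

lemma \<T>_small: "P \<in> \<T> \<Longrightarrow> coproduct_small U T P"
  using \<T>_coproduct coproduct_small_coproduct[OF T] S_small by metis

lemma countable_UN_T:
  assumes "\<And>n :: int. |F n| \<le>o |T|"
  shows "|\<Union>n. F n| \<le>o |T|"
proof -
  have "|UNIV :: int set| \<le>o |T|"
    using card_of_int_ordLeq_nat T infinite_iff_card_of_nat ordLeq_transitive by blast
  then show ?thesis using card_of_UNION_ordLeq_infinite[OF T] assms by blast
qed

text \<open>A resolution of \<open>M\<close>: a complex \<open>Q\<close> with a basis of objects of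
  \<open>S\<close> and a differential whose supports have size at most \<open>|T|\<close>, together
  with a strict retraction of \<open>Q\<close> onto \<open>M\<close> by chain maps.\<close>

definition retract_data where
  "retract_data M Q E N \<kappa> R \<sigma> \<rho> \<longleftrightarrow> cxB Q \<and> based_complex C Q E N \<kappa> R \<and> (\<forall>x. |R `` {x}| \<le>o |T| ) \<and>
     (\<forall>n. small U (E n)) \<and> (\<forall>n. \<forall>e\<in>E n. N n e \<in> S) \<and> \<sigma> \<in> chain_maps C M Q \<and> \<rho> \<in> chain_maps C Q M \<and>
     (\<forall>n. \<rho> n \<cdot> \<sigma> n = Id C (cpt M n))"

text \<open>
  If \<open>M n\<close> is a retract of \<open>Q n\<close> via \<open>\<rho> \<sigma> = 1\<close>, then \<open>\<sigma> d \<rho>\<close> is a differential on \<open>Q\<close> for which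
  \<open>\<sigma>\<close> and \<open>\<rho>\<close> are chain maps.
\<close>

lemma ex_retract_data:
  assumes M: "cxB M"
  shows "\<exists>Q (E :: int \<Rightarrow> 'u set) N \<kappa> R \<sigma> \<rho>. retract_data M Q E N \<kappa> R \<sigma> \<rho>"
proof -
  note MD = cxD[OF cxB_cx[OF M]]
  have "\<forall>n. \<exists>(I :: 'u set) N P \<iota> s r. small U I \<and> (\<forall>i\<in>I. N i \<in> S) \<and> coproduct C I N P \<iota> \<and>
      s \<in> Hom C (cpt M n) P \<and> r \<in> Hom C P (cpt M n) \<and> r \<cdot> s = Id C (cpt M n)"
  proof
    fix n
    have "cpt M n \<in> Add U C S" using complexes_cpt[OF M] B_Add by blast
    then obtain I :: "'u set" and N P \<iota> Y where *: "small U I" "\<forall>i\<in>I. N i \<in> S" "coproduct C I N P \<iota>"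
      "biproduct C (cpt M n) Y P" unfolding Add_def direct_summand_def by blast
    from *(4) obtain s r where "s \<in> Hom C (cpt M n) P" "r \<in> Hom C P (cpt M n)" "r \<cdot> s = Id C (cpt M n)"
      unfolding biproduct_def by blast
    with * show "\<exists>(I :: 'u set) N P \<iota> s r. small U I \<and> (\<forall>i\<in>I. N i \<in> S) \<and> coproduct C I N P \<iota> \<and>
      s \<in> Hom C (cpt M n) P \<and> r \<in> Hom C P (cpt M n) \<and> r \<cdot> s = Id C (cpt M n)" by blast
  qed
  then obtain E :: "int \<Rightarrow> 'u set" and N P \<kappa> \<sigma> \<rho> where E: "\<And>n. small U (E n)" "\<And>n e. e \<in> E n \<Longrightarrow> N n e \<in> S"
    and P: "\<And>n. coproduct C (E n) (N n) (P n) (\<kappa> n)"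
    and \<sigma>: "\<And>n. \<sigma> n \<in> Hom C (cpt M n) (P n)" and \<rho>: "\<And>n. \<rho> n \<in> Hom C (P n) (cpt M n)"
    and \<rho>\<sigma>: "\<And>n. \<rho> n \<cdot> \<sigma> n = Id C (cpt M n)" by metis
  note PD = coproductD[OF P] and A = HomD[OF \<sigma>] HomD[OF \<rho>]
  have \<rho>\<sigma>': "\<rho> n \<cdot> \<sigma> n \<cdot> k = k" if "k \<in> Arr C" "Cod C k = cpt M n" for n k
    using comp_reduce[OF \<rho>\<sigma>[of n], of k] that A MD by simp
  define Q where "Q = \<lparr>cpt = P, diff = \<lambda>n. \<sigma> (n + 1) \<cdot> diff M n \<cdot> \<rho> n\<rparr>"
  have dd: "diff M (n + 1) \<cdot> diff M n \<cdot> k = zr (Dom C k) (cpt M (n + 2))"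
    if "k \<in> Arr C" "Cod C k = cpt M n" for n k
    using cx_diff_diff[OF cxB_cx[OF M] that] .
  have "P n \<in> B" for n
    using closed_under_coproductsD[OF inaccessible category_axioms closed_B P E(1)] E(2) S_B by blast
  then have QB: "cxB Q"
    unfolding complexes_def Q_def using A MD PD(1) \<rho>\<sigma>' dd by (simp add: Hom_iff)
  note QD = cxD[OF cxB_cx[OF QB]]
  have cptQ: "cpt Q n = P n" for n by (simp add: Q_def)
  have "\<sigma> \<in> chain_maps C M Q" "\<rho> \<in> chain_maps C Q M"
    unfolding chain_maps_def Q_def using A MD \<rho>\<sigma> \<rho>\<sigma>' \<sigma> \<rho> by simp_all
  moreover
  have "\<exists>J\<subseteq>E (n + 1). |J| \<le>o |T| \<and>
      supp (E (n + 1)) (P (n + 1)) (\<kappa> (n + 1)) J \<cdot> diff Q n \<cdot> \<kappa> n e = diff Q n \<cdot> \<kappa> n e" if "e \<in> E n" for n e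
  proof -
    have "diff Q n \<cdot> \<kappa> n e \<in> Hom C (N n e) (P (n + 1))"
      using QD PD(4-6)[OF that] by (simp add: Hom_iff cptQ)
    then show ?thesis
      using S_small[OF E(2)[OF that]] P E(1) unfolding coproduct_small_def by blast
  qed
  then have "\<forall>n e. \<exists>J. e \<in> E n \<longrightarrow> J \<subseteq> E (n + 1) \<and> |J| \<le>o |T| \<and>
      supp (E (n + 1)) (P (n + 1)) (\<kappa> (n + 1)) J \<cdot> diff Q n \<cdot> \<kappa> n e = diff Q n \<cdot> \<kappa> n e" by blast
  then obtain J where J: "\<And>n e. e \<in> E n \<Longrightarrow> J n e \<subseteq> E (n + 1) \<and> |J n e| \<le>o |T| \<and>
      supp (E (n + 1)) (P (n + 1)) (\<kappa> (n + 1)) (J n e) \<cdot> diff Q n \<cdot> \<kappa> n e = diff Q n \<cdot> \<kappa> n e"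
    unfolding choice_iff by blast
  define R where "R = {((n, e), (n + 1, e')) | n e e'. e \<in> E n \<and> e' \<in> J n e}"
  have "based_complex C Q E N \<kappa> R"
  proof
    show "cx Q" using cxB_cx[OF QB] .
    show "coproduct C (E n) (N n) (cpt Q n) (\<kappa> n)" for n unfolding cptQ by (rule P)
    show "e \<in> E n \<and> (\<exists>e'\<in>E (n + 1). x = (n + 1, e'))" if "((n, e), x) \<in> R" for n e x
      using that J unfolding R_def by blast
    fix e n assume e: "e \<in> E n"
    then have "{e'. ((n, e), (n + 1, e')) \<in> R} = J n e" unfolding R_def by auto
    then show "supp (E (n + 1)) (cpt Q (n + 1)) (\<kappa> (n + 1)) {e'. ((n, e), (n + 1, e')) \<in> R} \<cdot>
        diff Q n \<cdot> \<kappa> n e = diff Q n \<cdot> \<kappa> n e" using J[OF e] by (simp add: cptQ)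
  qed
  moreover have "|R `` {x}| \<le>o |T|" for x
  proof (cases "snd x \<in> E (fst x)")
    case True
    have "R `` {x} \<subseteq> Pair (fst x + 1) ` J (fst x) (snd x)" unfolding R_def by auto
    then have "|R `` {x}| \<le>o |J (fst x) (snd x)|"
      using card_of_mono1 card_of_image ordLeq_transitive by blast
    then show ?thesis using J[OF True] ordLeq_transitive by blast
  next
    case False
    then have "R `` {x} = {}" unfolding R_def by auto
    then show ?thesis by (simp add: card_of_empty)
  qed
  ultimately show ?thesis
    using QB E \<rho>\<sigma> unfolding retract_data_def by blast
qed

lemma retract_dataD:
  assumes "retract_data M Q E N \<kappa> R \<sigma> \<rho>"
  shows "cxB Q" "based_complex C Q E N \<kappa> R" "|R `` {x}| \<le>o |T|" "small U (E n)" "e \<in> E n \<Longrightarrow> N n e \<in> S"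
    "\<sigma> \<in> chain_maps C M Q" "\<rho> \<in> chain_maps C Q M" "\<rho> n \<cdot> \<sigma> n = Id C (cpt M n)"
  using assms unfolding retract_data_def by blast+

lemma complexes_\<T>_I: "cx X \<Longrightarrow> (\<And>n. cpt X n \<in> \<T>) \<Longrightarrow> X \<in> complexes C \<T>"
  unfolding complexes_def by simp

lemma cxB_\<T>: "X \<in> complexes C \<T> \<Longrightarrow> cxB X"
  using complexes_mono[OF \<T>_B] .

text \<open>The identity of \<open>M\<close> is \<open>\<rho> \<sigma>\<close>, so it suffices that
  the retraction \<rho> from the resolution is null homotopic, and this can be tested on small
  subquotients of \<open>Q\<close>.\<close>

lemma zero_if_orthogonal:
  assumes M: "cxB M" and orth: "\<And>X f. X \<in> complexes C \<T> \<Longrightarrow> f \<in> chain_maps C X M \<Longrightarrow> null_homotopic X M f"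
  shows "null_homotopic M M (\<lambda>n. Id C (cpt M n))"
proof -
  obtain Q and E :: "int \<Rightarrow> 'u set" and N \<kappa> R \<sigma> \<rho> where rd: "retract_data M Q E N \<kappa> R \<sigma> \<rho>"
    using ex_retract_data[OF M] by blast
  note D = retract_dataD[OF rd]
  interpret based_complex C Q E N \<kappa> R by (rule D(2))
  \<comment> \<open>A coproduct chosen inside \<open>\<T>\<close>. It exists for the sets
    \<open>J\<close> that occur, since these lie in the closure of a single basis element, which has
    at most \<open>|T|\<close> members.\<close>
  define P where "P n J = (SOME P. P \<in> \<T> \<and> (\<exists>\<iota>. coproduct C J (N n) P \<iota>))" for n J
  have P: "P n J \<in> \<T> \<and> (\<exists>\<iota>. coproduct C J (N n) (P n J) \<iota>)"
    if J: "J \<subseteq> E n \<inter> {e. (n, e) \<in> R\<^sup>* `` {x}}" for n J and x :: "int \<times> 'u"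
  proof -
    have R: "|R\<^sup>* `` {x}| \<le>o |T|"
      by (rule card_of_rtrancl_Image_ordLeq[OF T _ D(3)])
        (rule card_of_singl_ordLeq, use T in auto)
    have "J \<subseteq> snd ` (R\<^sup>* `` {x})" using J by force
    then have "|J| \<le>o |T|"
      by (rule ordLeq_transitive[OF card_of_mono1 ordLeq_transitive[OF card_of_image R]])
    then have "\<exists>P. P \<in> \<T> \<and> (\<exists>\<iota>. coproduct C J (N n) P \<iota>)"
      using \<T>_ex[of J "N n"] D(5) J by blast
    then show ?thesis unfolding P_def by (rule someI_ex)
  qed
  have "null_homotopic Q M \<rho>"
  proof (rule null_homotopicI_small[OF cxB_cx[OF M] D(7), of P])
    show "\<exists>\<iota>. coproduct C J (N n) (P n J) \<iota>"
      if "J \<subseteq> E n \<inter> {e. (n, e) \<in> R\<^sup>* `` {x}}" for x n J using P[OF that] by blast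
    fix x X f assume X: "cx X" "f \<in> chain_maps C X M"
      and *: "\<And>n. \<exists>J \<kappa>. J \<subseteq> E n \<inter> {e. (n, e) \<in> R\<^sup>* `` {x}} \<and> coproduct C J (N n) (cpt X n) \<kappa> \<and>
        cpt X n = P n J"
    have "cpt X n \<in> \<T>" for n using *[of n] P by metis
    then show "null_homotopic X M f" using orth[OF complexes_\<T>_I[OF X(1)] X(2)] by blast
  qed
  then have "null_homotopic M M (\<lambda>n. \<rho> n \<cdot> \<sigma> n)"
    using null_homotopic_comp(2)[OF cxB_cx[OF M] Q cxB_cx[OF M] D(6)] by blast
  then show ?thesis by (simp add: D(8))
qed

text \<open>A representing chain map has a support of size at most \<open>|T|\<close> in every
  degree, and the union over the countably many degrees is one support for all of them. The
  projection onto these summands is a chain map, so the bound passes to homotopy classes.\<close>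

lemma K_coproduct_small:
  assumes X: "X \<in> complexes C \<T>"
  shows "preadditive_category.coproduct_small K U T X"
proof -
  interpret K: preadditive_category K by (rule K_preadditive)
  have XB: "cxB X" using cxB_\<T>[OF X] .
  show ?thesis
    unfolding K.coproduct_small_def
  proof (intro conjI allI impI ballI)
    show "X \<in> Ob K" using XB by (simp add: K_Ob)
    fix I :: "'u set" and M P' \<iota>' u assume *: "small U I \<and> coproduct K I M P' \<iota>'" and u: "u \<in> Hom K X P'"
    then have I: "small U I" and P': "coproduct K I M P' \<iota>'" by blast+
    have M: "\<And>i. i \<in> I \<Longrightarrow> cxB (M i)" using coproductD(2)[OF P'] by (simp add: K_Ob)
    obtain P \<iota> where PB: "cxB P" and P: "cpt_coproduct I M P \<iota>" using ex_cpt_coproduct[of I M] I M by blast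
    note PD = cpt_coproductD[OF P]
    have KP: "coproduct K I M P (\<lambda>i. cls (M i) P (\<iota> i))" by (rule K_coproduct[OF P PB M])
    \<comment> \<open>The given coproduct in \<open>K\<close> is known only up to isomorphism; it is
      compared with the one computed degree by degree.\<close>
    obtain h k where h: "h \<in> Hom K P P'" and k: "k \<in> Hom K P' P" and hk: "h \<cdot>\<^bsub>K\<^esub> k = Id K P'"
      and h\<iota>: "\<forall>i\<in>I. h \<cdot>\<^bsub>K\<^esub> cls (M i) P (\<iota> i) = \<iota>' i" and k\<iota>: "\<forall>i\<in>I. k \<cdot>\<^bsub>K\<^esub> \<iota>' i = cls (M i) P (\<iota> i)"
      using K.coproduct_unique[OF KP P'] by blast
    obtain f where f: "f \<in> chain_maps C X P" "k \<cdot>\<^bsub>K\<^esub> u = cls X P f"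
      using K.comp_hom[OF k u] by (rule K_HomE) (rule that)
    have "\<exists>J\<subseteq>I. |J| \<le>o |T| \<and> supp I (cpt P n) (\<lambda>i. \<iota> i n) J \<cdot> f n = f n" for n
      by (rule coproduct_small_any_index[OF inaccessible \<T>_small[OF complexes_cpt[OF X]] PD(4) I
          chain_mapD(1)[OF f(1)]])
    then obtain J where J: "\<And>n. J n \<subseteq> I" "\<And>n. |J n| \<le>o |T|"
      "\<And>n. supp I (cpt P n) (\<lambda>i. \<iota> i n) (J n) \<cdot> f n = f n" by metis
    define J' where "J' = (\<Union>n. J n)"
    have J': "J' \<subseteq> I" "|J'| \<le>o |T|" using J(1) countable_UN_T[of J, OF J(2)] by (auto simp: J'_def)
    \<comment> \<open>Components of the endomorphism \<open>e\<close> of \<open>P\<close> that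
      projects to the summands in \<open>J'\<close>; one and the same \<open>J'\<close> in all
      degrees makes \<open>e\<close> a chain map.\<close>
    define q where "q i = (if i \<in> J' then \<iota> i else (\<lambda>n. zr (cpt (M i) n) (cpt P n)))" for i
    have "q i \<in> chain_maps C (M i) P" if "i \<in> I" for i
      using PD(3)[OF that] chain_maps_closed(1)[OF PD(2)[OF that] PD(1)] by (simp add: q_def)
    then obtain e where e: "e \<in> chain_maps C P P" "\<forall>i\<in>I. \<forall>n. e n \<cdot> \<iota> i n = q i n"
      using cpt_coproduct_map[OF P PD(1), of q] by blast
    note cD = cxD[OF PD(1)] and eD = chain_mapD[OF e(1)] and fD = chain_mapD[OF f(1)]
    have "e n \<cdot> f n = f n" for n
    proof -
      have "e n \<cdot> f n = Id C (cpt P n) \<cdot> f n"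
      proof (rule supp_comp_eqI[OF PD(4) fD(1) _ eD(1) id_hom[OF cD(1)]])
        show "supp I (cpt P n) (\<lambda>i. \<iota> i n) J' \<cdot> f n = f n"
          by (rule supp_fixed_mono[OF PD(4) fD(1) J(3)]) (auto simp: J'_def)
        show "e n \<cdot> \<iota> i n = Id C (cpt P n) \<cdot> \<iota> i n" if "i \<in> I" "i \<in> J'" for i
          using e(2) that chain_mapD[OF PD(3)[OF that(1)]] by (simp add: q_def)
      qed
      then show ?thesis using fD by simp
    qed
    then have ef: "cls P P e \<cdot>\<^bsub>K\<^esub> cls X P f = cls X P f"
      using K_comp[OF XB PB PB e(1) f(1)] by simp
    note eK = K_HomI[OF PB PB e(1)]
    have "K.supp I P' \<iota>' J' = h \<cdot>\<^bsub>K\<^esub> cls P P e \<cdot>\<^bsub>K\<^esub> k"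
    proof (rule coproduct_eqI[OF P' K.supp(1)[OF P'] K.comp_hom[OF h K.comp_hom[OF eK k]] coproductD(1)[OF P'] K_category])
      fix i assume i: "i \<in> I"
      have \<iota>'A: "\<iota>' i \<in> Hom K (M i) P'" by (rule coproductD(3)[OF P' i])
      have "(h \<cdot>\<^bsub>K\<^esub> cls P P e \<cdot>\<^bsub>K\<^esub> k) \<cdot>\<^bsub>K\<^esub> \<iota>' i = h \<cdot>\<^bsub>K\<^esub> cls P P e \<cdot>\<^bsub>K\<^esub> k \<cdot>\<^bsub>K\<^esub> \<iota>' i"
        using HomD[OF h] HomD[OF eK] HomD[OF k] HomD[OF \<iota>'A] by simp
      also have "\<dots> = h \<cdot>\<^bsub>K\<^esub> cls (M i) P (q i)"
        using k\<iota> i K_comp[OF M[OF i] PB PB e(1) PD(3)[OF i]] e(2) by simp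
      also have "\<dots> = K.supp I P' \<iota>' J' \<cdot>\<^bsub>K\<^esub> \<iota>' i"
        using K.supp(2)[OF P' i] h\<iota> i K_zero[of "M i" P, symmetric] HomD[OF h] K_Ob M PB
        by (simp add: q_def)
      finally show "K.supp I P' \<iota>' J' \<cdot>\<^bsub>K\<^esub> \<iota>' i = (h \<cdot>\<^bsub>K\<^esub> cls P P e \<cdot>\<^bsub>K\<^esub> k) \<cdot>\<^bsub>K\<^esub> \<iota>' i" by simp
    qed
    then have "K.supp I P' \<iota>' J' \<cdot>\<^bsub>K\<^esub> u = h \<cdot>\<^bsub>K\<^esub> cls P P e \<cdot>\<^bsub>K\<^esub> k \<cdot>\<^bsub>K\<^esub> u"
      using HomD[OF h] HomD[OF eK] HomD[OF k] HomD[OF u] by simp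
    also have "\<dots> = (h \<cdot>\<^bsub>K\<^esub> k) \<cdot>\<^bsub>K\<^esub> u"
      unfolding f(2) ef unfolding f(2)[symmetric] using HomD[OF h] HomD[OF k] HomD[OF u] by simp
    also have "\<dots> = u" unfolding hk by (rule K.id_left[OF u])
    finally show "\<exists>J\<subseteq>I. |J| \<le>o |T| \<and> K.supp I P' \<iota>' J \<cdot>\<^bsub>K\<^esub> u = u"
      using J' by (intro exI[of _ J']) simp
  qed
qed

end

section \<open>Factoring maps from generators to coproducts\<close>

context small_generators
begin

text \<open>The closure of \<open>F0\<close> under \<open>R\<close> is still of size at most
  \<open>|T|\<close>, and as a closed set it spans a subcomplex: the case of an empty
  \<open>G'\<close>. The inclusion is a chain map; the retraction \<open>p\<close> is one only in
  each degree.\<close>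

lemma small_subcomplex:
  assumes rd: "retract_data M Q (E :: int \<Rightarrow> 'u set) N \<kappa> R \<sigma> \<rho>" and F: "|F0| \<le>o |T|"
  shows "\<exists>X D inc p. X \<in> complexes C \<T> \<and> inc \<in> chain_maps C X Q \<and>
    (\<forall>n. p n \<in> Hom C (cpt Q n) (cpt X n)) \<and> (\<forall>n. p n \<cdot> inc n = Id C (cpt X n)) \<and>
    (\<forall>n. \<forall>e\<in>E n. (n, e) \<in> F0 \<longrightarrow> e \<in> D n) \<and> (\<forall>n. \<forall>e\<in>D n. inc n \<cdot> p n \<cdot> \<kappa> n e = \<kappa> n e)"
proof -
  note RD = retract_dataD[OF rd]
  interpret based_complex C Q E N \<kappa> R by (rule RD(2))
  define G where "G = R\<^sup>* `` F0"
  have GT: "|G| \<le>o |T|" unfolding G_def by (rule card_of_rtrancl_Image_ordLeq[OF T F RD(3)])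
  have RG: "R `` G \<subseteq> G" unfolding G_def by (auto intro: rtrancl.rtrancl_into_rtrancl)
  define D where "D n = {e \<in> E n. (n, e) \<in> G \<and> (n, e) \<notin> ({} :: (int \<times> 'u) set)}" for n
  have "|D n| \<le>o |T|" for n
  proof -
    have "D n \<subseteq> snd ` G" unfolding D_def by force
    then show ?thesis by (rule ordLeq_transitive[OF card_of_mono1 ordLeq_transitive[OF card_of_image GT]])
  qed
  then have "\<exists>P\<in>\<T>. \<exists>\<nu>. coproduct C (D n) (N n) P \<nu>" for n
    by (rule \<T>_ex) (use RD(5) in \<open>auto simp: D_def\<close>)
  then obtain P \<nu> where P\<T>: "\<And>n. P n \<in> \<T>" and P: "\<And>n. coproduct C (D n) (N n) (P n) (\<nu> n)" by metis
  note PD = coproductD[OF P]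
  obtain X inc p where X: "cx X" "cpt X = P" and dX: "\<And>n. diff X n = p (n + 1) \<cdot> diff Q n \<cdot> inc n"
    and i: "\<And>n. inc n \<in> Hom C (P n) (cpt Q n)" and p: "\<And>n. p n \<in> Hom C (cpt Q n) (P n)"
    and i\<nu>: "\<And>n e. e \<in> D n \<Longrightarrow> inc n \<cdot> \<nu> n e = \<kappa> n e"
    and p\<kappa>: "\<And>n e. e \<in> D n \<Longrightarrow> p n \<cdot> \<kappa> n e = \<nu> n e"
    using subquotient[OF RG _ D_def P] by (smt (verit) Image_empty2 empty_subsetI)
  note A = HomD[OF i] HomD[OF p]
  have ip: "inc n \<cdot> p n \<cdot> \<kappa> n e = \<kappa> n e" if "e \<in> D n" for n e
    using i\<nu>[OF that] p\<kappa>[OF that] by simp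
  have DE: "e \<in> D n \<Longrightarrow> e \<in> E n" for e n by (simp add: D_def)
  have "p n \<cdot> inc n = Id C (P n)" for n
  proof (rule coproduct_eqI[OF P _ _ PD(1) category_axioms])
    show "(p n \<cdot> inc n) \<cdot> \<nu> n e = Id C (P n) \<cdot> \<nu> n e" if "e \<in> D n" for e
      using A PD(4-6)[OF that] i\<nu>[OF that] p\<kappa>[OF that] by simp
  qed (use A PD(1) in \<open>simp_all add: Hom_iff\<close>)
  moreover have "inc \<in> chain_maps C X Q"
  proof (rule chain_mapI)
    fix n
    show "inc n \<in> Hom C (cpt X n) (cpt Q n)" using i X(2) by simp
    show "inc (n + 1) \<cdot> diff X n = diff Q n \<cdot> inc n"
      unfolding dX
    proof (rule coproduct_eqI[OF P _ _ QD(1) category_axioms])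
      fix e assume e: "e \<in> D n"
      note eD = bD(4-6)[OF DE[OF e]] PD(4-6)[OF e]
      have "(inc (n + 1) \<cdot> p (n + 1)) \<cdot> diff Q n \<cdot> \<kappa> n e = Id C (cpt Q (n + 1)) \<cdot> diff Q n \<cdot> \<kappa> n e"
      proof (rule diff_comp_eqI[OF RG DE[OF e] _ comp_hom[OF i p] id_hom[OF QD(1)]])
        show "(n, e) \<in> G" using e by (simp add: D_def)
        fix e' assume e': "e' \<in> E (n + 1)" "(n + 1, e') \<in> G"
        then have "e' \<in> D (n + 1)" by (simp add: D_def)
        then show "(inc (n + 1) \<cdot> p (n + 1)) \<cdot> \<kappa> (n + 1) e' = Id C (cpt Q (n + 1)) \<cdot> \<kappa> (n + 1) e'"
          using ip A bD(4-6)[OF e'(1)] by simp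
      qed
      then show "(inc (n + 1) \<cdot> p (n + 1) \<cdot> diff Q n \<cdot> inc n) \<cdot> \<nu> n e = (diff Q n \<cdot> inc n) \<cdot> \<nu> n e"
        using A QD eD i\<nu>[OF e] by simp
    qed (use A QD in \<open>simp_all add: Hom_iff\<close>)
  qed
  moreover have "X \<in> complexes C \<T>" using complexes_\<T>_I[OF X(1)] P\<T> X(2) by simp
  moreover have "\<forall>n. \<forall>e\<in>E n. (n, e) \<in> F0 \<longrightarrow> e \<in> D n" by (auto simp: D_def G_def)
  ultimately show ?thesis
    using p ip X(2) by (intro exI[of _ X] exI[of _ D] exI[of _ inc] exI[of _ p]) simp
qed

text \<open>
  The factorization already holds on the level of chain maps: the supports of \<open>f\<close> generate small
  subcomplexes of resolutions of the \<open>M i\<close>.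
\<close>

lemma chain_map_factor:
  assumes X: "X \<in> complexes C \<T>" and I: "small U (I :: 'u set)" and M: "\<And>i. i \<in> I \<Longrightarrow> cxB (M i)"
    and P: "cpt_coproduct I M P \<iota>" and f: "f \<in> chain_maps C X P"
  shows "\<exists>N f' Q \<iota>' g h. (\<forall>i\<in>I. N i \<in> complexes C \<T> \<and> f' i \<in> chain_maps C (N i) (M i)) \<and>
    cxB Q \<and> cpt_coproduct I N Q \<iota>' \<and> g \<in> chain_maps C X Q \<and> h \<in> chain_maps C Q P \<and>
    (\<forall>i\<in>I. \<forall>n. h n \<cdot> \<iota>' i n = \<iota> i n \<cdot> f' i n) \<and> (\<forall>n. f n = h n \<cdot> g n)"
proof -
  have "\<forall>i\<in>I. \<exists>Q (E :: int \<Rightarrow> 'u set) N \<kappa> R \<sigma> \<rho>. retract_data (M i) Q E N \<kappa> R \<sigma> \<rho>"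
    using ex_retract_data M by blast
  then obtain Q and E :: "'u \<Rightarrow> int \<Rightarrow> 'u set" and N \<kappa> R \<sigma> \<rho> where
    rd: "\<And>i. i \<in> I \<Longrightarrow> retract_data (M i) (Q i) (E i) (N i) (\<kappa> i) (R i) (\<sigma> i) (\<rho> i)"
    by metis
  note RD = retract_dataD[OF rd]
  have basis: "coproduct C (E i n) (N i n) (cpt (Q i) n) (\<kappa> i n)" if "i \<in> I" for i n
    using based_complex.basis[OF RD(2)[OF that]] .
  have Qcx: "cx (Q i)" if "i \<in> I" for i using cxB_cx[OF RD(1)[OF that]] .
  obtain PQ \<iota>Q where PQB: "cxB PQ" and PQ: "cpt_coproduct I Q PQ \<iota>Q"
    using ex_cpt_coproduct[of I Q] I RD(1) by blast
  note PD = cpt_coproductD[OF P] and PQD = cpt_coproductD[OF PQ]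
  have "(\<lambda>n. \<iota>Q i n \<cdot> \<sigma> i n) \<in> chain_maps C (M i) PQ" if "i \<in> I" for i
    using chain_map_comp[OF PD(2)[OF that] Qcx[OF that] PQD(1) PQD(3)[OF that] RD(6)[OF that]] .
  then obtain s where s: "s \<in> chain_maps C P PQ" "\<And>i n. i \<in> I \<Longrightarrow> s n \<cdot> \<iota> i n = \<iota>Q i n \<cdot> \<sigma> i n"
    using cpt_coproduct_map[OF P PQD(1), of "\<lambda>i n. \<iota>Q i n \<cdot> \<sigma> i n"] by blast
  have "(\<lambda>n. \<iota> i n \<cdot> \<rho> i n) \<in> chain_maps C (Q i) P" if "i \<in> I" for i
    using chain_map_comp[OF Qcx[OF that] PD(2)[OF that] PD(1) PD(3)[OF that] RD(7)[OF that]] .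
  then obtain r where r: "r \<in> chain_maps C PQ P" "\<And>i n. i \<in> I \<Longrightarrow> r n \<cdot> \<iota>Q i n = \<iota> i n \<cdot> \<rho> i n"
    using cpt_coproduct_map[OF PQ PD(1), of "\<lambda>i n. \<iota> i n \<cdot> \<rho> i n"] by blast
  note sD = chain_mapD[OF s(1)] and rD = chain_mapD[OF r(1)] and fD = chain_mapD[OF f]
  have XB: "cxB X" using cxB_\<T>[OF X] .
  note Xcx = cxB_cx[OF XB]
  \<comment> \<open>\<open>P\<close> is a retract of the coproduct \<open>PQ\<close> of the
    resolutions, by chain maps; it is enough to factor \<open>s f\<close> through generators and
    then apply \<open>r\<close>.\<close>
  have rs: "r n \<cdot> s n = Id C (cpt P n)" for n
  proof (rule cpt_coproduct_eqI[OF P])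
    fix i assume i: "i \<in> I"
    note iD = chain_mapD[OF PD(3)[OF i]] chain_mapD[OF PQD(3)[OF i]] chain_mapD[OF RD(6)[OF i]]
      chain_mapD[OF RD(7)[OF i]] RD(8)[OF i]
    have "(r n \<cdot> s n) \<cdot> \<iota> i n = (r n \<cdot> \<iota>Q i n) \<cdot> \<sigma> i n" using sD rD iD s(2)[OF i] by simp
    also have "\<dots> = Id C (cpt P n) \<cdot> \<iota> i n" unfolding r(2)[OF i] using iD PD(1) by simp
    finally show "(r n \<cdot> s n) \<cdot> \<iota> i n = Id C (cpt P n) \<cdot> \<iota> i n" .
  qed (use sD rD cxD[OF PD(1)] in \<open>simp_all add: Hom_iff\<close>)
  define f1 where "f1 n = s n \<cdot> f n" for n
  have f1: "f1 \<in> chain_maps C X PQ"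
    unfolding f1_def using chain_map_comp[OF Xcx PD(1) PQD(1) s(1) f] .
  note f1D = chain_mapD[OF f1]
  have big: "coproduct C (Sigma I (\<lambda>i. E i n)) (\<lambda>(i, e). N i n e) (cpt PQ n) (\<lambda>(i, e). \<iota>Q i n \<cdot> \<kappa> i n e)" for n
    by (rule coproduct_Sigma[OF PQD(4) basis])
  have "\<exists>J\<subseteq>Sigma I (\<lambda>i. E i n). |J| \<le>o |T| \<and>
      supp (Sigma I (\<lambda>i. E i n)) (cpt PQ n) (\<lambda>(i, e). \<iota>Q i n \<cdot> \<kappa> i n e) J \<cdot> f1 n = f1 n" for n
    by (rule coproduct_small_any_index[OF inaccessible \<T>_small[OF complexes_cpt[OF X]] big
          small_Sigma[OF inaccessible I RD(4)] f1D(1)])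
  then have "\<forall>n. \<exists>J. J \<subseteq> Sigma I (\<lambda>i. E i n) \<and> |J| \<le>o |T| \<and>
      supp (Sigma I (\<lambda>i. E i n)) (cpt PQ n) (\<lambda>(i, e). \<iota>Q i n \<cdot> \<kappa> i n e) J \<cdot> f1 n = f1 n" by blast
  then obtain J where J: "\<And>n. J n \<subseteq> Sigma I (\<lambda>i. E i n)" "\<And>n. |J n| \<le>o |T|"
    "\<And>n. supp (Sigma I (\<lambda>i. E i n)) (cpt PQ n) (\<lambda>(i, e). \<iota>Q i n \<cdot> \<kappa> i n e) (J n) \<cdot> f1 n = f1 n"
    unfolding choice_iff by blast
  \<comment> \<open>The basis elements of the resolution of \<open>M i\<close> that occur in the
    support of \<open>f1\<close> in some degree.\<close>
  define F0 where "F0 i = (\<Union>n. Pair n ` {e. (i, e) \<in> J n})" for i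
  have F0T: "|F0 i| \<le>o |T|" for i
    unfolding F0_def
  proof (rule countable_UN_T)
    fix n
    have "{e. (i, e) \<in> J n} \<subseteq> snd ` J n" by force
    then have "|{e. (i, e) \<in> J n}| \<le>o |T|"
      by (rule ordLeq_transitive[OF card_of_mono1 ordLeq_transitive[OF card_of_image J(2)]])
    then show "|Pair n ` {e. (i, e) \<in> J n}| \<le>o |T|"
      by (rule ordLeq_transitive[OF card_of_image])
  qed
  define sub where "sub i Y D inc p \<longleftrightarrow> Y \<in> complexes C \<T> \<and> inc \<in> chain_maps C Y (Q i) \<and>
    (\<forall>n. p n \<in> Hom C (cpt (Q i) n) (cpt Y n)) \<and> (\<forall>n. p n \<cdot> inc n = Id C (cpt Y n)) \<and>
    (\<forall>n. \<forall>e\<in>E i n. (n, e) \<in> F0 i \<longrightarrow> e \<in> D n) \<and> (\<forall>n. \<forall>e\<in>D n. inc n \<cdot> p n \<cdot> \<kappa> i n e = \<kappa> i n e)"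
    for i Y D inc p
  have "\<forall>i\<in>I. \<exists>Y D inc p. sub i Y D inc p"
    unfolding sub_def using small_subcomplex[OF rd F0T] by blast
  then obtain Y D inc p where "\<And>i. i \<in> I \<Longrightarrow> sub i (Y i) (D i) (inc i) (p i)" by metis
  then have Y: "\<And>i. i \<in> I \<Longrightarrow> Y i \<in> complexes C \<T>" and inc: "\<And>i. i \<in> I \<Longrightarrow> inc i \<in> chain_maps C (Y i) (Q i)"
    and p: "\<And>i n. i \<in> I \<Longrightarrow> p i n \<in> Hom C (cpt (Q i) n) (cpt (Y i) n)"
    and pinc: "\<And>i n. i \<in> I \<Longrightarrow> p i n \<cdot> inc i n = Id C (cpt (Y i) n)"
    and D: "\<And>i n e. i \<in> I \<Longrightarrow> e \<in> E i n \<Longrightarrow> (n, e) \<in> F0 i \<Longrightarrow> e \<in> D i n"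
    and incp: "\<And>i n e. i \<in> I \<Longrightarrow> e \<in> D i n \<Longrightarrow> inc i n \<cdot> p i n \<cdot> \<kappa> i n e = \<kappa> i n e"
    unfolding sub_def by blast+
  have YB: "\<And>i. i \<in> I \<Longrightarrow> cxB (Y i)" using cxB_\<T>[OF Y] .
  obtain PY \<iota>Y where PYB: "cxB PY" and PY: "cpt_coproduct I Y PY \<iota>Y"
    using ex_cpt_coproduct[of I Y] I YB by blast
  note PYD = cpt_coproductD[OF PY]
  have "(\<lambda>n. \<iota>Q i n \<cdot> inc i n) \<in> chain_maps C (Y i) PQ" if "i \<in> I" for i
    using chain_map_comp[OF PYD(2)[OF that] Qcx[OF that] PQD(1) PQD(3)[OF that] inc[OF that]] .
  then obtain j where j: "j \<in> chain_maps C PY PQ" "\<And>i n. i \<in> I \<Longrightarrow> j n \<cdot> \<iota>Y i n = \<iota>Q i n \<cdot> inc i n"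
    using cpt_coproduct_map[OF PY PQD(1), of "\<lambda>i n. \<iota>Q i n \<cdot> inc i n"] by blast
  \<comment> \<open>A left inverse of \<open>j\<close> in each degree, assembled from the
    retractions \<open>p i\<close>; in general it does not commute with the differentials.\<close>
  define q where "q n = cotuple C I (cpt PQ n) (\<lambda>i. \<iota>Q i n) (cpt PY n) (\<lambda>i. \<iota>Y i n \<cdot> p i n)" for n
  have "\<iota>Y i n \<cdot> p i n \<in> Hom C (cpt (Q i) n) (cpt PY n)" if "i \<in> I" for i n
    using comp_hom[OF chain_mapD(1)[OF PYD(3)[OF that]] p[OF that]] .
  then have q: "q n \<in> Hom C (cpt PQ n) (cpt PY n)" "i \<in> I \<Longrightarrow> q n \<cdot> \<iota>Q i n = \<iota>Y i n \<cdot> p i n" for n i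
    unfolding q_def
    by (rule cotuple(1)[OF PQD(4) cxD(1)[OF PYD(1)]] cotuple(2)[OF PQD(4) cxD(1)[OF PYD(1)]]; blast)+
  note jD = chain_mapD[OF j(1)] and qD = HomD[OF q(1)]
  have qj: "q n \<cdot> j n = Id C (cpt PY n)" for n
  proof (rule cpt_coproduct_eqI[OF PY])
    fix i assume i: "i \<in> I"
    note iD = chain_mapD[OF PYD(3)[OF i]] chain_mapD[OF PQD(3)[OF i]] chain_mapD[OF inc[OF i]]
      HomD[OF p[OF i]] pinc[OF i]
    have "(q n \<cdot> j n) \<cdot> \<iota>Y i n = (q n \<cdot> \<iota>Q i n) \<cdot> inc i n" using jD qD iD j(2)[OF i] by simp
    also have "\<dots> = Id C (cpt PY n) \<cdot> \<iota>Y i n" unfolding q(2)[OF i] using iD by simp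
    finally show "(q n \<cdot> j n) \<cdot> \<iota>Y i n = Id C (cpt PY n) \<cdot> \<iota>Y i n" .
  qed (use jD qD cxD[OF PYD(1)] in \<open>simp_all add: Hom_iff\<close>)
  have jqf: "j n \<cdot> q n \<cdot> f1 n = f1 n" for n
  proof -
    have "(j n \<cdot> q n) \<cdot> f1 n = Id C (cpt PQ n) \<cdot> f1 n"
    proof (rule supp_comp_eqI[OF big f1D(1) J(3) comp_hom[OF jD(1) q(1)] id_hom[OF cxD(1)[OF PQD(1)]]])
      fix x assume "x \<in> Sigma I (\<lambda>i. E i n)" "x \<in> J n"
      then obtain i e where x: "x = (i, e)" and i: "i \<in> I" and e: "e \<in> E i n" and eJ: "(i, e) \<in> J n" by blast
      have eD: "e \<in> D i n" using D[OF i e] eJ by (auto simp: F0_def)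
      note iD = chain_mapD[OF PYD(3)[OF i]] chain_mapD[OF PQD(3)[OF i]] chain_mapD[OF inc[OF i]]
        HomD[OF p[OF i]] coproductD(4-6)[OF basis[OF i] e]
      have "(j n \<cdot> q n) \<cdot> \<iota>Q i n \<cdot> \<kappa> i n e = j n \<cdot> (q n \<cdot> \<iota>Q i n) \<cdot> \<kappa> i n e"
        using jD qD iD by simp
      also have "\<dots> = (j n \<cdot> \<iota>Y i n) \<cdot> p i n \<cdot> \<kappa> i n e"
        unfolding q(2)[OF i] using jD iD by simp
      also have "\<dots> = \<iota>Q i n \<cdot> \<kappa> i n e"
        unfolding j(2)[OF i] using iD incp[OF i eD] by simp
      finally show "(j n \<cdot> q n) \<cdot> (case x of (i, e) \<Rightarrow> \<iota>Q i n \<cdot> \<kappa> i n e) =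
          Id C (cpt PQ n) \<cdot> (case x of (i, e) \<Rightarrow> \<iota>Q i n \<cdot> \<kappa> i n e)"
        unfolding x using iD cxD[OF PQD(1)] by simp
    qed
    then show ?thesis using jD qD f1D by simp
  qed
  define g where "g n = q n \<cdot> f1 n" for n
  \<comment> \<open>\<open>q\<close> is not a chain map but \<open>q f1\<close> is:
    \<open>f1\<close> lies in the image of \<open>j\<close>, where \<open>j q\<close> acts as the
    identity, and \<open>j\<close> is a chain map with left inverse \<open>q\<close>.\<close>
  have g: "g \<in> chain_maps C X PY"
  proof (rule chain_mapI)
    fix n
    note A = qD jD f1D cxD[OF Xcx] cxD[OF PQD(1)] cxD[OF PYD(1)]
    show "g n \<in> Hom C (cpt X n) (cpt PY n)" using A by (simp add: g_def Hom_iff)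
    have "g (n + 1) \<cdot> diff X n = q (n + 1) \<cdot> diff PQ n \<cdot> f1 n" using A by (simp add: g_def)
    also have "\<dots> = q (n + 1) \<cdot> diff PQ n \<cdot> j n \<cdot> q n \<cdot> f1 n" by (simp add: jqf)
    also have "\<dots> = q (n + 1) \<cdot> j (n + 1) \<cdot> diff PY n \<cdot> q n \<cdot> f1 n"
      using chain_map_comm_comp[OF j(1) PYD(1) PQD(1), of "q n \<cdot> f1 n" n] A by simp
    also have "\<dots> = (q (n + 1) \<cdot> j (n + 1)) \<cdot> diff PY n \<cdot> q n \<cdot> f1 n" using A by simp
    also have "\<dots> = diff PY n \<cdot> g n" unfolding qj using A by (simp add: g_def)
    finally show "g (n + 1) \<cdot> diff X n = diff PY n \<cdot> g n" .
  qed
  define h where "h n = r n \<cdot> j n" for n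
  have h: "h \<in> chain_maps C PY P"
    unfolding h_def using chain_map_comp[OF PYD(1) PQD(1) PD(1) r(1) j(1)] .
  define f' where "f' i n = \<rho> i n \<cdot> inc i n" for i n
  have f': "f' i \<in> chain_maps C (Y i) (M i)" if "i \<in> I" for i
    unfolding f'_def using chain_map_comp[OF PYD(2)[OF that] Qcx[OF that] PD(2)[OF that] RD(7)[OF that] inc[OF that]] .
  have "h n \<cdot> \<iota>Y i n = \<iota> i n \<cdot> f' i n" if i: "i \<in> I" for i n
  proof -
    note iD = chain_mapD[OF PYD(3)[OF i]] chain_mapD[OF PQD(3)[OF i]] chain_mapD[OF inc[OF i]]
      chain_mapD[OF PD(3)[OF i]] chain_mapD[OF RD(7)[OF i]]
    have "h n \<cdot> \<iota>Y i n = (r n \<cdot> \<iota>Q i n) \<cdot> inc i n" using rD jD iD j(2)[OF i] by (simp add: h_def)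
    then show ?thesis unfolding r(2)[OF i] using iD by (simp add: f'_def)
  qed
  moreover have "f n = h n \<cdot> g n" for n
  proof -
    have "h n \<cdot> g n = r n \<cdot> j n \<cdot> q n \<cdot> f1 n" using rD jD qD f1D by (simp add: h_def g_def)
    also have "\<dots> = r n \<cdot> f1 n" unfolding jqf ..
    also have "\<dots> = (r n \<cdot> s n) \<cdot> f n" unfolding f1_def using rD sD fD by simp
    also have "\<dots> = f n" unfolding rs using fD by simp
    finally show ?thesis by simp
  qed
  ultimately show ?thesis
    using Y f' PYB PY g h
    by (intro exI[of _ Y] exI[of _ f'] exI[of _ PY] exI[of _ \<iota>Y] exI[of _ g] exI[of _ h]) simp
qed

text \<open>The strict factorization is transported along the isomorphism between the coproduct
  computed degree by degree and the given one in \<open>K\<close>.\<close>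

lemma K_factor:
  assumes X: "X \<in> complexes C \<T>" and I: "small U (I :: 'u set)" and P': "coproduct K I M P' \<iota>'"
    and u: "u \<in> Hom K X P'"
  shows "\<exists>N f' Q \<nu> g h. (\<forall>i\<in>I. N i \<in> complexes C \<T> \<and> f' i \<in> Hom K (N i) (M i)) \<and>
    coproduct K I N Q \<nu> \<and> g \<in> Hom K X Q \<and> h \<in> Hom K Q P' \<and>
    (\<forall>i\<in>I. h \<cdot>\<^bsub>K\<^esub> \<nu> i = \<iota>' i \<cdot>\<^bsub>K\<^esub> f' i) \<and> u = h \<cdot>\<^bsub>K\<^esub> g"
proof -
  interpret K: preadditive_category K by (rule K_preadditive)
  have XB: "cxB X" using cxB_\<T>[OF X] .
  have M: "\<And>i. i \<in> I \<Longrightarrow> cxB (M i)" using coproductD(2)[OF P'] by (simp add: K_Ob)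
  obtain P \<iota> where PB: "cxB P" and P: "cpt_coproduct I M P \<iota>" using ex_cpt_coproduct[of I M] I M by blast
  note PD = cpt_coproductD[OF P]
  have KP: "coproduct K I M P (\<lambda>i. cls (M i) P (\<iota> i))" by (rule K_coproduct[OF P PB]) (rule M)
  obtain a b where a: "a \<in> Hom K P P'" and b: "b \<in> Hom K P' P" and ab: "a \<cdot>\<^bsub>K\<^esub> b = Id K P'"
    and a\<iota>: "\<forall>i\<in>I. a \<cdot>\<^bsub>K\<^esub> cls (M i) P (\<iota> i) = \<iota>' i"
    using K.coproduct_unique[OF KP P'] by blast
  obtain f where f: "f \<in> chain_maps C X P" "b \<cdot>\<^bsub>K\<^esub> u = cls X P f"
    using K.comp_hom[OF b u] by (rule K_HomE) (rule that)
  obtain N f' Q \<nu> g h where N: "\<And>i. i \<in> I \<Longrightarrow> N i \<in> complexes C \<T>" "\<And>i. i \<in> I \<Longrightarrow> f' i \<in> chain_maps C (N i) (M i)"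
    and Q: "cxB Q" "cpt_coproduct I N Q \<nu>" and g: "g \<in> chain_maps C X Q" and h: "h \<in> chain_maps C Q P"
    and h\<nu>: "\<And>i n. i \<in> I \<Longrightarrow> h n \<cdot> \<nu> i n = \<iota> i n \<cdot> f' i n" and fhg: "\<And>n. f n = h n \<cdot> g n"
    using chain_map_factor[OF X I _ P f(1)] M by (smt (verit))
  have NB: "\<And>i. i \<in> I \<Longrightarrow> cxB (N i)" using cxB_\<T>[OF N(1)] .
  note QD = cpt_coproductD[OF Q(2)]
  have KQ: "coproduct K I N Q (\<lambda>i. cls (N i) Q (\<nu> i))" by (rule K_coproduct[OF Q(2,1) NB])
  note hK = K_HomI[OF Q(1) PB h] and gK = K_HomI[OF XB Q(1) g]
  have "(a \<cdot>\<^bsub>K\<^esub> cls Q P h) \<cdot>\<^bsub>K\<^esub> cls (N i) Q (\<nu> i) = \<iota>' i \<cdot>\<^bsub>K\<^esub> cls (N i) (M i) (f' i)" if i: "i \<in> I" for i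
  proof -
    note \<nu>K = K_HomI[OF NB[OF i] Q(1) QD(3)[OF i]] and \<iota>K = K_HomI[OF M[OF i] PB PD(3)[OF i]]
      and f'K = K_HomI[OF NB[OF i] M[OF i] N(2)[OF i]]
    have "cls Q P h \<cdot>\<^bsub>K\<^esub> cls (N i) Q (\<nu> i) = cls (M i) P (\<iota> i) \<cdot>\<^bsub>K\<^esub> cls (N i) (M i) (f' i)"
      using K_comp[OF NB[OF i] Q(1) PB h QD(3)[OF i]] K_comp[OF NB[OF i] M[OF i] PB PD(3)[OF i] N(2)[OF i]]
        h\<nu>[OF i] by simp
    then show ?thesis
      using K.comp_assoc[OF a hK \<nu>K] K.comp_assoc[OF a \<iota>K f'K] a\<iota> i by simp
  qed
  moreover have "u = (a \<cdot>\<^bsub>K\<^esub> cls Q P h) \<cdot>\<^bsub>K\<^esub> cls X Q g"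
  proof -
    have "(a \<cdot>\<^bsub>K\<^esub> cls Q P h) \<cdot>\<^bsub>K\<^esub> cls X Q g = a \<cdot>\<^bsub>K\<^esub> cls X P f"
      using K.comp_assoc[OF a hK gK] K_comp[OF XB Q(1) PB h g] by (simp flip: fhg)
    also have "\<dots> = (a \<cdot>\<^bsub>K\<^esub> b) \<cdot>\<^bsub>K\<^esub> u" unfolding f(2)[symmetric] by (rule K.comp_assoc[OF a b u, symmetric])
    also have "\<dots> = u" unfolding ab by (rule K.id_left[OF u])
    finally show ?thesis by simp
  qed
  ultimately show ?thesis
    using N NB M K_HomI KQ gK K.comp_hom[OF a hK]
    by (intro exI[of _ N] exI[of _ "\<lambda>i. cls (N i) (M i) (f' i)"] exI[of _ Q]
        exI[of _ "\<lambda>i. cls (N i) Q (\<nu> i)"] exI[of _ "cls X Q g"] exI[of _ "a \<cdot>\<^bsub>K\<^esub> cls Q P h"]) simp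
qed

lemma K_well_generated_by:
  assumes "locally_small U C" "small U \<T>" and \<kappa>: "|T| <o \<kappa>"
  shows "well_generated_by U \<kappa> K (complexes C \<T>)"
  unfolding well_generated_by_def
proof (intro conjI ballI allI impI)
  interpret K: preadditive_category K by (rule K_preadditive)
  show "additive_category K" by (rule K_additive)
  show "has_coproducts U K" by (rule K_has_coproducts)
  show "complexes C \<T> \<subseteq> Ob K" using cxB_\<T> by (auto simp: K_Ob)
  show "small U (complexes C \<T>)"
    by (rule small_complexes[OF inaccessible assms(1) _ assms(2)]) (use \<T>_B B_ob in blast)
  show "small_rel_split_monos U \<kappa> K X" if "X \<in> complexes C \<T>" for X
    by (rule K.small_rel_split_monosI[OF inaccessible K_has_coproducts K_coproduct_small[OF that] \<kappa>])
  show "\<exists>X\<in>complexes C \<T>. \<exists>f\<in>Hom K X M. f \<noteq> hom_zero K X M" if M: "M \<in> Ob K" "\<not> zero_object K M" for M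
  proof (rule ccontr)
    assume no: "\<not> ?thesis"
    have MB: "cxB M" using M by (simp add: K_Ob)
    have "null_homotopic X M f" if "X \<in> complexes C \<T>" "f \<in> chain_maps C X M" for X f
      using no that K_HomI[OF cxB_\<T> MB] K_cls_zero_iff[OF cxB_\<T> MB] by blast
    then have "zero_object K M" using zero_if_orthogonal[OF MB] K_zero_object_iff[OF MB] by blast
    with M(2) show False by blast
  qed
  fix X I M P \<iota> f
  assume "X \<in> complexes C \<T>" "f \<in> Hom K X P" "small U (I :: 'u set) \<and> coproduct K I M P \<iota>"
  then show "\<exists>N f' Q \<iota>' g h. (\<forall>i\<in>I. N i \<in> complexes C \<T> \<and> f' i \<in> Hom K (N i) (M i)) \<and>
      coproduct K I N Q \<iota>' \<and> g \<in> Hom K X Q \<and> h \<in> Hom K Q P \<and>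
      (\<forall>i\<in>I. h \<cdot>\<^bsub>K\<^esub> \<iota>' i = \<iota> i \<cdot>\<^bsub>K\<^esub> f' i) \<and> f = h \<cdot>\<^bsub>K\<^esub> g"
    using K_factor[of X I M P \<iota> f] by blast
qed

end

section \<open>Well generation from a set \<open>S\<close>\<close>

lemma (in homotopy_cat_coproducts) K_well_generated:
  assumes acc: "accessible U C" and ls: "locally_small U C"
    and S: "S \<subseteq> B" "small U S" "B \<subseteq> Add U C S"
  shows "well_generated U K"
proof -
  obtain T :: "'u set" where T: "small U T" "infinite T" "\<forall>X\<in>S. coproduct_small U T X"
    using ex_uniform_coproduct_small[OF inaccessible acc S(2)] S(1) B_ob by blast
  obtain \<T> where \<T>: "\<T> \<subseteq> B" "small U \<T>"
    "\<forall>P\<in>\<T>. \<exists>(I :: 'u set) N \<iota>. |I| \<le>o |T| \<and> (\<forall>i\<in>I. N i \<in> S) \<and> coproduct C I N P \<iota>"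
    "\<forall>(I :: 'u set) N. |I| \<le>o |T| \<and> (\<forall>i\<in>I. N i \<in> S) \<longrightarrow> (\<exists>P\<in>\<T>. \<exists>\<iota>. coproduct C I N P \<iota>)"
    using ex_small_set_of_coproducts[OF S(2,1) T(1)] by blast
  obtain \<kappa> :: "'u rel" where \<kappa>: "regular_cardinal \<kappa>" "\<kappa> <o U" "|T| <o \<kappa>"
    using ex_regular_cardinal_above[OF inaccessible T(1,2)] by blast
  interpret small_generators C B U S T \<T>
    by unfold_locales (use S T \<T> in blast)+
  show ?thesis
    unfolding well_generated_def using \<kappa> K_well_generated_by[OF ls \<T>(2) \<kappa>(3)] by blast
qed

section \<open>Splitting idempotents\<close>

text \<open>The colimit of \<open>P \<rightarrow> P \<rightarrow> \<dots>\<close> with all maps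
  equal to \<open>e\<close> splits \<open>e\<close>. The sequence has length \<kappa>, because only
  \<kappa>-directed colimits are available and a regular cardinal is \<kappa>-directed as a
  poset.\<close>

lemma (in preadditive_category) idempotents_split:
  fixes \<kappa> :: "'u rel"
  assumes \<kappa>: "regular_cardinal \<kappa>" "\<kappa> <o U" and acc: "accessible_at U \<kappa> C"
    and e: "e \<in> Hom C P P" "e \<cdot> e = e"
  shows "\<exists>L. \<exists>h\<in>Hom C L P. \<exists>k\<in>Hom C P L. h \<cdot> k = e \<and> k \<cdot> h = Id C L"
proof -
  have \<kappa>': "Card_order \<kappa>" "infinite (Field \<kappa>)" "regularCard \<kappa>" "\<kappa> =o |Field \<kappa>|"
    using \<kappa>(1) card_of_Field_ordIso ordIso_symmetric
    by (auto simp: regular_cardinal_def cinfinite_def)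
  have wo: "Well_order \<kappa>" using \<kappa>'(1) card_order_on_well_order_on by blast
  note W = Well_orderD[OF wo]
  have F: "(i, j) \<in> \<kappa> \<Longrightarrow> i \<in> Field \<kappa> \<and> j \<in> Field \<kappa>" for i j by (auto simp: Field_def)
  have P: "P \<in> Ob C" using Hom_ob[OF e(1)] by blast
  note eD = HomD[OF e(1)]
  have small: "small U (Field \<kappa>)"
    using \<kappa>(2) \<kappa>'(4) ordIso_ordLess_trans ordIso_symmetric unfolding small_def by blast
  have po: "Partial_order \<kappa>"
    using wo by (simp add: well_order_on_def linear_order_on_def)
  have dir: "directed_poset \<kappa> \<kappa>"
    unfolding directed_poset_def
  proof (intro conjI po allI impI)
    fix S assume S: "S \<subseteq> Field \<kappa>" "|S| <o \<kappa>"
    \<comment> \<open>Regularity says that every cofinal subset has full size. Failure of strict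
      cofinality yields \<open>u\<close> with no element of \<open>S\<close> strictly above it,
      hence an upper bound.\<close>
    have "\<not> cofinal S \<kappa>"
      using \<kappa>'(3) S not_ordLess_ordIso unfolding regularCard_def by blast
    then obtain u where u: "u \<in> Field \<kappa>" "\<forall>b\<in>S. \<not> (u \<noteq> b \<and> (u, b) \<in> \<kappa>)"
      unfolding cofinal_def by blast
    then have "(s, u) \<in> \<kappa>" if "s \<in> S" for s
      using that W(3)[of s u] W(4)[of u] S(1) by (metis subsetD)
    then show "\<exists>u\<in>Field \<kappa>. \<forall>s\<in>S. (s, u) \<in> \<kappa>" using u(1) by blast
  qed
  define t where "t i j = (if i = j then Id C P else e)" for i j :: 'u
  have sys: "direct_system C \<kappa> (\<lambda>_. P) t"
    unfolding direct_system_def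
  proof (intro conjI po ballI allI impI)
    fix i j k assume "(i, j) \<in> \<kappa> \<and> (j, k) \<in> \<kappa>"
    then have "i = k \<Longrightarrow> i = j" using W(5) by blast
    then show "t j k \<cdot> t i j = t i k" using e(2) eD P by (auto simp: t_def)
  qed (use P e id_hom[OF P] in \<open>auto simp: t_def\<close>)
  have "\<exists>L \<iota>. colimit C \<kappa> (\<lambda>_. P) t L \<iota>"
    using acc small dir sys unfolding accessible_at_def by blast
  then obtain L \<iota> where col: "colimit C \<kappa> (\<lambda>_. P) t L \<iota>" by blast
  have cc: "cocone C \<kappa> (\<lambda>_. P) t L \<iota>" using col by (simp add: colimit_def)
  note cD = coconeD[OF cc]
  \<comment> \<open>An infinite cardinal has no last element. So each leg of the cocone is also
    reached through an arrow \<open>e\<close>; it absorbs \<open>e\<close>, and all legs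
    coincide.\<close>
  have next_ex: "\<exists>j. (i, j) \<in> \<kappa> \<and> i \<noteq> j" if "i \<in> Field \<kappa>" for i
    using infinite_Card_order_limit[OF \<kappa>'(1,2) that] by blast
  have \<iota>e: "\<iota> j \<cdot> e = \<iota> i" if "(i, j) \<in> \<kappa>" "i \<noteq> j" for i j
    using cD(3)[OF that(1)] that(2) by (simp add: t_def)
  have \<iota>e': "\<iota> i \<cdot> e = \<iota> i" if i: "i \<in> Field \<kappa>" for i
  proof -
    obtain j where j: "(i, j) \<in> \<kappa>" "i \<noteq> j" using next_ex[OF i] by blast
    have "\<iota> i \<cdot> e = \<iota> j \<cdot> e \<cdot> e"
      using \<iota>e[OF j] comp_assoc[OF cD(2) e(1) e(1), of j] F[OF j(1)] by metis
    then show ?thesis using \<iota>e[OF j] e(2) by simp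
  qed
  have eq: "\<iota> i = \<iota> j" if "i \<in> Field \<kappa>" "j \<in> Field \<kappa>" for i j
    using W(3)[OF that] \<iota>e \<iota>e' that by metis
  have "cocone C \<kappa> (\<lambda>_. P) t P (\<lambda>_. e)"
    unfolding cocone_def using P e eD by (auto simp: t_def)
  then obtain h where h: "h \<in> Hom C L P" "\<forall>i\<in>Field \<kappa>. h \<cdot> \<iota> i = e" using colimit_map[OF col] by blast
  obtain i where i: "i \<in> Field \<kappa>" using \<kappa>'(2) by fastforce
  have "\<iota> i \<cdot> h = Id C L"
  proof (rule colimit_eqI[OF sys col comp_hom[OF cD(2)[OF i] h(1)] id_hom[OF cD(1)]])
    fix j assume j: "j \<in> Field \<kappa>"
    show "(\<iota> i \<cdot> h) \<cdot> \<iota> j = Id C L \<cdot> \<iota> j"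
      using comp_assoc[OF cD(2)[OF i] h(1) cD(2)[OF j]] h(2) j \<iota>e'[OF i] eq[OF i j] id_left[OF cD(2)[OF j]] by simp
  qed
  then show ?thesis using h i cD(2)[OF i] by (intro exI[of _ L] bexI[of _ h] bexI[of _ "\<iota> i"]) auto
qed

section \<open>Shifts and cones\<close>

context preadditive_category
begin

text \<open>The sign of the differential is -1 for every \<open>k\<close>, which is the usual
  convention for odd \<open>k\<close>; the construction takes \<open>k\<close> to be 1 or
  -1.\<close>

definition shift :: "int \<Rightarrow> ('o, 'm) cochain \<Rightarrow> ('o, 'm) cochain" where
  "shift k X = \<lparr>cpt = \<lambda>n. cpt X (n + k), diff = \<lambda>n. neg (diff X (n + k))\<rparr>"

lemma shift_simps [simp]: "cpt (shift k X) n = cpt X (n + k)" "diff (shift k X) n = neg (diff X (n + k))"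
  by (simp_all add: shift_def)

lemma shift_complexes:
  assumes "X \<in> complexes C B" "B \<subseteq> Ob C"
  shows "shift k X \<in> complexes C B"
proof -
  note D = cxD[OF complexes_mono[OF assms(2,1)]]
  have e: "n + 1 + k = n + k + 1" "n + 2 + k = n + k + 2" for n by simp_all
  show ?thesis
    unfolding complexes_def mem_Collect_eq shift_simps e using D complexes_cpt[OF assms(1)] by (simp add: Hom_iff)
qed

lemma shift_cx: "cx X \<Longrightarrow> cx (shift k X)"
  using shift_complexes by blast

lemma chain_map_shift:
  assumes "cx X" "cx Y" "f \<in> chain_maps C X Y"
  shows "(\<lambda>n. f (n + k)) \<in> chain_maps C (shift k X) (shift k Y)"
proof (rule chain_mapI)
  note D = cxD[OF assms(1)] cxD[OF assms(2)] chain_mapD[OF assms(3)]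
  show "f (n + k) \<in> Hom C (cpt (shift k X) n) (cpt (shift k Y) n)" for n using D by simp
  have e: "n + 1 + k = n + k + 1" for n by simp
  show "f (n + 1 + k) \<cdot> diff (shift k X) n = diff (shift k Y) n \<cdot> f (n + k)" for n
    unfolding shift_simps e using D by simp
qed

lemma chain_map_unshift:
  assumes "cx X" "cx Y" "f \<in> chain_maps C X (shift 1 Y)"
  shows "(\<lambda>n. f (n - 1)) \<in> chain_maps C (shift (- 1) X) Y"
proof (rule chain_mapI)
  note D = cxD[OF assms(1)] cxD[OF assms(2)] chain_mapD(1-4)[OF assms(3), simplified]
  fix n
  show "f (n - 1) \<in> Hom C (cpt (shift (- 1) X) n) (cpt Y n)" using D(13)[of "n - 1"] D by (simp add: Hom_iff)
  have "f n \<cdot> diff X (n - 1) = neg (diff Y n \<cdot> f (n - 1))"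
    using chain_mapD(5)[OF assms(3), of "n - 1"] D by simp
  then show "f (n + 1 - 1) \<cdot> diff (shift (- 1) X) n = diff Y n \<cdot> f (n - 1)"
    using D by simp
qed

text \<open>Reindexing a homotopy between the shifted complexes changes its sign, as the
  differentials change theirs.\<close>

lemma null_homotopic_shift:
  assumes "cx X" "cx Y" "null_homotopic (shift (- 1) X) Y f"
  shows "null_homotopic X (shift 1 Y) (\<lambda>n. f (n + 1))"
proof -
  obtain s where s: "\<And>n. s n \<in> Hom C (cpt (shift (- 1) X) n) (cpt Y (n - 1))"
    "\<And>n. f n = (diff Y (n - 1) \<cdot> s n) \<^bold>+ (s (n + 1) \<cdot> diff (shift (- 1) X) n)"
    using assms(3) by (rule null_homotopicE) (rule that)
  note D = cxD[OF assms(1)] cxD[OF assms(2)] HomD[OF s(1), simplified]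
  have s1: "s (n + 1) \<in> Hom C (cpt X n) (cpt Y n)" for n using s(1)[of "n + 1"] by simp
  note E = D HomD[OF s1]
  show ?thesis
  proof (rule null_homotopicI[of "\<lambda>n. neg (s (n + 1))"])
    fix n
    show "neg (s (n + 1)) \<in> Hom C (cpt X n) (cpt (shift 1 Y) (n - 1))" using E by (simp add: Hom_iff)
    have "f (n + 1) = (diff Y n \<cdot> s (n + 1)) \<^bold>+ neg (s (n + 1 + 1) \<cdot> diff X n)"
      unfolding s(2)[of "n + 1"] using E HomD[OF s1[of "n + 1"]] by simp
    then show "f (n + 1) = (diff (shift 1 Y) (n - 1) \<cdot> neg (s (n + 1))) \<^bold>+ (neg (s (n + 1 + 1)) \<cdot> diff X n)"
      using E HomD[OF s1[of "n + 1"]] by simp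
  qed
qed

lemma cpt_coproduct_shift:
  assumes "cpt_coproduct I M P \<iota>"
  shows "cpt_coproduct I (\<lambda>i. shift k (M i)) (shift k P) (\<lambda>i n. \<iota> i (n + k))"
  unfolding cpt_coproduct_def
  using cpt_coproductD[OF assms] shift_cx chain_map_shift by simp

text \<open>The mapping cone of \<open>\<phi>\<close>. In degree n it is the biproduct of
  \<open>cpt Q (n + 1)\<close> (inclusion \<open>a\<close>, projection \<open>p\<close>) and
  \<open>cpt W n\<close> (inclusion \<open>b\<close>, projection \<open>q\<close>); the differential
  is the triangular matrix with diagonal entries \<open>- diff Q\<close> and \<open>diff W\<close>
  and off-diagonal entry \<open>\<phi>\<close>. It is a predicate because biproducts are not
  chosen.\<close>

definition is_cone where
  "is_cone Q W \<phi> Z a b p q \<longleftrightarrow> cx Z \<and>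
     (\<forall>n. a n \<in> Hom C (cpt Q (n + 1)) (cpt Z n)) \<and> (\<forall>n. b n \<in> Hom C (cpt W n) (cpt Z n)) \<and>
     (\<forall>n. p n \<in> Hom C (cpt Z n) (cpt Q (n + 1))) \<and> (\<forall>n. q n \<in> Hom C (cpt Z n) (cpt W n)) \<and>
     (\<forall>n. p n \<cdot> a n = Id C (cpt Q (n + 1))) \<and> (\<forall>n. q n \<cdot> b n = Id C (cpt W n)) \<and>
     (\<forall>n. (a n \<cdot> p n) \<^bold>+ (b n \<cdot> q n) = Id C (cpt Z n)) \<and>
     (\<forall>n. diff Z n = (b (n + 1) \<cdot> \<phi> (n + 1) \<cdot> p n) \<^bold>+
        (neg (a (n + 1) \<cdot> diff Q (n + 1) \<cdot> p n) \<^bold>+ (b (n + 1) \<cdot> diff W n \<cdot> q n)))"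

lemma is_coneD:
  assumes "is_cone Q W \<phi> Z a b p q"
  shows "cx Z" "a n \<in> Hom C (cpt Q (n + 1)) (cpt Z n)" "b n \<in> Hom C (cpt W n) (cpt Z n)"
    "p n \<in> Hom C (cpt Z n) (cpt Q (n + 1))" "q n \<in> Hom C (cpt Z n) (cpt W n)"
    "p n \<cdot> a n = Id C (cpt Q (n + 1))" "q n \<cdot> b n = Id C (cpt W n)"
    "(a n \<cdot> p n) \<^bold>+ (b n \<cdot> q n) = Id C (cpt Z n)"
    "diff Z n = (b (n + 1) \<cdot> \<phi> (n + 1) \<cdot> p n) \<^bold>+
        (neg (a (n + 1) \<cdot> diff Q (n + 1) \<cdot> p n) \<^bold>+ (b (n + 1) \<cdot> diff W n \<cdot> q n))"
    "p n \<cdot> b n = zr (cpt W n) (cpt Q (n + 1))" "q n \<cdot> a n = zr (cpt Q (n + 1)) (cpt W n)"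
    "coproduct C UNIV (case_bool (cpt Q (n + 1)) (cpt W n)) (cpt Z n) (case_bool (a n) (b n))"
proof -
  show *: "cx Z" "a n \<in> Hom C (cpt Q (n + 1)) (cpt Z n)" "b n \<in> Hom C (cpt W n) (cpt Z n)"
    "p n \<in> Hom C (cpt Z n) (cpt Q (n + 1))" "q n \<in> Hom C (cpt Z n) (cpt W n)"
    "p n \<cdot> a n = Id C (cpt Q (n + 1))" "q n \<cdot> b n = Id C (cpt W n)"
    "(a n \<cdot> p n) \<^bold>+ (b n \<cdot> q n) = Id C (cpt Z n)"
    "diff Z n = (b (n + 1) \<cdot> \<phi> (n + 1) \<cdot> p n) \<^bold>+
        (neg (a (n + 1) \<cdot> diff Q (n + 1) \<cdot> p n) \<^bold>+ (b (n + 1) \<cdot> diff W n \<cdot> q n))"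
    using assms unfolding is_cone_def by blast+
  show "p n \<cdot> b n = zr (cpt W n) (cpt Q (n + 1))" "q n \<cdot> a n = zr (cpt Q (n + 1)) (cpt W n)"
    "coproduct C UNIV (case_bool (cpt Q (n + 1)) (cpt W n)) (cpt Z n) (case_bool (a n) (b n))"
    using biproduct_coproduct[OF *(2-8)] by blast+
qed

lemma cone_diff:
  assumes c: "is_cone Q W \<phi> Z a b p q" and Q: "cx Q" and W: "cx W" and \<phi>: "\<phi> \<in> chain_maps C Q W"
  shows "diff Z n \<cdot> a n = (b (n + 1) \<cdot> \<phi> (n + 1)) \<^bold>+ neg (a (n + 1) \<cdot> diff Q (n + 1))"
    "diff Z n \<cdot> b n = b (n + 1) \<cdot> diff W n"
    "p (n + 1) \<cdot> diff Z n = neg (diff Q (n + 1) \<cdot> p n)"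
    "q (n + 1) \<cdot> diff Z n = (\<phi> (n + 1) \<cdot> p n) \<^bold>+ (diff W n \<cdot> q n)"
proof -
  note cD = is_coneD[OF c]
  note D = HomD[OF cD(2)] HomD[OF cD(3)] HomD[OF cD(4)] HomD[OF cD(5)] cxD[OF Q] cxD[OF W] chain_mapD[OF \<phi>]
    cxD(1)[OF cD(1)]
  have pa: "p m \<cdot> a m \<cdot> k = k" if "k \<in> Arr C" "Cod C k = cpt Q (m + 1)" for k m
    using comp_reduce[OF cD(6)[of m], of k] that D by simp
  have qb: "q m \<cdot> b m \<cdot> k = k" if "k \<in> Arr C" "Cod C k = cpt W m" for k m
    using comp_reduce[OF cD(7)[of m], of k] that D by simp
  have pb: "p m \<cdot> b m \<cdot> k = zr (Dom C k) (cpt Q (m + 1))" if "k \<in> Arr C" "Cod C k = cpt W m" for k m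
    using comp_reduce[OF cD(10)[of m], of k] that D by simp
  have qa: "q m \<cdot> a m \<cdot> k = zr (Dom C k) (cpt W m)" if "k \<in> Arr C" "Cod C k = cpt Q (m + 1)" for k m
    using comp_reduce[OF cD(11)[of m], of k] that D by simp
  show "diff Z n \<cdot> a n = (b (n + 1) \<cdot> \<phi> (n + 1)) \<^bold>+ neg (a (n + 1) \<cdot> diff Q (n + 1))"
    "diff Z n \<cdot> b n = b (n + 1) \<cdot> diff W n"
    "p (n + 1) \<cdot> diff Z n = neg (diff Q (n + 1) \<cdot> p n)"
    "q (n + 1) \<cdot> diff Z n = (\<phi> (n + 1) \<cdot> p n) \<^bold>+ (diff W n \<cdot> q n)"
    unfolding cD(9) using D cD(6,7,10,11) pa pb qa qb by simp_all
qed

text \<open>The null homotopy is \<open>a\<close>, lowered by one degree: the column of the cone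
  differential over \<open>Q\<close> says exactly this.\<close>

lemma cone_null_homotopic:
  assumes c: "is_cone Q W \<phi> Z a b p q" and Q: "cx Q" and W: "cx W" and \<phi>: "\<phi> \<in> chain_maps C Q W"
  shows "b \<in> chain_maps C W Z" "null_homotopic Q Z (\<lambda>n. b n \<cdot> \<phi> n)"
proof -
  note cD = is_coneD[OF c] and dZ = cone_diff[OF assms]
  note D = HomD[OF cD(2)] HomD[OF cD(3)] cxD[OF Q] cxD[OF W] chain_mapD[OF \<phi>] cxD[OF cD(1)]
  show "b \<in> chain_maps C W Z" by (rule chain_mapI) (use cD(3) dZ(2) in simp_all)
  show "null_homotopic Q Z (\<lambda>n. b n \<cdot> \<phi> n)"
  proof (rule null_homotopicI[of "\<lambda>n. a (n - 1)"])
    show "a (n - 1) \<in> Hom C (cpt Q n) (cpt Z (n - 1))" for n using cD(2)[of "n - 1"] by simp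
    have "diff Z (n - 1) \<cdot> a (n - 1) = (b n \<cdot> \<phi> n) \<^bold>+ neg (a n \<cdot> diff Q n)" for n
      using dZ(1)[of "n - 1"] by simp
    then show "b n \<cdot> \<phi> n = (diff Z (n - 1) \<cdot> a (n - 1)) \<^bold>+ (a (n + 1 - 1) \<cdot> diff Q n)" for n
      using D by (simp add: add_assoc)
  qed
qed

end

context homotopy_cat_coproducts
begin

lemma ex_cone:
  assumes Q: "cxB Q" and W: "cxB W" and \<phi>: "\<phi> \<in> chain_maps C Q W"
  shows "\<exists>Z a b p q. cxB Z \<and> is_cone Q W \<phi> Z a b p q"
proof -
  note QD = cxD[OF cxB_cx[OF Q]] and WD = cxD[OF cxB_cx[OF W]] and \<phi>D = chain_mapD[OF \<phi>]
  interpret additive_category C using additive_categoryI[OF inaccessible has_coproducts] .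
  have "\<exists>Z a b p q. a \<in> Hom C (cpt Q (n + 1)) Z \<and> b \<in> Hom C (cpt W n) Z \<and>
      p \<in> Hom C Z (cpt Q (n + 1)) \<and> q \<in> Hom C Z (cpt W n) \<and>
      p \<cdot> a = Id C (cpt Q (n + 1)) \<and> q \<cdot> b = Id C (cpt W n) \<and> (a \<cdot> p) \<^bold>+ (b \<cdot> q) = Id C Z" for n
    using biproducts[OF QD(1) WD(1), of "n + 1" n] unfolding biproduct_def by blast
  then obtain Z a b p q where a: "\<And>n. a n \<in> Hom C (cpt Q (n + 1)) (Z n)" and b: "\<And>n. b n \<in> Hom C (cpt W n) (Z n)"
    and p: "\<And>n. p n \<in> Hom C (Z n) (cpt Q (n + 1))" and q: "\<And>n. q n \<in> Hom C (Z n) (cpt W n)"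
    and pa: "\<And>n. p n \<cdot> a n = Id C (cpt Q (n + 1))" and qb: "\<And>n. q n \<cdot> b n = Id C (cpt W n)"
    and sum: "\<And>n. (a n \<cdot> p n) \<^bold>+ (b n \<cdot> q n) = Id C (Z n)" by metis
  note bc = biproduct_coproduct[OF a b p q pa qb sum]
  have ZB: "Z n \<in> B" for n
    by (rule closed_under_coproductsD[OF inaccessible category_axioms closed_B bc(3)])
      (use complexes_cpt[OF Q] complexes_cpt[OF W] in \<open>auto intro: small_finite[OF inaccessible] split: bool.split\<close>)
  then have Zob: "Z n \<in> Ob C" for n using B_ob by blast
  define d where "d n = (b (n + 1) \<cdot> \<phi> (n + 1) \<cdot> p n) \<^bold>+
        (neg (a (n + 1) \<cdot> diff Q (n + 1) \<cdot> p n) \<^bold>+ (b (n + 1) \<cdot> diff W n \<cdot> q n))" for n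
  note D = HomD[OF a] HomD[OF b] HomD[OF p] HomD[OF q] QD WD \<phi>D Zob
  have pa': "p m \<cdot> a m \<cdot> k = k" if "k \<in> Arr C" "Cod C k = cpt Q (m + 1)" for k m
    using comp_reduce[OF pa[of m], of k] that D by simp
  have qb': "q m \<cdot> b m \<cdot> k = k" if "k \<in> Arr C" "Cod C k = cpt W m" for k m
    using comp_reduce[OF qb[of m], of k] that D by simp
  have pb': "p m \<cdot> b m \<cdot> k = zr (Dom C k) (cpt Q (m + 1))" if "k \<in> Arr C" "Cod C k = cpt W m" for k m
    using comp_reduce[OF bc(1)[of m], of k] that D by simp
  have qa': "q m \<cdot> a m \<cdot> k = zr (Dom C k) (cpt W m)" if "k \<in> Arr C" "Cod C k = cpt Q (m + 1)" for k m
    using comp_reduce[OF bc(2)[of m], of k] that D by simp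
  have dd: "diff W (m + 1) \<cdot> diff W m \<cdot> k = zr (Dom C k) (cpt W (m + 2))"
    if "k \<in> Arr C" "Cod C k = cpt W m" for k m
    using cx_diff_diff[OF cxB_cx[OF W] that] .
  have dd': "diff Q (m + 2) \<cdot> diff Q (m + 1) \<cdot> k = zr (Dom C k) (cpt Q (m + 3))"
    if "k \<in> Arr C" "Cod C k = cpt Q (m + 1)" for k m
    using cx_diff_diff[OF cxB_cx[OF Q] that] by simp
  have cm: "\<phi> (m + 2) \<cdot> diff Q (m + 1) \<cdot> k = diff W (m + 1) \<cdot> \<phi> (m + 1) \<cdot> k"
    if "k \<in> Arr C" "Cod C k = cpt Q (m + 1)" for k m
    using chain_map_comm_comp[OF \<phi> cxB_cx[OF Q] cxB_cx[OF W] that] by simp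
  have "p (n + 1) \<cdot> d n = neg (diff Q (n + 1) \<cdot> p n)"
    "q (n + 1) \<cdot> d n = (\<phi> (n + 1) \<cdot> p n) \<^bold>+ (diff W n \<cdot> q n)" for n
    unfolding d_def using D pa' qb' pb' qa' by simp_all
  note pd = this
  have dA: "d n \<in> Hom C (Z n) (Z (n + 1))" for n using D by (simp add: d_def Hom_iff)
  note dD = HomD[OF dA]
  have "d (n + 1) \<cdot> d n = zr (Z n) (Z (n + 2))" for n
  proof -
    have "d (n + 1) \<cdot> d n = (b (n + 2) \<cdot> \<phi> (n + 2) \<cdot> p (n + 1) \<cdot> d n) \<^bold>+
        (neg (a (n + 2) \<cdot> diff Q (n + 2) \<cdot> p (n + 1) \<cdot> d n) \<^bold>+
        (b (n + 2) \<cdot> diff W (n + 1) \<cdot> q (n + 1) \<cdot> d n))"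
      unfolding d_def[of "n + 1"] using D dD by simp
    also have "\<dots> = zr (Z n) (Z (n + 2))"
      unfolding pd using D cm dd dd' by simp
    finally show ?thesis .
  qed
  then have "cxB \<lparr>cpt = Z, diff = d\<rparr>" using ZB dA by (simp add: complexes_def)
  moreover from cxB_cx[OF this] have "is_cone Q W \<phi> \<lparr>cpt = Z, diff = d\<rparr> a b p q"
    unfolding is_cone_def using a b p q pa qb sum by (simp add: d_def)
  ultimately show ?thesis by blast
qed

end

section \<open>Complexes without maps from the generators\<close>

text \<open>By condition (3) a map from a generator to the coproduct factors through a coproduct of
  maps from generators to the summands, and on each of these \<open>c\<close> vanishes. The property
  of killing all maps from generators thus passes from the summands to the coproduct.\<close>

lemma (in preadditive_category) coproduct_of_phantoms:
  fixes I :: "'i set" and U :: "'u rel"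
  assumes U: "inaccessible U" and wg: "well_generated_by U \<kappa> C G" and I: "small U I"
    and P: "coproduct C I M P \<iota>" and c: "c \<in> Hom C P Z"
    and ph: "\<And>i N g. \<lbrakk>i \<in> I; N \<in> G; g \<in> Hom C N (M i)\<rbrakk> \<Longrightarrow> c \<cdot> \<iota> i \<cdot> g = zr N Z"
    and X: "X \<in> G" and u: "u \<in> Hom C X P"
  shows "c \<cdot> u = zr X Z"
proof -
  obtain \<phi> :: "'i \<Rightarrow> 'u" where \<phi>: "inj_on \<phi> I" using small_embed[OF U I] .
  define \<psi> where "\<psi> = inv_into I \<phi>"
  have \<psi>: "bij_betw \<psi> (\<phi> ` I) I"
    unfolding \<psi>_def using \<phi> by (simp add: bij_betw_imageI bij_betw_inv_into)
  then have \<psi>I: "\<psi> i \<in> I" if "i \<in> \<phi> ` I" for i using that by (auto simp: bij_betw_def)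
  have P': "coproduct C (\<phi> ` I) (M \<circ> \<psi>) P (\<iota> \<circ> \<psi>)"
    by (rule coproduct_reindex[OF P \<psi>]) simp_all
  have "\<exists>N f' Q \<iota>' g h. (\<forall>i\<in>\<phi> ` I. N i \<in> G \<and> f' i \<in> Hom C (N i) ((M \<circ> \<psi>) i)) \<and>
           coproduct C (\<phi> ` I) N Q \<iota>' \<and> g \<in> Hom C X Q \<and>
           h \<in> Hom C Q P \<and> (\<forall>i\<in>\<phi> ` I. h \<cdot> \<iota>' i = (\<iota> \<circ> \<psi>) i \<cdot> f' i) \<and> u = h \<cdot> g"
    using wg X u P' small_image[OF I, of \<phi>] unfolding well_generated_by_def by blast
  then obtain N f' Q \<iota>' g h where N: "\<forall>i\<in>\<phi> ` I. N i \<in> G \<and> f' i \<in> Hom C (N i) (M (\<psi> i))"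
    and Q: "coproduct C (\<phi> ` I) N Q \<iota>'" and g: "g \<in> Hom C X Q" and h: "h \<in> Hom C Q P"
    and h\<iota>: "\<forall>i\<in>\<phi> ` I. h \<cdot> \<iota>' i = \<iota> (\<psi> i) \<cdot> f' i" and uhg: "u = h \<cdot> g"
    unfolding comp_apply by blast
  have Z: "Z \<in> Ob C" using Hom_ob[OF c] by blast
  note QD = coproductD[OF Q] and PD = coproductD[OF P]
  have "c \<cdot> h = zr Q Z"
  proof (rule coproduct_eqI[OF Q comp_hom[OF c h] Hom_simps(1)[OF QD(1) Z] Z category_axioms])
    fix i assume i: "i \<in> \<phi> ` I"
    have f'i: "f' i \<in> Hom C (N i) (M (\<psi> i))" and Ni: "N i \<in> G" using N i by blast+
    have "(c \<cdot> h) \<cdot> \<iota>' i = c \<cdot> \<iota> (\<psi> i) \<cdot> f' i"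
      using comp_assoc[OF c h QD(3)[OF i]] h\<iota> i by simp
    also have "\<dots> = zr (N i) Z" by (rule ph[OF \<psi>I[OF i] Ni f'i])
    also have "\<dots> = zr Q Z \<cdot> \<iota>' i" using QD(4-6)[OF i] Z by simp
    finally show "(c \<cdot> h) \<cdot> \<iota>' i = zr Q Z \<cdot> \<iota>' i" .
  qed
  then have "(c \<cdot> h) \<cdot> g = zr X Z" using HomD[OF g] Z by simp
  then show ?thesis unfolding uhg using HomD[OF c] HomD[OF h] HomD[OF g] by simp
qed

lemma (in preadditive_category) add_conjugate_cancel:
  assumes "x \<in> Arr C" "y \<in> Arr C" "z \<in> Arr C" "Dom C x = Dom C y" "Cod C x = Cod C y"
    "Dom C y = Dom C z" "Cod C y = Cod C z"
  shows "((x \<^bold>+ y) \<^bold>+ z) \<^bold>+ neg x = z \<^bold>+ y"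
proof -
  have "((x \<^bold>+ y) \<^bold>+ z) \<^bold>+ neg x = (x \<^bold>+ neg x) \<^bold>+ (z \<^bold>+ y)"
    using assms by (simp add: add_ac del: add_neg add_neg_cancel)
  then show ?thesis using assms by simp
qed

section \<open>Cones that kill maps from the generators\<close>

context homotopy_cat_coproducts
begin

text \<open>Composition with \<open>b\<close> annihilates maps from \<open>G\<close> to
  \<open>W\<close> and to \<open>W[1]\<close> up to homotopy. Both are required to control maps into
  a cone, whose two summands in each degree come from these complexes.\<close>

definition kills where
  "kills G W W' b \<longleftrightarrow> (\<forall>N\<in>G.
     (\<forall>f\<in>chain_maps C N W. null_homotopic N W' (\<lambda>n. b n \<cdot> f n)) \<and>
     (\<forall>f\<in>chain_maps C N (shift 1 W). null_homotopic N (shift 1 W') (\<lambda>n. b (n + 1) \<cdot> f n)))"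

lemma small_chain_maps:
  assumes "locally_small U C" "cx X" "cx Y"
  shows "small U (chain_maps C X Y)"
proof (rule small_functions[OF inaccessible small_countable(2)[OF inaccessible]])
  show "small U (\<Union>n. Hom C (cpt X n) (cpt Y n))"
    by (rule small_UNION[OF inaccessible small_countable(2)[OF inaccessible]])
      (use assms cxD(1) in \<open>auto simp: locally_small_def\<close>)
  show "f n \<in> (\<Union>n. Hom C (cpt X n) (cpt Y n))" if "f \<in> chain_maps C X Y" for f n
    using chain_mapD(1)[OF that] by blast
qed auto

text \<open>\<open>W'\<close> is the cone of the universal map to \<open>W\<close> from a coproduct
  of generators and shifted generators, one summand for each chain map. Its part in degree m adds to
  \<open>W\<close> only components of generators from degree m + 1, so degree m remains a coproduct
  of objects of \<open>S\<close>. The retraction \<open>q\<close> of \<open>b\<close> exists only in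
  each degree.\<close>

lemma ex_killing_map:
  assumes ls: "locally_small U C" and G: "small U G" "\<And>N. N \<in> G \<Longrightarrow> cxB N"
    and W: "cxB W" "cpt W m \<in> coproducts_of U C S" and S: "\<And>N n. N \<in> G \<Longrightarrow> cpt N n \<in> S"
  shows "\<exists>W' b q. cxB W' \<and> cpt W' m \<in> coproducts_of U C S \<and> b \<in> chain_maps C W W' \<and>
    (\<forall>n. q n \<in> Hom C (cpt W' n) (cpt W n)) \<and> (\<forall>n. q n \<cdot> b n = Id C (cpt W n)) \<and> kills G W W' b"
proof -
  \<comment> \<open>A chain map from \<open>N\<close> to \<open>W[1]\<close> is the same as one from
    \<open>N[-1]\<close> to \<open>W\<close>.\<close>
  define G' where "G' = G \<union> shift (- 1) ` G"
  have G'B: "cxB N" if "N \<in> G'" for N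
    using that G(2) shift_complexes[OF _ B_ob] by (auto simp: G'_def)
  define I where "I = Sigma G' (\<lambda>N. chain_maps C N W)"
  note Wcx = cxB_cx[OF W(1)]
  have I: "small U I"
    unfolding I_def G'_def
    by (intro small_Sigma[OF inaccessible] small_Un[OF inaccessible] small_image G(1) small_chain_maps[OF ls _ Wcx])
      (use G'B cxB_cx in \<open>auto simp: G'_def\<close>)
  have IB: "cxB (fst i)" if "i \<in> I" for i using that G'B by (auto simp: I_def)
  obtain Q \<iota> where QB: "cxB Q" and Q: "cpt_coproduct I fst Q \<iota>"
    using ex_cpt_coproduct[of I fst] I IB by blast
  note QD = cpt_coproductD[OF Q]
  have "snd i \<in> chain_maps C (fst i) W" if "i \<in> I" for i using that by (auto simp: I_def)
  then obtain \<phi> where \<phi>: "\<phi> \<in> chain_maps C Q W" "\<forall>i\<in>I. \<forall>n. \<phi> n \<cdot> \<iota> i n = snd i n"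
    using cpt_coproduct_map[OF Q Wcx, of snd] by blast
  obtain W' a b p q where W'B: "cxB W'" and cone: "is_cone Q W \<phi> W' a b p q"
    using ex_cone[OF QB W(1) \<phi>(1)] by blast
  note W'cx = cxB_cx[OF W'B] and cD = is_coneD[OF cone]
  note b = cone_null_homotopic[OF cone QD(1) Wcx \<phi>(1)]
  have null: "null_homotopic N W' (\<lambda>n. b n \<cdot> f n)" if "N \<in> G'" "f \<in> chain_maps C N W" for N f
  proof -
    have i: "(N, f) \<in> I" using that by (simp add: I_def)
    have "null_homotopic N W' (\<lambda>n. (b n \<cdot> \<phi> n) \<cdot> \<iota> (N, f) n)"
      using null_homotopic_comp(2)[OF _ QD(1) W'cx _ b(2)] QD(2,3)[OF i] by simp
    moreover have "(b n \<cdot> \<phi> n) \<cdot> \<iota> (N, f) n = b n \<cdot> f n" for n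
      using \<phi>(2) i chain_mapD[OF b(1)] chain_mapD[OF \<phi>(1)] chain_mapD[OF QD(3)[OF i]] by simp
    ultimately show ?thesis by simp
  qed
  have "kills G W W' b"
    unfolding kills_def
  proof (intro ballI conjI)
    fix N f assume N: "N \<in> G"
    show "null_homotopic N W' (\<lambda>n. b n \<cdot> f n)" if "f \<in> chain_maps C N W"
      using null that N by (simp add: G'_def)
    assume f: "f \<in> chain_maps C N (shift 1 W)"
    have Ncx: "cx N" using cxB_cx[OF G(2)[OF N]] .
    have "null_homotopic (shift (- 1) N) W' (\<lambda>n. b n \<cdot> f (n - 1))"
      by (rule null[OF _ chain_map_unshift[OF Ncx Wcx f]]) (use N in \<open>simp add: G'_def\<close>)
    from null_homotopic_shift[OF Ncx W'cx this]
    show "null_homotopic N (shift 1 W') (\<lambda>n. b (n + 1) \<cdot> f n)" by simp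
  qed
  moreover have "cpt W' m \<in> coproducts_of U C S"
  proof (rule closed_under_coproductsD[OF inaccessible category_axioms
        closed_coproducts_of[OF inaccessible category_axioms] cD(12)])
    have "cpt (fst i) (m + 1) \<in> S" if "i \<in> I" for i
      using that S by (auto simp: I_def G'_def)
    then have "cpt Q (m + 1) \<in> coproducts_of U C S"
      by (intro coproducts_ofI[OF inaccessible category_axioms QD(4) I])
    then show "(case x of True \<Rightarrow> cpt Q (m + 1) | False \<Rightarrow> cpt W m) \<in> coproducts_of U C S" for x
      using W(2) by (simp split: bool.split)
  qed (rule small_finite[OF inaccessible], simp)
  ultimately show ?thesis using W'B b(1) cD(5,7) by blast
qed

text \<open>
  Since \<open>s\<close> kills the maps from \<open>N\<close> to \<open>V\<close> and \<open>V[1]\<close>, the map \<open>1 - s\<close> induces isomorphisms on them.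
\<close>

lemma cone_orthogonal:
  assumes N: "cx N" and V: "cx V" and s: "s \<in> chain_maps C V V"
    and cone: "is_cone V V (\<lambda>n. Id C (cpt V n) \<^bold>+ neg (s n)) Z a b p q"
    and kills: "kills {N} V V s" and f: "f \<in> chain_maps C N Z"
  shows "null_homotopic N Z f"
proof -
  define \<phi> where "\<phi> n = Id C (cpt V n) \<^bold>+ neg (s n)" for n
  have \<phi>: "\<phi> \<in> chain_maps C V V"
    unfolding \<phi>_def using chain_maps_closed[OF V V] chain_map_Id[OF V] s by blast
  note cone' = cone[folded \<phi>_def]
  note cD = is_coneD[OF cone'] and dZ = cone_diff[OF cone' V V \<phi>]
  note VD = cxD[OF V] and ND = cxD[OF N] and sD = chain_mapD[OF s] and fD = chain_mapD[OF f]
    and \<phi>D = chain_mapD[OF \<phi>] and ZD = cxD[OF cD(1)]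
  note A = HomD[OF cD(2)] HomD[OF cD(3)] HomD[OF cD(4)] HomD[OF cD(5)]
  \<comment> \<open>The identity is the sum of \<open>\<phi> = 1 - s\<close> and \<open>s\<close>.
    Since \<open>s\<close> kills maps from \<open>N\<close>, this lets maps be moved through
    \<open>\<phi>\<close> up to homotopy.\<close>
  have split: "k = (\<phi> n \<cdot> k) \<^bold>+ (s n \<cdot> k)" if "k \<in> Arr C" "Cod C k = cpt V n" for k n
    using that VD sD by (simp add: \<phi>_def add_assoc)
  define \<alpha> where "\<alpha> n = p n \<cdot> f n" for n
  define \<beta> where "\<beta> n = q n \<cdot> f n" for n
  have \<alpha>A: "\<alpha> n \<in> Arr C" "Dom C (\<alpha> n) = cpt N n" "Cod C (\<alpha> n) = cpt V (n + 1)" for n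
    using A fD by (simp_all add: \<alpha>_def)
  have \<beta>A: "\<beta> n \<in> Arr C" "Dom C (\<beta> n) = cpt N n" "Cod C (\<beta> n) = cpt V n" for n
    using A fD by (simp_all add: \<beta>_def)
  have \<alpha>d: "\<alpha> (n + 1) \<cdot> diff N n = neg (diff V (n + 1) \<cdot> \<alpha> n)" for n
  proof -
    have "\<alpha> (n + 1) \<cdot> diff N n = (p (n + 1) \<cdot> diff Z n) \<cdot> f n" using A fD ND ZD by (simp add: \<alpha>_def)
    then show ?thesis unfolding dZ(3) using A fD VD by (simp add: \<alpha>_def)
  qed
  have \<beta>d: "\<beta> (n + 1) \<cdot> diff N n = (\<phi> (n + 1) \<cdot> \<alpha> n) \<^bold>+ (diff V n \<cdot> \<beta> n)" for n
  proof -
    have "\<beta> (n + 1) \<cdot> diff N n = (q (n + 1) \<cdot> diff Z n) \<cdot> f n" using A fD ND ZD by (simp add: \<beta>_def)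
    then show ?thesis unfolding dZ(4) using A fD VD \<phi>D by (simp add: \<alpha>_def \<beta>_def)
  qed
  \<comment> \<open>The component of \<open>f\<close> in \<open>V[1]\<close> is a chain map, while
    the component \<open>\<beta>\<close> in \<open>V\<close> is one only up to the error
    \<open>\<phi> \<alpha>\<close>.\<close>
  have "\<alpha> \<in> chain_maps C N (shift 1 V)"
    by (rule chain_mapI) (use \<alpha>A \<alpha>d VD in \<open>simp_all add: Hom_iff\<close>)
  then have "null_homotopic N (shift 1 V) (\<lambda>n. s (n + 1) \<cdot> \<alpha> n)" using kills by (simp add: kills_def)
  then obtain v where v0: "\<And>n. v n \<in> Hom C (cpt N n) (cpt (shift 1 V) (n - 1))"
    "\<And>n. s (n + 1) \<cdot> \<alpha> n = (diff (shift 1 V) (n - 1) \<cdot> v n) \<^bold>+ (v (n + 1) \<cdot> diff N n)"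
    by (rule null_homotopicE) (rule that)
  note vA = HomD[OF v0(1), simplified]
  have v: "s (n + 1) \<cdot> \<alpha> n = neg (diff V n \<cdot> v n) \<^bold>+ (v (n + 1) \<cdot> diff N n)" for n
    using v0(2)[of n] vA VD by simp
  \<comment> \<open>\<open>\<alpha>\<close> is the sum of \<open>\<phi> \<alpha>\<close>, bounded by
    \<open>\<beta>\<close>, and of \<open>s \<alpha>\<close>, bounded by \<open>v\<close>; so
    \<open>u\<close> bounds \<open>\<alpha>\<close> itself.\<close>
  define u where "u n = \<beta> n \<^bold>+ v n" for n
  have uA: "u n \<in> Arr C" "Dom C (u n) = cpt N n" "Cod C (u n) = cpt V n" for n
    using \<beta>A vA by (simp_all add: u_def)
  have \<alpha>u: "\<alpha> n = (u (n + 1) \<cdot> diff N n) \<^bold>+ neg (diff V n \<cdot> u n)" for n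
  proof -
    have "\<phi> (n + 1) \<cdot> \<alpha> n = (\<beta> (n + 1) \<cdot> diff N n) \<^bold>+ neg (diff V n \<cdot> \<beta> n)"
      by (subst eq_add_neg_iff) (use \<beta>d[of n] \<phi>D \<alpha>A \<beta>A ND VD in simp_all)
    then have "\<alpha> n = ((\<beta> (n + 1) \<cdot> diff N n) \<^bold>+ neg (diff V n \<cdot> \<beta> n)) \<^bold>+
        (neg (diff V n \<cdot> v n) \<^bold>+ (v (n + 1) \<cdot> diff N n))"
      using split[of "\<alpha> n" "n + 1"] \<alpha>A v[of n] by simp
    then show ?thesis
      using \<beta>A vA ND VD by (simp add: u_def neg_add add_ac)
  qed
  \<comment> \<open>\<open>\<beta>\<close> and \<open>\<phi> u\<close> have the same boundary
    \<open>\<phi> \<alpha>\<close>, so their difference is a chain map and \<open>s \<gamma>\<close>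
    is null homotopic through \<open>t\<close>.\<close>
  define \<gamma> where "\<gamma> n = \<beta> n \<^bold>+ neg (\<phi> n \<cdot> u n)" for n
  have \<gamma>A: "\<gamma> n \<in> Arr C" "Dom C (\<gamma> n) = cpt N n" "Cod C (\<gamma> n) = cpt V n" for n
    using \<beta>A uA \<phi>D by (simp_all add: \<gamma>_def)
  have \<phi>\<alpha>: "\<phi> (n + 1) \<cdot> \<alpha> n = (\<phi> (n + 1) \<cdot> u (n + 1) \<cdot> diff N n) \<^bold>+ neg (diff V n \<cdot> \<phi> n \<cdot> u n)" for n
    unfolding \<alpha>u[of n] using uA ND VD \<phi>D chain_map_comm_comp[OF \<phi> V V, of "u n" n] by simp
  have \<gamma>: "\<gamma> \<in> chain_maps C N V"
  proof (rule chain_mapI)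
    fix n
    show "\<gamma> n \<in> Hom C (cpt N n) (cpt V n)" using \<gamma>A by (simp add: Hom_iff)
    let ?x = "\<phi> (n + 1) \<cdot> u (n + 1) \<cdot> diff N n" and ?y = "neg (diff V n \<cdot> \<phi> n \<cdot> u n)"
      and ?z = "diff V n \<cdot> \<beta> n"
    have "\<gamma> (n + 1) \<cdot> diff N n = (\<beta> (n + 1) \<cdot> diff N n) \<^bold>+ neg ?x"
      using \<beta>A uA \<phi>D ND VD by (simp add: \<gamma>_def)
    also have "\<dots> = ((?x \<^bold>+ ?y) \<^bold>+ ?z) \<^bold>+ neg ?x" unfolding \<beta>d \<phi>\<alpha> ..
    also have "\<dots> = ?z \<^bold>+ ?y"
      by (rule add_conjugate_cancel) (use \<beta>A uA \<phi>D ND VD in simp_all)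
    also have "\<dots> = diff V n \<cdot> \<gamma> n" using \<beta>A uA \<phi>D VD by (simp add: \<gamma>_def)
    finally show "\<gamma> (n + 1) \<cdot> diff N n = diff V n \<cdot> \<gamma> n" .
  qed
  then have "null_homotopic N V (\<lambda>n. s n \<cdot> \<gamma> n)" using kills by (simp add: kills_def)
  then obtain t where t: "\<And>n. t n \<in> Hom C (cpt N n) (cpt V (n - 1))"
    "\<And>n. s n \<cdot> \<gamma> n = (diff V (n - 1) \<cdot> t n) \<^bold>+ (t (n + 1) \<cdot> diff N n)"
    by (rule null_homotopicE) (rule that)
  note tA = HomD[OF t(1)]
  \<comment> \<open>Adding the chain map \<open>\<gamma>\<close> to \<open>u\<close> keeps the
    boundary equal to \<open>\<alpha>\<close> and changes \<open>\<phi> u\<close> by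
    \<open>\<phi> \<gamma>\<close>, which is \<open>\<gamma>\<close> up to the homotopy
    \<open>t\<close>; so \<open>\<beta>\<close> becomes \<open>\<phi> w\<close> plus the boundary of
    \<open>t\<close>.\<close>
  define w where "w n = u n \<^bold>+ \<gamma> n" for n
  have wA: "w n \<in> Arr C" "Dom C (w n) = cpt N n" "Cod C (w n) = cpt V n" for n
    using \<gamma>A uA by (simp_all add: w_def)
  have w\<alpha>: "(w (n + 1) \<cdot> diff N n) \<^bold>+ neg (diff V n \<cdot> w n) = \<alpha> n" for n
    unfolding \<alpha>u[of n] using chain_mapD(5)[OF \<gamma>, of n] uA \<gamma>A ND VD
    by (simp add: w_def neg_add add_assoc add_left_commute[of "diff V n \<cdot> \<gamma> n" "neg (diff V n \<cdot> u n)"])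
  have w\<beta>: "(\<phi> n \<cdot> w n) \<^bold>+ ((diff V (n - 1) \<cdot> t n) \<^bold>+ (t (n + 1) \<cdot> diff N n)) = \<beta> n" for n
  proof -
    have "(\<phi> n \<cdot> w n) \<^bold>+ (s n \<cdot> \<gamma> n) = (\<phi> n \<cdot> u n) \<^bold>+ ((\<phi> n \<cdot> \<gamma> n) \<^bold>+ (s n \<cdot> \<gamma> n))"
      using uA \<gamma>A \<phi>D sD by (simp add: w_def add_assoc)
    also have "\<dots> = (\<phi> n \<cdot> u n) \<^bold>+ \<gamma> n" using split[OF \<gamma>A(1,3)] by simp
    also have "\<dots> = \<beta> n"
      using \<beta>A uA \<phi>D by (simp add: \<gamma>_def add_left_commute[of "\<phi> n \<cdot> u n" "\<beta> n"])
    finally show ?thesis by (simp add: t(2))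
  qed
  show ?thesis
  \<comment> \<open>The null homotopy of \<open>f\<close> has component \<open>w\<close> in
    \<open>V[1]\<close> and \<open>t\<close> in \<open>V\<close>.\<close>
  proof (rule null_homotopicI[of "\<lambda>n. (a (n - 1) \<cdot> w n) \<^bold>+ (b (n - 1) \<cdot> t n)"])
    fix n
    have aA: "a (n - 1) \<in> Arr C" "Dom C (a (n - 1)) = cpt V n" "Cod C (a (n - 1)) = cpt Z (n - 1)"
      using HomD[OF cD(2)[of "n - 1"]] by simp_all
    show "(a (n - 1) \<cdot> w n) \<^bold>+ (b (n - 1) \<cdot> t n) \<in> Hom C (cpt N n) (cpt Z (n - 1))"
      using aA A tA wA by (simp add: Hom_iff)
    have za: "diff Z (n - 1) \<cdot> a (n - 1) \<cdot> w n = (b n \<cdot> \<phi> n \<cdot> w n) \<^bold>+ neg (a n \<cdot> diff V n \<cdot> w n)"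
      using comp_reduce[OF dZ(1)[of "n - 1"], of "w n"] aA ZD A wA VD \<phi>D by simp
    have zb: "diff Z (n - 1) \<cdot> b (n - 1) \<cdot> t n = b n \<cdot> diff V (n - 1) \<cdot> t n"
      using comp_reduce[OF dZ(2)[of "n - 1"], of "t n"] ZD A tA VD by simp
    have "f n = ((a n \<cdot> p n) \<^bold>+ (b n \<cdot> q n)) \<cdot> f n" unfolding cD(8) using fD ZD by simp
    also have "\<dots> = (a n \<cdot> \<alpha> n) \<^bold>+ (b n \<cdot> \<beta> n)" using A fD by (simp add: \<alpha>_def \<beta>_def)
    also have "\<dots> = (a n \<cdot> ((w (n + 1) \<cdot> diff N n) \<^bold>+ neg (diff V n \<cdot> w n))) \<^bold>+
        (b n \<cdot> ((\<phi> n \<cdot> w n) \<^bold>+ ((diff V (n - 1) \<cdot> t n) \<^bold>+ (t (n + 1) \<cdot> diff N n))))"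
      unfolding w\<alpha> w\<beta> ..
    also have "\<dots> = (diff Z (n - 1) \<cdot> ((a (n - 1) \<cdot> w n) \<^bold>+ (b (n - 1) \<cdot> t n))) \<^bold>+
        (((a n \<cdot> w (n + 1)) \<^bold>+ (b n \<cdot> t (n + 1))) \<cdot> diff N n)"
      using aA A tA wA ZD VD ND \<phi>D za zb by (simp add: add_ac)
    finally show "f n = (diff Z (n - 1) \<cdot> ((a (n - 1) \<cdot> w n) \<^bold>+ (b (n - 1) \<cdot> t n))) \<^bold>+
        (((a (n + 1 - 1) \<cdot> w (n + 1)) \<^bold>+ (b (n + 1 - 1) \<cdot> t (n + 1))) \<cdot> diff N n)" by simp
  qed
qed

end

section \<open>The telescope and its contraction\<close>

context homotopy_cat_coproducts
begin

text \<open>The vanishing result for coproducts in \<open>K\<close>, restated for chain maps and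
  null homotopies. It is applied both to the coproduct of the stages and to its shift.\<close>

lemma null_homotopic_phantom:
  fixes I :: "'i set"
  assumes wg: "well_generated_by U \<kappa> K G" and I: "small U I"
    and P: "cpt_coproduct I M P \<iota>" "cxB P" "\<And>i. i \<in> I \<Longrightarrow> cxB (M i)"
    and c: "c \<in> chain_maps C P Z" "cxB Z"
    and ph: "\<And>i N g. \<lbrakk>i \<in> I; N \<in> G; g \<in> chain_maps C N (M i)\<rbrakk> \<Longrightarrow>
      null_homotopic N Z (\<lambda>n. c n \<cdot> \<iota> i n \<cdot> g n)"
    and N: "N \<in> G" and f: "f \<in> chain_maps C N P"
  shows "null_homotopic N Z (\<lambda>n. c n \<cdot> f n)"
proof -
  interpret K: preadditive_category K by (rule K_preadditive)
  have GB: "cxB N" if "N \<in> G" for N using wg that by (auto simp: well_generated_by_def K_Ob)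
  note PD = cpt_coproductD[OF P(1)]
  note cx = cxB_cx[OF P(2)] cxB_cx[OF c(2)]
  have "cls P Z c \<cdot>\<^bsub>K\<^esub> cls N P f = hom_zero K N Z"
  proof (rule K.coproduct_of_phantoms[OF inaccessible wg I K_coproduct[OF P] K_HomI[OF P(2) c(2,1)]
        _ N K_HomI[OF GB[OF N] P(2) f]])
    fix i N' u assume i: "i \<in> I" and N': "N' \<in> G" and u: "u \<in> Hom K N' (M i)"
    obtain g where g: "g \<in> chain_maps C N' (M i)" "u = cls N' (M i) g"
      using u by (rule K_HomE) (rule that)
    note N'B = GB[OF N'] and MB = P(3)[OF i]
    have ig: "(\<lambda>n. \<iota> i n \<cdot> g n) \<in> chain_maps C N' P"
      by (rule chain_map_comp[OF cxB_cx[OF N'B] PD(2)[OF i] PD(1) PD(3)[OF i] g(1)])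
    have "cls P Z c \<cdot>\<^bsub>K\<^esub> cls (M i) P (\<iota> i) \<cdot>\<^bsub>K\<^esub> u = cls N' Z (\<lambda>n. c n \<cdot> \<iota> i n \<cdot> g n)"
      using K_comp[OF N'B MB P(2) PD(3)[OF i] g(1)] K_comp[OF N'B P(2) c(2,1) ig] g(2) by simp
    also have "\<dots> = hom_zero K N' Z"
      using K_cls_zero_iff[OF N'B c(2) chain_map_comp[OF cxB_cx[OF N'B] cx(1,2) c(1) ig]] ph[OF i N' g(1)]
      by simp
    finally show "cls P Z c \<cdot>\<^bsub>K\<^esub> cls (M i) P (\<iota> i) \<cdot>\<^bsub>K\<^esub> u = hom_zero K N' Z" .
  qed
  then show ?thesis
    using K_comp[OF GB[OF N] P(2) c(2,1) f]
      K_cls_zero_iff[OF GB[OF N] c(2) chain_map_comp[OF cxB_cx[OF GB[OF N]] cx c(1) f]] by simp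
qed

text \<open>
  Starting with \<open>X\<close> in degree 0, adjoin cones killing all maps from the generators, countably often. The
  telescope of the resulting sequence receives no maps from the generators, hence is contractible, and
  \<open>X\<close> splits off the part in degree \<open>-1\<close>, to which only the generators contribute.
\<close>

lemma retract_of_coproduct:
  assumes wg: "well_generated_by U \<kappa> K G" and ls: "locally_small U C"
    and S: "\<And>N n. N \<in> G \<Longrightarrow> cpt N n \<in> S" and Zo: "zero_object C Zo" "Zo \<in> S" and SB: "S \<subseteq> B"
    and X: "X \<in> B"
  shows "\<exists>P\<in>coproducts_of U C S. \<exists>s\<in>Hom C X P. \<exists>r\<in>Hom C P X. r \<cdot> s = Id C X"
proof -
  have GB: "cxB N" if "N \<in> G" for N using wg that by (auto simp: well_generated_by_def K_Ob)
  have G: "small U G" using wg by (simp add: well_generated_by_def)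
  have Xob: "X \<in> Ob C" and Zoob: "Zo \<in> Ob C" and ZoB: "Zo \<in> B" using X Zo SB B_ob by blast+
  \<comment> \<open>\<open>X\<close> in degree 0, a zero object of \<open>S\<close> elsewhere, so
    that degree -1 already consists of objects of \<open>S\<close>.\<close>
  define W0 :: "('o, 'm) cochain" where
    "W0 = \<lparr>cpt = \<lambda>n. if n = 0 then X else Zo,
       diff = \<lambda>n. zr (if n = 0 then X else Zo) (if n + 1 = 0 then X else Zo)\<rparr>"
  have W0: "cxB W0" unfolding complexes_def W0_def using X ZoB Xob Zoob by (auto simp: Hom_iff)
  \<comment> \<open>The invariant of a stage records degree -1 alone; this is the degree through
    which \<open>X\<close> is finally shown to factor.\<close>
  define A where "A k W \<longleftrightarrow> cxB W \<and> cpt W (- 1) \<in> coproducts_of U C S \<and> (k = 0 \<longrightarrow> W = W0)"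
    for k :: nat and W
  define A' where "A' W W' b q \<longleftrightarrow> b \<in> chain_maps C W W' \<and>
    (\<forall>n. q n \<in> Hom C (cpt W' n) (cpt W n)) \<and> (\<forall>n. q n \<cdot> b n = Id C (cpt W n)) \<and> kills G W W' b" for W W' b q
  have "\<exists>W. \<forall>k. A k (W k) \<and> (\<exists>b q. A' (W k) (W (Suc k)) b q)"
  proof (rule dependent_nat_choice)
    have "cpt W0 (- 1) \<in> coproducts_of U C S"
      using subset_coproducts_of[OF inaccessible category_axioms Zo(2)] SB B_ob by (auto simp: W0_def)
    then show "\<exists>W. A 0 W" using W0 by (auto simp: A_def)
  next
    fix W k assume "A k W"
    then have W: "cxB W" "cpt W (- 1) \<in> coproducts_of U C S" by (simp_all add: A_def)
    show "\<exists>W'. A (Suc k) W' \<and> (\<exists>b q. A' W W' b q)"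
      using ex_killing_map[OF ls G GB W S] unfolding A_def A'_def by blast
  qed
  then obtain W where "\<forall>k. A k (W k) \<and> (\<exists>b q. A' (W k) (W (Suc k)) b q)" by blast
  moreover from this obtain b q where "\<And>k. A' (W k) (W (Suc k)) (b k) (q k)" by metis
  ultimately have W: "\<And>k. cxB (W k)" "\<And>k. cpt (W k) (- 1) \<in> coproducts_of U C S" "W 0 = W0"
    and b: "\<And>k. b k \<in> chain_maps C (W k) (W (Suc k))"
    and q: "\<And>k n. q k n \<in> Hom C (cpt (W (Suc k)) n) (cpt (W k) n)"
    and qb: "\<And>k n. q k n \<cdot> b k n = Id C (cpt (W k) n)"
    and kb: "\<And>k. kills G (W k) (W (Suc k)) (b k)"
    unfolding A_def A'_def by blast+
  have Wcx: "\<And>k. cx (W k)" using cxB_cx[OF W(1)] .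
  obtain V \<iota> where VB: "cxB V" and V: "cpt_coproduct UNIV W V \<iota>"
    using ex_cpt_coproduct[of "UNIV :: nat set" W] small_countable(1)[OF inaccessible] W(1) by blast
  have Vcx: "cx V" and \<iota>: "\<And>k. \<iota> k \<in> chain_maps C (W k) V"
    and Vn: "\<And>n. coproduct C UNIV (\<lambda>k. cpt (W k) n) (cpt V n) (\<lambda>k. \<iota> k n)"
    using cpt_coproductD[OF V] by blast+
  have "(\<lambda>n. \<iota> (Suc k) n \<cdot> b k n) \<in> chain_maps C (W k) V" for k
    by (rule chain_map_comp[OF Wcx Wcx Vcx \<iota> b])
  \<comment> \<open>The shift map of the telescope: it moves the k-th stage into the next one along
    \<open>b k\<close>.\<close>
  then obtain s where s: "s \<in> chain_maps C V V" "\<And>k n. s n \<cdot> \<iota> k n = \<iota> (Suc k) n \<cdot> b k n"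
    using cpt_coproduct_map[OF V Vcx, of "\<lambda>k n. \<iota> (Suc k) n \<cdot> b k n"] by blast
  note sD = chain_mapD[OF s(1)] and \<iota>D = chain_mapD[OF \<iota>] and bD = chain_mapD[OF b]
  have s\<iota>g: "s n \<cdot> \<iota> k n \<cdot> g = \<iota> (Suc k) n \<cdot> b k n \<cdot> g" if "g \<in> Arr C" "Cod C g = cpt (W k) n" for k n g
    using comp_reduce[OF s(2)[of n k], of g] that sD \<iota>D bD by simp
  \<comment> \<open>On the k-th stage \<open>s\<close> factors through \<open>b k\<close>, which
    kills maps from generators; passing to the whole of \<open>V\<close> uses condition (3).\<close>
  have kills: "kills G V V s"
    unfolding kills_def
  proof (intro ballI conjI)
    fix N f assume N: "N \<in> G"
    {
      assume f: "f \<in> chain_maps C N V"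
      show "null_homotopic N V (\<lambda>n. s n \<cdot> f n)"
      proof (rule null_homotopic_phantom[OF wg small_countable(1)[OF inaccessible] V VB W(1) s(1) VB _ N f])
        fix k N' g assume N': "N' \<in> G" and g: "g \<in> chain_maps C N' (W k)"
        have "null_homotopic N' (W (Suc k)) (\<lambda>n. b k n \<cdot> g n)" using kb N' g by (simp add: kills_def)
        from null_homotopic_comp(1)[OF cxB_cx[OF GB[OF N']] Wcx Vcx this \<iota>]
        show "null_homotopic N' V (\<lambda>n. s n \<cdot> \<iota> k n \<cdot> g n)" using s\<iota>g chain_mapD[OF g] by simp
      qed
    next
      assume f: "f \<in> chain_maps C N (shift 1 V)"
      note sB = shift_complexes[OF _ B_ob]
      show "null_homotopic N (shift 1 V) (\<lambda>n. s (n + 1) \<cdot> f n)"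
      proof (rule null_homotopic_phantom[OF wg small_countable(1)[OF inaccessible] cpt_coproduct_shift[OF V]
            sB[OF VB] sB[OF W(1)] chain_map_shift[OF Vcx Vcx s(1)] sB[OF VB] _ N f])
        fix k N' g assume N': "N' \<in> G" and g: "g \<in> chain_maps C N' (shift 1 (W k))"
        have "null_homotopic N' (shift 1 (W (Suc k))) (\<lambda>n. b k (n + 1) \<cdot> g n)"
          using kb N' g by (simp add: kills_def)
        from null_homotopic_comp(1)[OF cxB_cx[OF GB[OF N']] shift_cx[OF Wcx] shift_cx[OF Vcx] this
            chain_map_shift[OF Wcx Vcx \<iota>]]
        show "null_homotopic N' (shift 1 V) (\<lambda>n. s (n + 1) \<cdot> \<iota> k (n + 1) \<cdot> g n)"
          using s\<iota>g chain_mapD[OF g] by simp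
      qed
    }
  qed
  define \<phi> where "\<phi> n = Id C (cpt V n) \<^bold>+ neg (s n)" for n
  have \<phi>: "\<phi> \<in> chain_maps C V V"
    unfolding \<phi>_def using chain_maps_closed[OF Vcx Vcx] chain_map_Id[OF Vcx] s(1) by blast
  obtain Z a b' p q' where ZB: "cxB Z" and cone: "is_cone V V \<phi> Z a b' p q'"
    using ex_cone[OF VB VB \<phi>] by blast
  have "null_homotopic N Z f" if "N \<in> G" "f \<in> chain_maps C N Z" for N f
    using cone_orthogonal[OF cxB_cx[OF GB[OF that(1)]] Vcx s(1) cone[unfolded \<phi>_def] _ that(2)] kills that(1)
    by (simp add: kills_def)
  then have "u = hom_zero K N Z" if "N \<in> G" "u \<in> Hom K N Z" for N u
    using that(2) K_cls_zero_iff[OF GB[OF that(1)] ZB] that(1) by (elim K_HomE) blast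
  then have "zero_object K Z"
    using wg ZB unfolding well_generated_by_def K_Ob by blast
  then obtain H where H: "\<And>n. H n \<in> Hom C (cpt Z n) (cpt Z (n - 1))"
    "\<And>n. Id C (cpt Z n) = (diff Z (n - 1) \<cdot> H n) \<^bold>+ (H (n + 1) \<cdot> diff Z n)"
    unfolding K_zero_object_iff[OF ZB] by (rule null_homotopicE) (rule that)
  note VD = cxD[OF Vcx] and ZD = cxD[OF cxB_cx[OF ZB]] and \<phi>D = chain_mapD[OF \<phi>]
  note cD = is_coneD[OF cone] and dZ = cone_diff[OF cone Vcx Vcx \<phi>]
  note A = HomD[OF cD(3)] HomD[OF cD(4)] HomD[OF cD(5)] HomD[OF H(1)]
  have X0: "cpt (W 0) 0 = X" by (simp add: W(3) W0_def)
  \<comment> \<open>The composite of the retractions \<open>q\<close> in degree 0 from the k-th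
    stage back to \<open>X\<close>. These retractions are not chain maps, so \<open>\<rho>\<close>
    is defined in degree 0 only.\<close>
  define \<rho> where "\<rho> = rec_nat (Id C X) (\<lambda>k r. r \<cdot> q k 0)"
  have \<rho>: "\<rho> k \<in> Hom C (cpt (W k) 0) X" for k
  proof (induction k)
    case 0
    then show ?case using id_hom[OF Xob] X0 by (simp add: \<rho>_def)
  next
    case (Suc k)
    then show ?case using comp_hom[OF Suc q] by (simp add: \<rho>_def)
  qed
  have \<rho>b: "\<rho> (Suc k) \<cdot> b k 0 = \<rho> k" for k
    using qb[of k 0] HomD[OF \<rho>[of k]] HomD[OF q[of k 0]] bD by (simp add: \<rho>_def)
  define r where "r = cotuple C UNIV (cpt V 0) (\<lambda>k. \<iota> k 0) X \<rho>"
  have r: "r \<in> Hom C (cpt V 0) X" "\<And>k. r \<cdot> \<iota> k 0 = \<rho> k"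
    using cotuple[OF Vn Xob, of \<rho> 0] \<rho> unfolding r_def by blast+
  note rD = HomD[OF r(1)]
  \<comment> \<open>The \<open>\<rho> k\<close> are compatible with the maps \<open>b k\<close>, so
    \<open>r\<close> does not see the shift map and vanishes on
    \<open>\<phi> = 1 - s\<close>.\<close>
  have rs: "r \<cdot> s 0 = r"
  proof (rule coproduct_eqI[OF Vn comp_hom[OF r(1) sD(1)] r(1) Xob category_axioms])
    fix k
    have "(r \<cdot> s 0) \<cdot> \<iota> k 0 = (r \<cdot> \<iota> (Suc k) 0) \<cdot> b k 0"
      using rD sD \<iota>D bD s(2) by simp
    then show "(r \<cdot> s 0) \<cdot> \<iota> k 0 = r \<cdot> \<iota> k 0" by (simp add: r(2) \<rho>b)
  qed
  have r\<phi>: "r \<cdot> \<phi> 0 = zr (cpt V 0) X"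
    using rD sD VD rs by (simp add: \<phi>_def)
  \<comment> \<open>\<open>?x\<close> is the image of \<open>X\<close> in degree 0 of the cone. It
    is a cycle, as the complex \<open>W0\<close> has zero differential, so the contraction gives
    \<open>?x = diff Z (- 1) \<cdot> H 0 \<cdot> ?x\<close>.\<close>
  let ?x = "b' 0 \<cdot> \<iota> 0 0" and ?t = "q' (- 1) \<cdot> H 0 \<cdot> b' 0 \<cdot> \<iota> 0 0"
  have \<iota>0: "\<iota> 0 0 \<in> Arr C" "Dom C (\<iota> 0 0) = X" "Cod C (\<iota> 0 0) = cpt V 0" using \<iota>D X0 by simp_all
  have H0: "H 0 \<in> Arr C" "Dom C (H 0) = cpt Z 0" "Cod C (H 0) = cpt Z (- 1)"
    using HomD[OF H(1)[of 0]] by simp_all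
  have p1: "p (- 1) \<in> Arr C" "Dom C (p (- 1)) = cpt Z (- 1)" "Cod C (p (- 1)) = cpt V 0"
    using HomD[OF cD(4)[of "- 1"]] by simp_all
  have dV1: "Cod C (diff V (- 1)) = cpt V 0" and dZ1: "Cod C (diff Z (- 1)) = cpt Z 0"
    using VD(4)[of "- 1"] ZD(4)[of "- 1"] by simp_all
  have W01: "diff (W 0) 0 = zr X Zo" "cpt (W 0) 1 = Zo" by (simp_all add: W(3) W0_def)
  have \<iota>1: "\<iota> 0 1 \<in> Arr C" "Dom C (\<iota> 0 1) = Zo" "Cod C (\<iota> 0 1) = cpt V 1"
    using \<iota>D(2-4)[of 0 1] W01(2) by simp_all
  have "diff V 0 \<cdot> \<iota> 0 0 = \<iota> 0 1 \<cdot> diff (W 0) 0" using chain_mapD(5)[OF \<iota>, of 0 0] by simp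
  also have "\<dots> = zr X (cpt V 1)"
    unfolding W01 using \<iota>1 Xob Zoob by simp
  finally have "diff Z 0 \<cdot> ?x = zr X (cpt Z 1)"
    using comp_reduce[OF dZ(2)[of 0], of "\<iota> 0 0"] A \<iota>0 VD ZD Xob by simp
  then have x: "?x = diff Z (- 1) \<cdot> H 0 \<cdot> ?x"
  proof -
    assume dx: "diff Z 0 \<cdot> ?x = zr X (cpt Z 1)"
    have "?x = ((diff Z (- 1) \<cdot> H 0) \<^bold>+ (H 1 \<cdot> diff Z 0)) \<cdot> ?x"
      using H(2)[of 0] A \<iota>0 ZD(1) by (metis (no_types, lifting) add_0 arr_Id_left arr_comp(1,3) diff_0)
    also have "\<dots> = (diff Z (- 1) \<cdot> H 0 \<cdot> ?x) \<^bold>+ (H 1 \<cdot> diff Z 0 \<cdot> ?x)"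
      using HomD[OF H(1)[of 1]] H0 A(1-3)[of 0] \<iota>0 ZD(2-4)[of 0] ZD(2-4)[of "- 1"] by simp
    also have "\<dots> = diff Z (- 1) \<cdot> H 0 \<cdot> ?x"
      unfolding dx using HomD[OF H(1)[of 1]] H0 A(1-3)[of 0] \<iota>0 ZD(2-4)[of "- 1"] Xob dZ1 by simp
    finally show ?thesis .
  qed
  have "Id C X = r \<cdot> \<iota> 0 0" by (simp add: r(2) \<rho>_def)
  also have "\<dots> = r \<cdot> q' 0 \<cdot> ?x"
    using comp_reduce[OF cD(7)[of 0], of "\<iota> 0 0"] A \<iota>0 VD by simp
  also have "\<dots> = r \<cdot> (q' 0 \<cdot> diff Z (- 1)) \<cdot> H 0 \<cdot> ?x"
    by (subst x) (use A(1-9)[of 0] H0 \<iota>0 ZD(2-3)[of "- 1"] dZ1 in simp)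
  \<comment> \<open>The \<open>W\<close>-row of the cone differential from degree -1 to 0 has two
    entries. The entry \<open>\<phi>\<close> is annihilated by \<open>r\<close>; the other is the
    differential of \<open>V\<close>, so the identity of \<open>X\<close> factors through degree -1
    of \<open>V\<close>.\<close>
  also have "\<dots> = r \<cdot> ((\<phi> 0 \<cdot> p (- 1)) \<^bold>+ (diff V (- 1) \<cdot> q' (- 1))) \<cdot> H 0 \<cdot> ?x"
    using dZ(4)[of "- 1"] by simp
  also have "\<dots> = ((r \<cdot> \<phi> 0) \<cdot> p (- 1) \<cdot> H 0 \<cdot> ?x) \<^bold>+ ((r \<cdot> diff V (- 1)) \<cdot> ?t)"
    using rD A(1-3)[of 0] A(7-9)[of "- 1"] H0 \<iota>0 p1 dV1 VD(2,3)[of "- 1"] \<phi>D(2-4)[of 0] by simp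
  also have "\<dots> = (r \<cdot> diff V (- 1)) \<cdot> ?t"
    unfolding r\<phi> using rD A(1-3)[of 0] A(7-9)[of "- 1"] H0 \<iota>0 p1 dV1 VD(2,3)[of "- 1"] Xob by simp
  finally have eq: "(r \<cdot> diff V (- 1)) \<cdot> ?t = Id C X" by simp
  moreover have "r \<cdot> diff V (- 1) \<in> Hom C (cpt V (- 1)) X"
    using rD dV1 VD(2,3)[of "- 1"] by (simp add: Hom_iff)
  moreover have "?t \<in> Hom C X (cpt V (- 1))"
    using A(1-3)[of 0] A(7-9)[of "- 1"] H0 \<iota>0 by (simp add: Hom_iff)
  moreover have "cpt V (- 1) \<in> coproducts_of U C S"
    by (rule closed_under_coproductsD[OF inaccessible category_axioms
        closed_coproducts_of[OF inaccessible category_axioms] Vn small_countable(1)[OF inaccessible]])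
      (rule W(2))
  ultimately show ?thesis by blast
qed

text \<open>\<open>S\<close> contains a zero object taken as an empty coproduct: it lies in
  \<open>B\<close> by closure under coproducts and fills the degrees of the complex concentrated at
  \<open>X\<close>.\<close>

lemma well_generated_K_imp:
  assumes acc: "accessible U C" and ls: "locally_small U C" and wg: "well_generated U K"
  shows "\<exists>S\<subseteq>B. small U S \<and> B \<subseteq> Add U C S"
proof -
  obtain \<kappa> :: "'u rel" and G where wg: "well_generated_by U \<kappa> K G"
    using wg unfolding well_generated_def by blast
  have GB: "cxB N" if "N \<in> G" for N using wg that by (auto simp: well_generated_by_def K_Ob)
  have G: "small U G" using wg by (simp add: well_generated_by_def)
  obtain Zo \<iota> where Zo: "coproduct C ({} :: 'u set) (\<lambda>_. undefined) Zo \<iota>"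
    using has_coproducts_small[OF inaccessible category_axioms has_coproducts, of "{} :: 'u set"]
      small_finite[OF inaccessible] by blast
  have ZoB: "Zo \<in> B"
    by (rule closed_under_coproductsD[OF inaccessible category_axioms closed_B Zo])
      (auto intro: small_finite[OF inaccessible])
  define S where "S = insert Zo (\<Union>N\<in>G. range (cpt N))"
  have "S \<subseteq> B" using ZoB complexes_cpt[OF GB] by (auto simp: S_def)
  moreover have "small U S"
    unfolding S_def
    by (intro small_insert[OF inaccessible] small_UNION[OF inaccessible] G small_image
        small_countable(2)[OF inaccessible])
  moreover have "X \<in> Add U C S" if X: "X \<in> B" for X
  proof -
    obtain P s r where P: "P \<in> coproducts_of U C S" and sr: "s \<in> Hom C X P" "r \<in> Hom C P X" "r \<cdot> s = Id C X"
      using retract_of_coproduct[OF wg ls _ coproduct_empty_zero_object[OF Zo] _ \<open>S \<subseteq> B\<close> X]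
      by (auto simp: S_def)
    obtain \<kappa>' :: "'u rel" where \<kappa>': "regular_cardinal \<kappa>'" "\<kappa>' <o U" "accessible_at U \<kappa>' C"
      using acc unfolding accessible_def by blast
    have "direct_summand C X P"
      by (rule retract_direct_summand_if_split[OF sr]) (rule idempotents_split[OF \<kappa>'])
    then show ?thesis using P unfolding coproducts_of_def Add_def by blast
  qed
  ultimately show ?thesis by blast
qed

end

theorem corollary4p10:
  fixes U :: "'u rel"
    and A :: "('o, 'm, 'z) preadd_scheme"
    and B :: "'o set"
  assumes "inaccessible U"
    and "locally_small U A"
    and "additive_category A"
    and "accessible U A"
    and "has_coproducts U A"
    and "B \<subseteq> Ob A"
    and "closed_under_coproducts U A B"
  shows "well_generated U (homotopy_category A B) \<longleftrightarrow>
    (\<exists>S \<subseteq> B. small U S \<and> B \<subseteq> Add U A S)"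
proof -
  interpret additive_category A by fact
  interpret homotopy_cat_coproducts A B U
    by unfold_locales fact+
  show ?thesis
    using K_well_generated[OF assms(4,2)] well_generated_K_imp[OF assms(4,2)] by blast
qed

end
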